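(* Assume the hypotheses below hold with some $q>4$ and $p\in[1,4)$. Let $b_n\to\infty$ be integers with $b_n/n^{2/(3\max(p,2))}\to0$ and $b_n/n^{(q-4)/(2q+4)}\to0$. Define $$Q_n(u)=\frac1n\sum_{t=\tau_n+L_n}^{\lfloor nu\rfloor-b_n}\frac1{b_n}\Big[Df(\hat\mu_{t-L_n,n})\sum_{i=1}^{b_n}(X_{t+i,n}-\hat\mu_{t-L_n,n})\Big]^2 .$$ Then, as $n\to\infty$, $Q_n(u)\to Q(u)=\int_0^uDf(\mu_v)\Sigma(v)Df(\mu_v)^T\,dv$ in probability, uniformly in $u\in[0,1]$, where $\Sigma(v)=\sum_{h=-\infty}^\infty\operatorname{Cov}(G(v,\boldsymbol{\epsilon}_0),G(v,\boldsymbol{\epsilon}_h))$.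
   Context: Model: $(\epsilon_i)_{i\in\mathbb Z}$ i.i.d. random variables, $(\epsilon^*_i)$ an independent copy; $\boldsymbol{\epsilon}_t=(\epsilon_t,\epsilon_{t-1},\dots)$, $\tilde{\boldsymbol{\epsilon}}_{t,j}=(\epsilon_t,\dots,\epsilon_{t-j+1},\epsilon^*_{t-j},\epsilon_{t-j-1},\dots)$. Measurable kernels $G_n,G:\mathbb R\times\mathbb R^\infty\to\mathbb R^d$, $X_{t,n}=G_n(t/n,\boldsymbol{\epsilon}_t)$, $t=1,\dots,n$. $\|Y\|_{L_q}=(\mathbb E\|Y\|^q)^{1/q}$; $\|G_n\|_{p\text{-var}}=\sup_{0=u_0<\dots<u_m=1}(\sum_i\|G_n(u_i,\boldsymbol{\epsilon}_0)-G_n(u_{i-1},\boldsymbol{\epsilon}_0)\|_{L_q}^p)^{1/p}$. (A.1) $\sup_u\|G_n(u,\boldsymbol{\epsilon}_0)-G(u,\boldsymbol{\epsilon}_0)\|_{L_q}\to0$. (A.2) $\sup_n\sup_u\|G_n(u,\boldsymbol{\epsilon}_0)\|_{L_q}+\sup_n\|G_n\|_{p\text{-var}}\le C_G<\infty$. (A.3) for some $\rho\in(0,1)$, $\|G_n(u,\boldsymbol{\epsilon}_t)-G_n(u,\tilde{\boldsymbol{\epsilon}}_{t,j})\|_{L_q}\le C_G\rho^j$ for all $j,n,u$. $\mu^n_u=\mathbb EG_n(u,\boldsymbol{\epsilon}_0)$, $\mu_u=\mathbb EG(u,\boldsymbol{\epsilon}_0)$, $\mathcal M=\mathrm{conv}\{\mu_u:u\in[0,1]\}$,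 $\mathcal M^\delta$ its open $\delta$-neighborhood. $f:\mathbb R^d\to\mathbb R$ twice differentiable with differential $Df\in\mathbb R^{1\times d}$, Hessian $D^2f$. (A.4) for some $\delta\in(0,\infty]$, $C_f<\infty$: $|f|+\|Df\|+\|D^2f\|\le C_f$ on $\mathcal M^\delta$. Pilot estimators $\hat\mu_{t,n}$ are $\sigma(\epsilon_t,\epsilon_{t-1},\dots)$-measurable; integer sequences $\tau_n\ge1$, $L_n\to\infty$, $L_n/\tau_n\to0$. (A.5) $\sum_{t=\tau_n}^n\|\hat\mu_{t,n}-\mu^n_{t/n}\|^2=o_P(\sqrt n)$. (A.6) $P(\hat\mu_{t,n}\in\mathcal M^\delta,\ t=\tau_n,\dots,n)\to1$. Further: $\tau_n/n\to0$, $\log(n)^{1+a}/L_n\to0$ for some $a\in(0,1)$, $L_n/n^{1/p-1/4}\to0$, $L_n/n^{1/(2p)}\to0$. *)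

theory Defs
  imports "HOL-Probability.Probability"
begin

text \<open>Bernoulli shift inputs: the infinite past vector at time t, and its coupled version
  where the entry at lag j (i.e. the innovation at time t - j) is replaced by the independent copy.\<close>

definition epsvec :: "(int \<Rightarrow> 'w \<Rightarrow> real) \<Rightarrow> int \<Rightarrow> 'w \<Rightarrow> nat \<Rightarrow> real" where
  "epsvec eps t \<omega> = (\<lambda>k. eps (t - int k) \<omega>)"

definition epstilde :: "(int \<Rightarrow> 'w \<Rightarrow> real) \<Rightarrow> (int \<Rightarrow> 'w \<Rightarrow> real) \<Rightarrow> int \<Rightarrow> nat \<Rightarrow> 'w \<Rightarrow> nat \<Rightarrow> real" where
  "epstilde eps epsS t j \<omega> = (\<lambda>k. if k = j then epsS (t - int j) \<omega> else eps (t - int k) \<omega>)"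

text \<open>q-th absolute moment  E ||Y||^q  (as an extended nonnegative real, so it may be infinite).
  The L_q norm is its (1/q)-th power; ||Y||_{L_q} <= c  iff  Lq_moment M q Y <= c^q.\<close>

definition Lq_moment :: "'w measure \<Rightarrow> real \<Rightarrow> ('w \<Rightarrow> 'a::real_normed_vector) \<Rightarrow> ennreal" where
  "Lq_moment M q Y = (\<integral>\<^sup>+ x. ennreal (norm (Y x) powr q) \<partial>M)"

text \<open>Real-valued L_q norm; only meaningful (and only used) where the moment is finite.\<close>
definition Lq_norm :: "'w measure \<Rightarrow> real \<Rightarrow> ('w \<Rightarrow> 'a::real_normed_vector) \<Rightarrow> real" where
  "Lq_norm M q Y = enn2real (Lq_moment M q Y) powr (1 / q)"

definition cov :: "'w measure \<Rightarrow> ('w \<Rightarrow> real) \<Rightarrow> ('w \<Rightarrow> real) \<Rightarrow> real" where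
  "cov M X Y = (\<integral>x. X x * Y x \<partial>M) - (\<integral>x. X x \<partial>M) * (\<integral>x. Y x \<partial>M)"

definition longrun_cov ::
  "'w measure \<Rightarrow> (int \<Rightarrow> 'w \<Rightarrow> real) \<Rightarrow> (real \<Rightarrow> (nat \<Rightarrow> real) \<Rightarrow> 'a::euclidean_space) \<Rightarrow> real \<Rightarrow> 'a \<Rightarrow> 'a \<Rightarrow> real" where
  "longrun_cov M eps G v i j =
     (\<Sum>\<^sub>\<infinity> h::int. cov M (\<lambda>\<omega>. G v (epsvec eps 0 \<omega>) \<bullet> i) (\<lambda>\<omega>. G v (epsvec eps h \<omega>) \<bullet> j))"

definition quad_form :: "('a::euclidean_space \<Rightarrow> 'a \<Rightarrow> real) \<Rightarrow> 'a \<Rightarrow> real" where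
  "quad_form S a = (\<Sum>i\<in>Basis. \<Sum>j\<in>Basis. (a \<bullet> i) * S i j * (a \<bullet> j))"

end

theory Submission
  imports Defs
begin

text \<open>
  Let \<open>S\<close> denote a window sum of centred observations of length \<open>b\<close>. Replacing the pilot
  estimators by the true means changes the average of the squared windows by little, pathwise:
  the crude moment bound \<open>\<parallel>S\<parallel> \<le> 2 b C\<close> in \<open>L\<^sub>q\<close> and a union bound give
  \<open>max \<parallel>S\<parallel>\<^sup>2 \<le> b \<surd>n\<close> with high probability, which is multiplied by the \<open>o\<^sub>P(\<surd>n)\<close> total squared
  pilot error, while the drift of the means inside a window is controlled by the finite \<open>p\<close>-variation.

  For the remaining average with deterministic weights, all innovations before a window may be
  replaced by independent copies at an exponentially small cost. Hence squared windows further apart than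
  \<open>b\<close> are nearly uncorrelated, and the variance of the average is of order \<open>b\<^sup>3 / n\<close>.
  The expectation is the integral of a step function that converges, by dominated convergence, to the long-run
  variance at every \<open>v\<close> where \<open>G\<close> is continuous in \<open>L\<^sub>q\<close>; by finite \<open>p\<close>-variation
  these are all but countably many \<open>v\<close>. Uniformity in \<open>u\<close> follows from monotonicity.
\<close>

section \<open>Bounds in \<open>L\<^sub>q\<close>\<close>

text \<open>The main obstacle is that the coupling hypothesis changes one innovation at a time,
  while decoupling requires the whole past to be replaced. This takes infinitely many steps, and the
  kernels are merely measurable, so coordinatewise convergence of their inputs does not by itself
  give convergence of their values. The limit is rescued by the fact that all partially replaced
  sequences have the same law: measurable functions then converge in probability, and Fatou's lemma
  keeps the bound.

  The moment and rate conditions have separate origins. Variances of squared windows use fourth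
  moments, and the crude window bound makes the variance of order \<open>b^3 / n\<close>. The term
  \<open>max p 2\<close> pays for passing from \<open>p\<close>-th powers of mean increments to
  squares when \<open>p > 2\<close>. The exponent containing \<open>q\<close> makes the union bound
  over about \<open>n\<close> windows vanish.

  Norm bounds are a predicate with a strictly positive real bound: dividing by the bound turns the
  classical norm inequalities into pointwise convexity inequalities, and finiteness need not be
  tracked separately.\<close>

definition lq_le :: "'w measure \<Rightarrow> real \<Rightarrow> ('w \<Rightarrow> 'a::euclidean_space) \<Rightarrow> real \<Rightarrow> bool" where
  "lq_le M q Y c \<longleftrightarrow> Y \<in> borel_measurable M \<and> 0 < c \<and>
     (\<integral>\<^sup>+x. ennreal ((norm (Y x) / c) powr q) \<partial>M) \<le> 1"

lemma lq_leD: "lq_le M q Y c \<Longrightarrow> Y \<in> borel_measurable M" "lq_le M q Y c \<Longrightarrow> 0 < c"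
  "lq_le M q Y c \<Longrightarrow> (\<integral>\<^sup>+x. ennreal ((norm (Y x) / c) powr q) \<partial>M) \<le> 1"
  by (auto simp: lq_le_def)

lemma lq_moment_scale:
  assumes [measurable]: "Y \<in> borel_measurable M" and "0 < c"
  shows "Lq_moment M q Y = ennreal (c powr q) * (\<integral>\<^sup>+x. ennreal ((norm (Y x) / c) powr q) \<partial>M)"
proof -
  have "ennreal (norm (Y x) powr q) = ennreal (c powr q) * ennreal ((norm (Y x) / c) powr q)" for x
    using assms by (simp add: ennreal_mult[symmetric] powr_divide)
  then show ?thesis
    unfolding Lq_moment_def by (simp add: nn_integral_cmult)
qed

lemma lq_le_iff_moment:
  assumes Y: "Y \<in> borel_measurable M" and c: "0 < c"
  shows "lq_le M q Y c \<longleftrightarrow> Lq_moment M q Y \<le> ennreal (c powr q)"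
proof -
  have c': "0 < c powr q" using c by simp
  have "Lq_moment M q Y \<le> ennreal (c powr q) \<longleftrightarrow>
     ennreal (c powr q) * (\<integral>\<^sup>+x. ennreal ((norm (Y x) / c) powr q) \<partial>M) \<le> ennreal (c powr q) * 1"
    using lq_moment_scale[OF Y c] by simp
  also have "\<dots> \<longleftrightarrow> (\<integral>\<^sup>+x. ennreal ((norm (Y x) / c) powr q) \<partial>M) \<le> 1"
    using c' by (subst ennreal_mult_le_mult_iff) auto
  finally show ?thesis using Y c by (simp add: lq_le_def)
qed

lemma lq_le_dom:
  assumes "lq_le M q Z c" and [measurable]: "Y \<in> borel_measurable M"
    and "c \<le> c'" and le: "\<And>x. x \<in> space M \<Longrightarrow> norm (Y x) / c' \<le> norm (Z x) / c" and "0 \<le> q"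
  shows "lq_le M q Y c'"
proof -
  have c: "0 < c" "0 < c'" using lq_leD(2)[OF assms(1)] assms(3) by auto
  have "(\<integral>\<^sup>+x. ennreal ((norm (Y x) / c') powr q) \<partial>M) \<le> (\<integral>\<^sup>+x. ennreal ((norm (Z x) / c) powr q) \<partial>M)"
    using c \<open>0 \<le> q\<close> le by (intro nn_integral_mono ennreal_leI powr_mono2) auto
  also have "\<dots> \<le> 1" by (rule lq_leD(3)[OF assms(1)])
  finally show ?thesis using c by (simp add: lq_le_def)
qed

lemma lq_le_mono:
  assumes "lq_le M q Y c" "c \<le> c'" "0 \<le> q"
  shows "lq_le M q Y c'"
  using assms by (intro lq_le_dom[OF assms(1)])
    (auto dest: lq_leD intro!: divide_left_mono simp: lq_le_def)

lemma lq_le_scaled: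
  assumes "lq_le M q Z c" "Y \<in> borel_measurable M" "\<And>x. x \<in> space M \<Longrightarrow> norm (Y x) \<le> K * norm (Z x)"
    "0 < K" "0 \<le> q"
  shows "lq_le M q Y (K * c)"
proof -
  have c: "0 < c" using lq_leD(2)[OF assms(1)] .
  have "norm (Y x) / (K * c) \<le> norm (Z x) / c" if "x \<in> space M" for x
    using assms(3)[OF that] c \<open>0 < K\<close> by (simp add: field_simps)
  then have "(\<integral>\<^sup>+x. ennreal ((norm (Y x) / (K * c)) powr q) \<partial>M) \<le> (\<integral>\<^sup>+x. ennreal ((norm (Z x) / c) powr q) \<partial>M)"
    using c \<open>0 < K\<close> \<open>0 \<le> q\<close> by (intro nn_integral_mono ennreal_leI powr_mono2) auto
  also have "\<dots> \<le> 1" by (rule lq_leD(3)[OF assms(1)])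
  finally show ?thesis using c assms by (simp add: lq_le_def)
qed

lemma lq_le_uminus: "lq_le M q Y c \<Longrightarrow> lq_le M q (\<lambda>x. - Y x) c"
  by (simp add: lq_le_def)

lemma lq_le_inner:
  assumes "lq_le M q Y c" "norm a \<le> K" "0 < K" "0 \<le> q"
  shows "lq_le M q (\<lambda>x. a \<bullet> Y x) (K * c)"
proof (rule lq_le_scaled[OF assms(1)])
  have [measurable]: "Y \<in> borel_measurable M" using assms(1) by (rule lq_leD)
  show "(\<lambda>x. a \<bullet> Y x) \<in> borel_measurable M" by measurable
  show "norm (a \<bullet> Y x) \<le> K * norm (Y x)" for x
    using Cauchy_Schwarz_ineq2[of a "Y x"] mult_right_mono[OF assms(2), of "norm (Y x)"] by simp
qed (use assms in auto)

lemma powr_convex_nonneg: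
  fixes x y s q :: real
  assumes "1 \<le> q" "0 \<le> x" "0 \<le> y" "0 \<le> s" "s \<le> 1"
  shows "((1 - s) * x + s * y) powr q \<le> (1 - s) * x powr q + s * y powr q"
proof -
  \<comment> \<open>If one of the two points is 0, only scaling is left, and
    \<open>r powr q \<le> r\<close> holds for \<open>r\<close> in [0,1] because
    \<open>q \<ge> 1\<close>.\<close>
  have *: "(r * z) powr q \<le> r * z powr q" if "0 \<le> r" "r \<le> 1" "0 \<le> z" for r z :: real
  proof -
    have "r powr q \<le> r powr 1" using that assms by (intro powr_mono') auto
    then show ?thesis using that by (simp add: powr_mult mult_right_mono)
  qed
  show ?thesis
  proof (cases "x = 0 \<or> y = 0")
    case True
    then show ?thesis using *[of s y] *[of "1 - s" x] assms by auto
  next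
    case False
    then show ?thesis using convex_onD[OF powr_convex[OF assms(1)], of s x y] assms by auto
  qed
qed

text \<open>Minkowski's inequality, by convexity of \<open>x powr q\<close> with weights proportional to the bounds.\<close>

lemma lq_le_add:
  assumes Y: "lq_le M q Y c" and Z: "lq_le M q Z d" and q: "1 \<le> q"
  shows "lq_le M q (\<lambda>x. Y x + Z x) (c + d)"
proof -
  note [measurable] = lq_leD(1)[OF Y] lq_leD(1)[OF Z]
  have cd: "0 < c" "0 < d" using lq_leD(2)[OF Y] lq_leD(2)[OF Z] .
  define s where "s = c / (c + d)"
  define s' where "s' = d / (c + d)"
  have s: "0 \<le> s" "0 \<le> s'" "s + s' = 1"
    using cd by (auto simp: s_def s'_def add_divide_distrib[symmetric])
  have pt: "(norm (Y x + Z x) / (c + d)) powr q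
      \<le> s * (norm (Y x) / c) powr q + s' * (norm (Z x) / d) powr q" for x
  proof -
    have "norm (Y x + Z x) / (c + d) \<le> (norm (Y x) + norm (Z x)) / (c + d)"
      using cd by (intro divide_right_mono norm_triangle_ineq) auto
    also have "\<dots> = s * (norm (Y x) / c) + s' * (norm (Z x) / d)"
      using cd by (simp add: s_def s'_def add_divide_distrib)
    finally have "(norm (Y x + Z x) / (c + d)) powr q \<le> (s * (norm (Y x) / c) + s' * (norm (Z x) / d)) powr q"
      using q cd by (intro powr_mono2) auto
    also have "\<dots> \<le> s * (norm (Y x) / c) powr q + s' * (norm (Z x) / d) powr q"
      using powr_convex_nonneg[OF q, of "norm (Y x) / c" "norm (Z x) / d" s'] s cd
      by (simp add: eq_diff_eq[symmetric])
    finally show ?thesis .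
  qed
  have "(\<integral>\<^sup>+x. ennreal ((norm (Y x + Z x) / (c + d)) powr q) \<partial>M)
      \<le> (\<integral>\<^sup>+x. ennreal s * ennreal ((norm (Y x) / c) powr q) + ennreal s' * ennreal ((norm (Z x) / d) powr q) \<partial>M)"
    using s pt by (intro nn_integral_mono) (simp add: ennreal_mult[symmetric] ennreal_plus[symmetric] del: ennreal_plus)
  also have "\<dots> = ennreal s * (\<integral>\<^sup>+x. ennreal ((norm (Y x) / c) powr q) \<partial>M)
      + ennreal s' * (\<integral>\<^sup>+x. ennreal ((norm (Z x) / d) powr q) \<partial>M)"
    by (simp add: nn_integral_add nn_integral_cmult)
  also have "\<dots> \<le> ennreal s * 1 + ennreal s' * 1"
    using lq_leD(3)[OF Y] lq_leD(3)[OF Z] by (intro add_mono mult_left_mono) auto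
  also have "\<dots> = 1" using s by (simp add: ennreal_plus[symmetric] del: ennreal_plus)
  finally show ?thesis using cd by (simp add: lq_le_def)
qed

lemma lq_le_diff:
  assumes "lq_le M q Y c" "lq_le M q Z d" "1 \<le> q"
  shows "lq_le M q (\<lambda>x. Y x - Z x) (c + d)"
  using lq_le_add[OF assms(1) lq_le_uminus[OF assms(2)] assms(3)] by simp

lemma lq_le_sum:
  assumes "finite I" "I \<noteq> {}" "1 \<le> q" "\<And>i. i \<in> I \<Longrightarrow> lq_le M q (Y i) (w i)"
  shows "lq_le M q (\<lambda>x. \<Sum>i\<in>I. Y i x) (\<Sum>i\<in>I. w i)"
  using assms
proof (induction I rule: finite_ne_induct)
  case (insert i I)
  then show ?case
    by (simp add: lq_le_add)
qed simp

text \<open>Cauchy-Schwarz: after division by the bounds it is the pointwise inequality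
  \<open>2 y z \<le> y^2 + z^2\<close>. The case \<open>s = 1\<close> serves covariances, the case
  \<open>s = 2\<close> squared windows; the latter is where fourth moments enter.\<close>

lemma lq_le_mult:
  fixes U V :: "'w \<Rightarrow> real"
  assumes U: "lq_le M (2 * s) U c" and V: "lq_le M (2 * s) V d"
  shows "lq_le M s (\<lambda>x. U x * V x) (c * d)"
proof -
  note [measurable] = lq_leD(1)[OF U] lq_leD(1)[OF V]
  have cd: "0 < c" "0 < d" using lq_leD(2)[OF U] lq_leD(2)[OF V] .
  have pt: "(norm (U x * V x) / (c * d)) powr s \<le>
     (1/2) * (norm (U x) / c) powr (2 * s) + (1/2) * (norm (V x) / d) powr (2 * s)" for x
  proof -
    define y where "y = (norm (U x) / c) powr s"
    define z where "z = (norm (V x) / d) powr s"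
    have "(norm (U x) / c) powr (2 * s) = y\<^sup>2" "(norm (V x) / d) powr (2 * s) = z\<^sup>2"
      by (simp_all add: y_def z_def power2_eq_square powr_add[symmetric])
    moreover have "(norm (U x * V x) / (c * d)) powr s = y * z"
      using cd by (simp add: y_def z_def powr_mult[symmetric] abs_mult)
    moreover have "0 \<le> (y - z)\<^sup>2" by simp
    ultimately show ?thesis by (simp add: power2_diff)
  qed
  have "(\<integral>\<^sup>+x. ennreal ((norm (U x * V x) / (c * d)) powr s) \<partial>M)
      \<le> (\<integral>\<^sup>+x. ennreal (1/2) * ennreal ((norm (U x) / c) powr (2 * s)) + ennreal (1/2) * ennreal ((norm (V x) / d) powr (2 * s)) \<partial>M)"
    using pt by (intro nn_integral_mono) (simp add: ennreal_mult[symmetric] ennreal_plus[symmetric] del: ennreal_plus ennreal_half)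
  also have "\<dots> = ennreal (1/2) * (\<integral>\<^sup>+x. ennreal ((norm (U x) / c) powr (2 * s)) \<partial>M)
      + ennreal (1/2) * (\<integral>\<^sup>+x. ennreal ((norm (V x) / d) powr (2 * s)) \<partial>M)"
    by (simp add: nn_integral_add nn_integral_cmult)
  also have "\<dots> \<le> ennreal (1/2) * 1 + ennreal (1/2) * 1"
    using lq_leD(3)[OF U] lq_leD(3)[OF V] by (intro add_mono mult_left_mono) auto
  also have "\<dots> = 1" by (simp add: ennreal_plus[symmetric] del: ennreal_plus ennreal_half)
  finally show ?thesis using cd by (simp add: lq_le_def)
qed

lemma lq_le_one_integral:
  assumes Y: "lq_le M 1 Y c"
  shows "integrable M Y" "norm (\<integral>x. Y x \<partial>M) \<le> c"
proof -
  note [measurable] = lq_leD(1)[OF Y]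
  have c: "0 < c" using lq_leD(2)[OF Y] .
  have le: "(\<integral>\<^sup>+x. ennreal (norm (Y x)) \<partial>M) \<le> ennreal c"
    using iffD1[OF lq_le_iff_moment[OF lq_leD(1)[OF Y] c] Y] c by (simp add: Lq_moment_def)
  show i: "integrable M Y"
    using le by (intro integrableI_bounded) (auto simp: le_less_trans[OF _ ennreal_less_top])
  have "ennreal (norm (\<integral>x. Y x \<partial>M)) \<le> (\<integral>\<^sup>+x. ennreal (norm (Y x)) \<partial>M)"
    by (rule integral_norm_bound_ennreal[OF i])
  also note le
  finally show "norm (\<integral>x. Y x \<partial>M) \<le> c" using c by simp
qed

section \<open>Comparison of norms, covariances and deviation bounds under a probability
  measure\<close>

context prob_space
begin

text \<open>Young's inequality against the constant 1 bounds the \<open>s\<close>-th power by a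
  convex combination of the \<open>q\<close>-th power and 1; total mass 1 then makes the integral at
  most 1.\<close>

lemma lq_le_lower:
  assumes Y: "lq_le M q Y c" and "0 < s" "s \<le> q"
  shows "lq_le M s Y c"
proof -
  note [measurable] = lq_leD(1)[OF Y]
  have c: "0 < c" using lq_leD(2)[OF Y] .
  define \<theta> where "\<theta> = s / q"
  have \<theta>: "0 \<le> \<theta>" "0 \<le> 1 - \<theta>" "\<theta> + (1 - \<theta>) = 1" using assms by (auto simp: \<theta>_def)
  have pt: "(norm (Y x) / c) powr s \<le> \<theta> * (norm (Y x) / c) powr q + (1 - \<theta>)" for x
  proof -
    have "(norm (Y x) / c) powr s = ((norm (Y x) / c) powr q) powr \<theta> * 1 powr (1 - \<theta>)"
      using assms by (simp add: \<theta>_def powr_powr)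
    also have "\<dots> \<le> \<theta> * (norm (Y x) / c) powr q + (1 - \<theta>) * 1"
      using \<theta> by (cases "Y x = 0") (auto intro!: Youngs_inequality_0[of \<theta> "1 - \<theta>" _ 1, simplified] simp: c less_imp_neq[OF c, symmetric])
    finally show ?thesis by simp
  qed
  have "(\<integral>\<^sup>+x. ennreal ((norm (Y x) / c) powr s) \<partial>M)
      \<le> (\<integral>\<^sup>+x. ennreal \<theta> * ennreal ((norm (Y x) / c) powr q) + ennreal (1 - \<theta>) \<partial>M)"
    using \<theta> pt by (intro nn_integral_mono) (simp add: ennreal_mult[symmetric] ennreal_plus[symmetric] del: ennreal_plus)
  also have "\<dots> = ennreal \<theta> * (\<integral>\<^sup>+x. ennreal ((norm (Y x) / c) powr q) \<partial>M) + ennreal (1 - \<theta>)"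
    by (simp add: nn_integral_add nn_integral_cmult emeasure_space_1)
  also have "\<dots> \<le> ennreal \<theta> * 1 + ennreal (1 - \<theta>)"
    using lq_leD(3)[OF Y] by (intro add_mono mult_left_mono) auto
  also have "\<dots> = 1" using \<theta> by (simp add: ennreal_plus[symmetric] del: ennreal_plus)
  finally show ?thesis using c by (simp add: lq_le_def)
qed

lemma lq_le_const: "0 < c \<Longrightarrow> norm a \<le> c \<Longrightarrow> 0 \<le> q \<Longrightarrow> lq_le M q (\<lambda>_. a) c"
  by (simp add: lq_le_def emeasure_space_1 ennreal_le_1 powr_le1)

lemma lq_le_integral:
  assumes "lq_le M q Y c" "1 \<le> q"
  shows "integrable M Y" "norm (\<integral>x. Y x \<partial>M) \<le> c"
  using lq_le_one_integral[OF lq_le_lower[OF assms(1), of 1]] assms(2) by auto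

lemma lq_le_2_mult_integral:
  fixes U V :: "'a \<Rightarrow> real"
  assumes U: "lq_le M 2 U c" and V: "lq_le M 2 V d"
  shows "integrable M (\<lambda>x. U x * V x)" "\<bar>\<integral>x. U x * V x \<partial>M\<bar> \<le> c * d"
proof -
  have "lq_le M 1 (\<lambda>x. U x * V x) (c * d)"
    using lq_le_mult[of M 1 U c V d] U V by simp
  from lq_le_one_integral[OF this]
  show "integrable M (\<lambda>x. U x * V x)" "\<bar>\<integral>x. U x * V x \<partial>M\<bar> \<le> c * d" by auto
qed

lemma cov_commute: "cov M U V = cov M V U"
  by (simp add: cov_def mult.commute)

text \<open>The mixed moment and the product of the means are each bounded by \<open>c * d\<close>,
  whence the factor 2.\<close>

lemma cov_bound:
  assumes U: "lq_le M 2 U c" and V: "lq_le M 2 V d"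
  shows "\<bar>cov M U V\<bar> \<le> 2 * c * d"
proof -
  have cd: "0 < c" "0 < d" using lq_leD(2)[OF U] lq_leD(2)[OF V] .
  have "\<bar>(\<integral>x. U x \<partial>M) * (\<integral>x. V x \<partial>M)\<bar> \<le> c * d"
    using lq_le_integral(2)[OF U] lq_le_integral(2)[OF V] cd by (auto simp: abs_mult intro!: mult_mono)
  with lq_le_2_mult_integral(2)[OF U V] show ?thesis unfolding cov_def by linarith
qed

lemma cov_diff_left:
  assumes "lq_le M 2 U c" "lq_le M 2 U' c'" "lq_le M 2 V d"
  shows "cov M (\<lambda>x. U x - U' x) V = cov M U V - cov M U' V"
  using lq_le_2_mult_integral(1)[OF assms(1,3)] lq_le_2_mult_integral(1)[OF assms(2,3)]
    lq_le_integral(1)[OF assms(1)] lq_le_integral(1)[OF assms(2)]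
  by (simp add: cov_def left_diff_distrib)

text \<open>One argument is exchanged at a time, \<open>U\<close> while \<open>V\<close> is kept and
  then \<open>V\<close> while \<open>U'\<close> is kept; this explains why exactly the bounds of
  \<open>V\<close> and \<open>U'\<close> appear.\<close>

lemma cov_diff_bound:
  assumes U: "lq_le M 2 U c" "lq_le M 2 U' c'" "lq_le M 2 (\<lambda>x. U x - U' x) \<delta>"
    and V: "lq_le M 2 V d" "lq_le M 2 V' d'" "lq_le M 2 (\<lambda>x. V x - V' x) \<eta>"
  shows "\<bar>cov M U V - cov M U' V'\<bar> \<le> 2 * \<delta> * d + 2 * c' * \<eta>"
proof -
  have "cov M U V - cov M U' V' = cov M (\<lambda>x. U x - U' x) V + cov M (\<lambda>x. V x - V' x) U'"
    unfolding cov_diff_left[OF U(1,2) V(1)] cov_diff_left[OF V(1,2) U(2)]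
    by (simp add: cov_commute[of U'])
  with cov_bound[OF U(3) V(1)] cov_bound[OF V(3) U(2)] show ?thesis
    by (simp add: mult_ac)
qed

lemma cov_sum:
  assumes "finite I" "finite J" "\<And>i. i \<in> I \<Longrightarrow> lq_le M 2 (U i) (c i)" "\<And>j. j \<in> J \<Longrightarrow> lq_le M 2 (V j) (d j)"
  shows "cov M (\<lambda>x. \<Sum>i\<in>I. U i x) (\<lambda>x. \<Sum>j\<in>J. V j x) = (\<Sum>i\<in>I. \<Sum>j\<in>J. cov M (U i) (V j))"
proof -
  have UV: "integrable M (\<lambda>x. U i x * V j x)" if "i \<in> I" "j \<in> J" for i j
    using lq_le_2_mult_integral(1) assms that by blast
  have U: "integrable M (U i)" if "i \<in> I" for i using lq_le_integral(1)[OF assms(3)] that by auto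
  have V: "integrable M (V j)" if "j \<in> J" for j using lq_le_integral(1)[OF assms(4)] that by auto
  have "(\<integral>x. (\<Sum>i\<in>I. U i x) * (\<Sum>j\<in>J. V j x) \<partial>M) = (\<Sum>i\<in>I. \<Sum>j\<in>J. \<integral>x. U i x * V j x \<partial>M)"
    by (simp add: sum_product UV Bochner_Integration.integral_sum)
  moreover have "(\<integral>x. (\<Sum>i\<in>I. U i x) \<partial>M) * (\<integral>x. (\<Sum>j\<in>J. V j x) \<partial>M)
     = (\<Sum>i\<in>I. \<Sum>j\<in>J. (\<integral>x. U i x \<partial>M) * (\<integral>x. V j x \<partial>M))"
    by (simp add: U V sum_product Bochner_Integration.integral_sum)
  ultimately show ?thesis by (simp add: cov_def sum_subtractf)
qed

lemma cov_scale: "cov M (\<lambda>x. a * U x) (\<lambda>x. b * V x) = a * b * cov M U V"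
proof -
  have "(\<lambda>x. a * U x * (b * V x)) = (\<lambda>x. (a * b) * (U x * V x))" by (auto simp: mult_ac)
  then show ?thesis by (simp add: cov_def algebra_simps)
qed

lemma markov_lq:
  assumes Y: "lq_le M q Y c" and "0 < e" "0 < q"
  shows "prob {x \<in> space M. e \<le> norm (Y x)} \<le> (c / e) powr q"
proof -
  note [measurable] = lq_leD(1)[OF Y]
  have c: "0 < c" using lq_leD(2)[OF Y] .
  have "emeasure M {x \<in> space M. e \<le> norm (Y x)}
     \<le> emeasure M {x \<in> space M. 1 \<le> ennreal ((c / e) powr q) * ennreal ((norm (Y x) / c) powr q)}"
  proof (rule emeasure_mono)
    have "1 \<le> (c / e) powr q * (norm (Y x) / c) powr q" if "e \<le> norm (Y x)" for x
    proof -
      have "(c / e) powr q * (norm (Y x) / c) powr q = (norm (Y x) / e) powr q"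
        using c \<open>0 < e\<close> by (simp add: powr_mult[symmetric])
      then show ?thesis using that \<open>0 < e\<close> \<open>0 < q\<close> by (simp add: ge_one_powr_ge_zero)
    qed
    then show "{x \<in> space M. e \<le> norm (Y x)} \<subseteq> {x \<in> space M. 1 \<le> ennreal ((c / e) powr q) * ennreal ((norm (Y x) / c) powr q)}"
      by (auto simp: ennreal_mult[symmetric] ennreal_1[symmetric] simp del: ennreal_1)
  qed measurable
  also have "\<dots> \<le> ennreal ((c / e) powr q) * (\<integral>\<^sup>+x. ennreal ((norm (Y x) / c) powr q) * indicator (space M) x \<partial>M)"
    by (rule nn_integral_Markov_inequality) auto
  also have "\<dots> \<le> ennreal ((c / e) powr q) * 1"
    using lq_leD(3)[OF Y] by (intro mult_left_mono) (auto cong: nn_integral_cong)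
  finally show ?thesis by (simp add: emeasure_eq_measure)
qed

text \<open>Chebyshev without independence: the variance is expanded into the double covariance sum,
  whose bound is supplied later by decoupling.\<close>

lemma lln_bound:
  fixes Y :: "'i \<Rightarrow> 'a \<Rightarrow> real"
  assumes "finite T" "\<And>t. t \<in> T \<Longrightarrow> lq_le M 2 (Y t) (c t)" "0 < e"
    and K: "(\<Sum>s\<in>T. \<Sum>t\<in>T. cov M (Y s) (Y t)) \<le> K"
  shows "prob {x \<in> space M. e \<le> \<bar>(\<Sum>t\<in>T. Y t x) - (\<Sum>t\<in>T. \<integral>x. Y t x \<partial>M)\<bar>} \<le> K / e\<^sup>2"
proof -
  have [measurable]: "Y t \<in> borel_measurable M" if "t \<in> T" for t using assms(2) that by (auto dest: lq_leD)
  define S where "S = (\<lambda>x. \<Sum>t\<in>T. Y t x)"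
  have iY: "integrable M (Y t)" if "t \<in> T" for t using lq_le_integral(1)[OF assms(2)[OF that]] by simp
  have iYY: "integrable M (\<lambda>x. Y s x * Y t x)" if "t \<in> T" "s \<in> T" for s t
    using lq_le_2_mult_integral(1) assms that by blast
  have iS: "integrable M S" unfolding S_def by (auto intro: iY)
  have iSS: "integrable M (\<lambda>x. (S x)\<^sup>2)"
    unfolding S_def power2_eq_square sum_product by (auto intro!: iYY Bochner_Integration.integrable_sum)
  have ES: "expectation S = (\<Sum>t\<in>T. \<integral>x. Y t x \<partial>M)"
    unfolding S_def by (simp add: Bochner_Integration.integral_sum iY)
  have "prob {x \<in> space M. e \<le> \<bar>S x - expectation S\<bar>} \<le> variance S / e\<^sup>2"
    using iS iSS \<open>0 < e\<close> by (intro Chebyshev_inequality) (auto simp: S_def)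
  also have "variance S = cov M S S"
    using variance_eq[OF iS iSS] by (simp add: cov_def power2_eq_square)
  also have "\<dots> = (\<Sum>s\<in>T. \<Sum>t\<in>T. cov M (Y s) (Y t))"
    unfolding S_def by (rule cov_sum[OF assms(1,1,2,2)])
  also have "\<dots> / e\<^sup>2 \<le> K / e\<^sup>2" using K by (intro divide_right_mono) auto
  finally show ?thesis unfolding ES by (simp add: S_def)
qed

end

section \<open>Functions of i.i.d. families\<close>

abbreviation seqM :: "('i \<Rightarrow> real) measure" where
  "seqM \<equiv> \<Pi>\<^sub>M i\<in>UNIV. borel"

text \<open>The index set is arbitrary so that the innovations and their copies form one family over
  a sum type; every coupling is then just a change of indices.\<close>

locale iid_family = prob_space M for M :: "'w measure" +
  fixes E :: "'k \<Rightarrow> 'w \<Rightarrow> real" and D :: "real measure"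
  assumes E_indep: "indep_vars (\<lambda>_. borel) E UNIV"
    and E_ident: "\<And>k. distr M borel (E k) = D"
begin

lemma E_meas [measurable]: "E k \<in> borel_measurable M"
  using E_indep by (auto simp: indep_vars_def)

definition reindex :: "('i \<Rightarrow> 'k) \<Rightarrow> 'w \<Rightarrow> 'i \<Rightarrow> real" where
  "reindex \<sigma> \<omega> = (\<lambda>i. E (\<sigma> i) \<omega>)"

lemma reindex_meas [measurable]: "reindex \<sigma> \<in> M \<rightarrow>\<^sub>M seqM"
  unfolding reindex_def by (rule measurable_PiM_single') (auto simp: space_PiM)

text \<open>An injective index map selects distinct coordinates, so either law is a product of
  copies of \<open>D\<close>. Stationarity in time and the equality in law of coupled sequences are
  both instances.\<close>

lemma reindex_law:
  fixes \<sigma> \<tau> :: "'i \<Rightarrow> 'k"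
  assumes "inj \<sigma>" "inj \<tau>"
  shows "distr M seqM (reindex \<sigma>) = distr M seqM (reindex \<tau>)"
proof -
  have "distr M seqM (reindex \<upsilon>) = (\<Pi>\<^sub>M i\<in>UNIV. D)" if "inj \<upsilon>" for \<upsilon> :: "'i \<Rightarrow> 'k"
  proof -
    have D: "sets D = sets borel" "prob_space D"
      using E_ident prob_space_distr[OF E_meas] by (metis sets_distr)+
    have "distr M seqM (\<lambda>\<omega>. \<lambda>k\<in>UNIV. E k \<omega>) = (\<Pi>\<^sub>M k\<in>UNIV. distr M borel (E k))"
      using E_indep by (subst (asm) indep_vars_iff_distr_eq_PiM) auto
    then have PiM_eq: "distr M seqM (\<lambda>\<omega> k. E k \<omega>) = (\<Pi>\<^sub>M k\<in>UNIV. D)"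
      by (simp add: E_ident restrict_def)
    have "(\<Pi>\<^sub>M i\<in>UNIV. D) = distr (\<Pi>\<^sub>M k\<in>UNIV. D) (\<Pi>\<^sub>M i\<in>UNIV. D) (\<lambda>x i. x (\<upsilon> i))"
      using distr_PiM_reindex[of UNIV "\<lambda>_. D" \<upsilon> UNIV] D(2) that by (simp add: restrict_def)
    also have "\<dots> = distr (distr M seqM (\<lambda>\<omega> k. E k \<omega>)) seqM (\<lambda>x i. x (\<upsilon> i))"
      unfolding PiM_eq by (rule distr_cong) (auto intro!: sets_PiM_cong simp: D)
    also have "\<dots> = distr M seqM (reindex \<upsilon>)"
      by (subst distr_distr) (auto simp: comp_def reindex_def[abs_def] intro!: measurable_PiM_single')
    finally show ?thesis ..
  qed
  with assms show ?thesis by simp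
qed

lemma reindex_nn_integral:
  assumes "inj \<sigma>" "inj \<tau>" and [measurable]: "\<phi> \<in> borel_measurable seqM"
  shows "(\<integral>\<^sup>+\<omega>. \<phi> (reindex \<sigma> \<omega>) \<partial>M) = (\<integral>\<^sup>+\<omega>. \<phi> (reindex \<tau> \<omega>) \<partial>M)"
  using reindex_law[OF assms(1,2)] nn_integral_distr[of "reindex \<sigma>" M seqM \<phi>]
    nn_integral_distr[of "reindex \<tau>" M seqM \<phi>] by simp

lemma reindex_integral:
  fixes \<phi> :: "('i \<Rightarrow> real) \<Rightarrow> 'b::{banach, second_countable_topology}"
  assumes "inj \<sigma>" "inj \<tau>" and [measurable]: "\<phi> \<in> borel_measurable seqM"
  shows "(\<integral>\<omega>. \<phi> (reindex \<sigma> \<omega>) \<partial>M) = (\<integral>\<omega>. \<phi> (reindex \<tau> \<omega>) \<partial>M)"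
  using reindex_law[OF assms(1,2)] integral_distr[of "reindex \<sigma>" M seqM \<phi>]
    integral_distr[of "reindex \<tau>" M seqM \<phi>] by simp

lemma reindex_prob:
  assumes "inj \<sigma>" "inj \<tau>" "A \<in> sets seqM"
  shows "prob {\<omega> \<in> space M. reindex \<sigma> \<omega> \<in> A} = prob {\<omega> \<in> space M. reindex \<tau> \<omega> \<in> A}"
proof -
  have "prob {\<omega> \<in> space M. reindex \<upsilon> \<omega> \<in> A} = measure (distr M seqM (reindex \<upsilon>)) A" for \<upsilon>
    using assms(3) by (subst measure_distr) (auto intro!: arg_cong[where f=prob])
  with reindex_law[OF assms(1,2)] show ?thesis by simp
qed

lemma reindex_lq_le:
  assumes "inj \<sigma>" "inj \<tau>" "\<phi> \<in> borel_measurable seqM"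
  shows "lq_le M q (\<lambda>\<omega>. \<phi> (reindex \<sigma> \<omega>)) c \<longleftrightarrow> lq_le M q (\<lambda>\<omega>. \<phi> (reindex \<tau> \<omega>)) c"
proof -
  have [measurable]: "\<phi> \<in> borel_measurable seqM" by fact
  show ?thesis unfolding lq_le_def
    using reindex_nn_integral[OF assms(1,2), of "\<lambda>x. ennreal ((norm (\<phi> x) / c) powr q)"] by simp
qed

text \<open>Disjointness of the ranges, not injectivity, is what separates the two groups of
  coordinates; the decoupling step uses an index map that repeats a coordinate.\<close>

lemma reindex_indep:
  fixes \<sigma> :: "'i \<Rightarrow> 'k" and \<tau> :: "'j \<Rightarrow> 'k"
  assumes disj: "range \<sigma> \<inter> range \<tau> = {}"
    and [measurable]: "\<phi> \<in> borel_measurable seqM" "\<psi> \<in> borel_measurable seqM"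
    and "integrable M (\<lambda>\<omega>. \<phi> (reindex \<sigma> \<omega>))" "integrable M (\<lambda>\<omega>. \<psi> (reindex \<tau> \<omega>))"
  shows "(\<integral>\<omega>. \<phi> (reindex \<sigma> \<omega>) * \<psi> (reindex \<tau> \<omega>) \<partial>M)
    = (\<integral>\<omega>. \<phi> (reindex \<sigma> \<omega>) \<partial>M) * (\<integral>\<omega>. (\<psi> (reindex \<tau> \<omega>) :: real) \<partial>M)"
proof -
  let ?A = "range \<sigma>" and ?B = "range \<tau>"
  have 1: "indep_var (PiM ?A (\<lambda>_. borel)) (\<lambda>\<omega>. \<lambda>k\<in>?A. E k \<omega>) (PiM ?B (\<lambda>_. borel)) (\<lambda>\<omega>. \<lambda>k\<in>?B. E k \<omega>)"
    by (rule indep_var_restrict[OF E_indep]) (use disj in auto)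
  have m: "(\<lambda>x i. x (\<upsilon> i)) \<in> (\<Pi>\<^sub>M k\<in>range \<upsilon>. borel) \<rightarrow>\<^sub>M (seqM :: ('l \<Rightarrow> real) measure)"
    for \<upsilon> :: "'l \<Rightarrow> 'k"
    by (rule measurable_PiM_single') (auto simp: space_PiM)
  have "indep_var borel (\<phi> \<circ> (\<lambda>x i. x (\<sigma> i)) \<circ> (\<lambda>\<omega>. \<lambda>k\<in>?A. E k \<omega>)) borel (\<psi> \<circ> (\<lambda>x i. x (\<tau> i)) \<circ> (\<lambda>\<omega>. \<lambda>k\<in>?B. E k \<omega>))"
    by (rule indep_var_compose[OF 1]) (auto intro!: measurable_comp[OF m])
  also have "\<phi> \<circ> (\<lambda>x i. x (\<sigma> i)) \<circ> (\<lambda>\<omega>. \<lambda>k\<in>?A. E k \<omega>) = (\<lambda>\<omega>. \<phi> (reindex \<sigma> \<omega>))"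
    by (auto simp: fun_eq_iff reindex_def)
  also have "\<psi> \<circ> (\<lambda>x i. x (\<tau> i)) \<circ> (\<lambda>\<omega>. \<lambda>k\<in>?B. E k \<omega>) = (\<lambda>\<omega>. \<psi> (reindex \<tau> \<omega>))"
    by (auto simp: fun_eq_iff reindex_def)
  finally show ?thesis using assms(4,5) by (rule indep_var_lebesgue_integral)
qed

text \<open>The sets with this property form a sigma-algebra containing the cylinders.\<close>

lemma reindex_set_converges:
  fixes \<sigma> :: "nat \<Rightarrow> 'i \<Rightarrow> 'k" and \<tau> :: "'i \<Rightarrow> 'k"
  assumes inj: "\<And>J. inj (\<sigma> J)" "inj \<tau>" and ev: "\<And>i. \<forall>\<^sub>F J in sequentially. \<sigma> J i = \<tau> i"
    and A: "A \<in> sets seqM"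
  shows "(\<lambda>J. prob {\<omega> \<in> space M. (reindex (\<sigma> J) \<omega> \<in> A) \<noteq> (reindex \<tau> \<omega> \<in> A)}) \<longlonglongrightarrow> 0"
proof -
  let ?\<Omega> = "UNIV :: ('i \<Rightarrow> real) set"
  let ?P = "\<lambda>A. (\<lambda>J. prob {\<omega> \<in> space M. (reindex (\<sigma> J) \<omega> \<in> A) \<noteq> (reindex \<tau> \<omega> \<in> A)}) \<longlonglongrightarrow> 0"
  have sets: "sets (seqM :: ('i \<Rightarrow> real) measure)
      = sigma_sets ?\<Omega> {{f. f i \<in> B} |i B. B \<in> sets (borel :: real measure)}"
    using sets_PiM_single[of "UNIV :: 'i set" "\<lambda>_. borel :: real measure"] by simp
  have "A \<in> sigma_sets ?\<Omega> {{f. f i \<in> B} |i B. B \<in> sets (borel :: real measure)}"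
    using A sets by simp
  then show ?thesis
  proof (induction rule: sigma_sets.induct)
    case (Basic a)
    then obtain i B where a: "a = {f. f i \<in> B}" by auto
    have "\<forall>\<^sub>F J in sequentially. prob {\<omega> \<in> space M. (reindex (\<sigma> J) \<omega> \<in> a) \<noteq> (reindex \<tau> \<omega> \<in> a)} = 0"
      using ev[of i] by eventually_elim (simp add: a reindex_def)
    then show ?case by (rule tendsto_eventually)
  next
    case Empty
    then show ?case by simp
  next
    case (Compl a)
    then show ?case by (simp add: not_less)
  next
    case (Union a)
    have a_sets [measurable]: "a k \<in> sets seqM" for k using Union(1) sets by simp
    \<comment> \<open>The part of the union missed by the first \<open>K\<close> sets has small
      probability for \<open>\<tau>\<close>. Since every \<open>\<sigma> J\<close> induces the same
      law, it is equally small for all \<open>J\<close> at once, and only finitely many sets remain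
      to be compared.\<close>
    define R where "R = (\<lambda>K. (\<Union>k. a k) - (\<Union>k<K. a k))"
    have R_sets [measurable]: "R K \<in> sets seqM" for K unfolding R_def by measurable
    let ?r = "\<lambda>K. prob {\<omega> \<in> space M. reindex \<tau> \<omega> \<in> R K}"
    have "?r \<longlonglongrightarrow> prob (\<Inter>K. {\<omega> \<in> space M. reindex \<tau> \<omega> \<in> R K})"
      by (rule finite_Lim_measure_decseq) (auto simp: decseq_def R_def)
    moreover have "(\<Inter>K. {\<omega> \<in> space M. reindex \<tau> \<omega> \<in> R K}) = {}"
      by (auto simp: R_def)
    ultimately have r0: "?r \<longlonglongrightarrow> 0" by simp
    show ?case
    proof (rule LIMSEQ_I)
      fix e :: real assume "0 < e"
      then obtain K where K: "?r K < e / 3"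
        using LIMSEQ_D[OF r0, of "e / 3"] by (auto simp: dest!: spec)
      let ?d = "\<lambda>k J. prob {\<omega> \<in> space M. (reindex (\<sigma> J) \<omega> \<in> a k) \<noteq> (reindex \<tau> \<omega> \<in> a k)}"
      have "(\<lambda>J. \<Sum>k<K. ?d k J) \<longlonglongrightarrow> (\<Sum>k<K. 0)"
        by (intro tendsto_sum Union(2))
      from LIMSEQ_D[OF this, of "e / 3"] \<open>0 < e\<close>
      obtain N where N: "\<And>J. J \<ge> N \<Longrightarrow> (\<Sum>k<K. ?d k J) < e / 3" by (force simp: sum_nonneg)
      have "prob {\<omega> \<in> space M. (reindex (\<sigma> J) \<omega> \<in> (\<Union>k. a k)) \<noteq> (reindex \<tau> \<omega> \<in> (\<Union>k. a k))} < e"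
        if "J \<ge> N" for J
      proof -
        let ?B = "\<Union>k<K. {\<omega> \<in> space M. (reindex (\<sigma> J) \<omega> \<in> a k) \<noteq> (reindex \<tau> \<omega> \<in> a k)}"
        let ?r1 = "{\<omega> \<in> space M. reindex (\<sigma> J) \<omega> \<in> R K}" and ?r2 = "{\<omega> \<in> space M. reindex \<tau> \<omega> \<in> R K}"
        have Bk: "{\<omega> \<in> space M. (reindex (\<sigma> J) \<omega> \<in> a k) \<noteq> (reindex \<tau> \<omega> \<in> a k)} \<in> events" for k
          by measurable
        have "prob {\<omega> \<in> space M. (reindex (\<sigma> J) \<omega> \<in> (\<Union>k. a k)) \<noteq> (reindex \<tau> \<omega> \<in> (\<Union>k. a k))}
          \<le> prob (?B \<union> (?r1 \<union> ?r2))"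
        proof (rule finite_measure_mono)
          show "{\<omega> \<in> space M. (reindex (\<sigma> J) \<omega> \<in> (\<Union>k. a k)) \<noteq> (reindex \<tau> \<omega> \<in> (\<Union>k. a k))} \<subseteq> ?B \<union> (?r1 \<union> ?r2)"
            by (auto simp: R_def)
        qed measurable
        also have "\<dots> \<le> prob ?B + prob (?r1 \<union> ?r2)"
          by (rule measure_Un_le) measurable
        also have "prob (?r1 \<union> ?r2) \<le> prob ?r1 + prob ?r2"
          by (rule measure_Un_le) measurable
        also have "prob ?B \<le> (\<Sum>k<K. ?d k J)"
          by (rule finite_measure_subadditive_finite) (use Bk in auto)
        also have "prob ?r1 = prob ?r2"
          by (rule reindex_prob[OF inj]) measurable
        finally show ?thesis using K N[OF that] by simp
      qed
      then show "\<exists>no. \<forall>n\<ge>no. norm (prob {\<omega> \<in> space M. (reindex (\<sigma> n) \<omega> \<in> (\<Union>k. a k)) \<noteq> (reindex \<tau> \<omega> \<in> (\<Union>k. a k))} - 0) < e"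
        by auto
    qed
  qed
qed

text \<open>As \<open>g\<close> need not be continuous, its values are compared through countably
  many preimages of balls of radius \<open>\<eta> / 2\<close>. Finitely many of them carry almost
  all the mass, and if both arguments lie in a common one, the values are closer than
  \<open>\<eta>\<close>.\<close>

lemma reindex_converges_in_prob:
  fixes \<sigma> :: "nat \<Rightarrow> 'i \<Rightarrow> 'k" and \<tau> :: "'i \<Rightarrow> 'k" and g :: "('i \<Rightarrow> real) \<Rightarrow> 'b::euclidean_space"
  assumes inj: "\<And>J. inj (\<sigma> J)" "inj \<tau>" and ev: "\<And>i. \<forall>\<^sub>F J in sequentially. \<sigma> J i = \<tau> i"
    and g [measurable]: "g \<in> borel_measurable seqM" and "0 < \<eta>"
  shows "(\<lambda>J. prob {\<omega> \<in> space M. \<eta> \<le> dist (g (reindex (\<sigma> J) \<omega>)) (g (reindex \<tau> \<omega>))}) \<longlonglongrightarrow> 0"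
proof (rule LIMSEQ_I)
  fix e :: real assume "0 < e"
  obtain D' :: "'b set" where D': "countable D'" "\<And>X. open X \<Longrightarrow> X \<noteq> {} \<Longrightarrow> \<exists>d\<in>D'. d \<in> X"
    using countable_dense_exists by blast
  have D0: "D' \<noteq> {}" using D'(2)[of UNIV] by auto
  define c where "c = from_nat_into D'"
  have c: "\<exists>k. x \<in> ball (c k) (\<eta> / 2)" for x
  proof -
    obtain d where "d \<in> D'" "d \<in> ball x (\<eta> / 2)" using D'(2)[of "ball x (\<eta>/2)"] \<open>0 < \<eta>\<close> by auto
    moreover obtain k where "c k = d" unfolding c_def using from_nat_into_surj[OF D'(1) \<open>d \<in> D'\<close>] by auto
    ultimately show ?thesis by (auto simp: dist_commute)
  qed
  define a where "a = (\<lambda>k. {x. g x \<in> ball (c k) (\<eta> / 2)})"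
  have a_sets [measurable]: "a k \<in> sets seqM" for k
    using measurable_sets[OF g, of "ball (c k) (\<eta> / 2)"]
    by (simp add: a_def vimage_def space_PiM del: mem_ball)
  let ?r = "\<lambda>K. prob {\<omega> \<in> space M. \<forall>k<K. reindex \<tau> \<omega> \<notin> a k}"
  have "?r \<longlonglongrightarrow> prob (\<Inter>K. {\<omega> \<in> space M. \<forall>k<K. reindex \<tau> \<omega> \<notin> a k})"
    by (rule finite_Lim_measure_decseq) (auto simp: decseq_def)
  moreover have "(\<Inter>K. {\<omega> \<in> space M. \<forall>k<K. reindex \<tau> \<omega> \<notin> a k}) = {}"
    using c by (fastforce simp: a_def)
  ultimately have "?r \<longlonglongrightarrow> 0" by simp
  then obtain K where K: "?r K < e / 2"
    using LIMSEQ_D[of ?r 0 "e / 2"] \<open>0 < e\<close> by auto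
  let ?d = "\<lambda>k J. prob {\<omega> \<in> space M. (reindex (\<sigma> J) \<omega> \<in> a k) \<noteq> (reindex \<tau> \<omega> \<in> a k)}"
  have "(\<lambda>J. \<Sum>k<K. ?d k J) \<longlonglongrightarrow> (\<Sum>k<K. 0)"
    by (intro tendsto_sum reindex_set_converges inj ev) measurable
  from LIMSEQ_D[OF this, of "e / 2"] \<open>0 < e\<close>
  obtain N where N: "\<And>J. J \<ge> N \<Longrightarrow> (\<Sum>k<K. ?d k J) < e / 2" by (force simp: sum_nonneg)
  have "prob {\<omega> \<in> space M. \<eta> \<le> dist (g (reindex (\<sigma> J) \<omega>)) (g (reindex \<tau> \<omega>))} < e" if "J \<ge> N" for J
  proof -
    let ?B = "\<Union>k<K. {\<omega> \<in> space M. (reindex (\<sigma> J) \<omega> \<in> a k) \<noteq> (reindex \<tau> \<omega> \<in> a k)}"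
    let ?C = "{\<omega> \<in> space M. \<forall>k<K. reindex \<tau> \<omega> \<notin> a k}"
    have Bk: "{\<omega> \<in> space M. (reindex (\<sigma> J) \<omega> \<in> a k) \<noteq> (reindex \<tau> \<omega> \<in> a k)} \<in> events" for k
      by measurable
    have "prob {\<omega> \<in> space M. \<eta> \<le> dist (g (reindex (\<sigma> J) \<omega>)) (g (reindex \<tau> \<omega>))} \<le> prob (?B \<union> ?C)"
    proof (rule finite_measure_mono)
      have "dist y z < \<eta>" if "dist w y * 2 < \<eta>" "dist w z * 2 < \<eta>" for w y z :: 'b
        using that dist_triangle3[of y z w] by linarith
      then show "{\<omega> \<in> space M. \<eta> \<le> dist (g (reindex (\<sigma> J) \<omega>)) (g (reindex \<tau> \<omega>))} \<subseteq> ?B \<union> ?C"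
        by (fastforce simp: a_def not_le[symmetric])
    qed measurable
    also have "\<dots> \<le> prob ?B + prob ?C"
      by (rule measure_Un_le) measurable
    also have "prob ?B \<le> (\<Sum>k<K. ?d k J)"
      by (rule finite_measure_subadditive_finite) (use Bk in auto)
    finally show ?thesis using K N[OF that] by simp
  qed
  then show "\<exists>no. \<forall>n\<ge>no. norm (prob {\<omega> \<in> space M. \<eta> \<le> dist (g (reindex (\<sigma> n) \<omega>)) (g (reindex \<tau> \<omega>))} - 0) < e"
    by auto
qed

text \<open>Convergence in probability is upgraded to almost sure convergence along a subsequence
  with summable exceptional probabilities (Borel-Cantelli); Fatou's lemma then carries the bound to
  the limit with the same constant.\<close>

lemma lq_le_reindex_limit:
  fixes \<sigma> :: "nat \<Rightarrow> 'i \<Rightarrow> 'k" and \<tau> :: "'i \<Rightarrow> 'k" and g :: "('i \<Rightarrow> real) \<Rightarrow> 'b::euclidean_space"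
  assumes inj: "\<And>J. inj (\<sigma> J)" "inj \<tau>" and ev: "\<And>i. \<forall>\<^sub>F J in sequentially. \<sigma> J i = \<tau> i"
    and g [measurable]: "g \<in> borel_measurable seqM" and Z [measurable]: "Z \<in> borel_measurable M"
    and le: "\<And>J. lq_le M q (\<lambda>\<omega>. Z \<omega> - g (reindex (\<sigma> J) \<omega>)) c" and "0 < q"
  shows "lq_le M q (\<lambda>\<omega>. Z \<omega> - g (reindex \<tau> \<omega>)) c"
proof -
  have c: "0 < c" using lq_leD(2)[OF le] .
  let ?B = "\<lambda>k J. {\<omega> \<in> space M. (1/2)^k \<le> dist (g (reindex (\<sigma> J) \<omega>)) (g (reindex \<tau> \<omega>))}"
  have "\<exists>J. prob (?B k J) < (1/2)^k" for k
    using LIMSEQ_D[OF reindex_converges_in_prob[OF inj ev g, of "(1/2)^k"], of "(1/2)^k"] by auto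
  then obtain J where J: "\<And>k. prob (?B k (J k)) < (1/2)^k" by metis
  have "summable (\<lambda>k. prob (?B k (J k)))"
    by (rule summable_comparison_test[OF _ summable_geometric[of "1/2::real"]]) (auto intro: less_imp_le J)
  then have "AE \<omega> in M. \<forall>\<^sub>F k in sequentially. \<omega> \<in> space M - ?B k (J k)"
    by (intro borel_cantelli_AE1) (auto simp: emeasure_eq_measure)
  then have conv: "AE \<omega> in M. (\<lambda>k. g (reindex (\<sigma> (J k)) \<omega>)) \<longlonglongrightarrow> g (reindex \<tau> \<omega>)"
  proof eventually_elim
    case (elim \<omega>)
    have "(\<lambda>k. dist (g (reindex (\<sigma> (J k)) \<omega>)) (g (reindex \<tau> \<omega>))) \<longlonglongrightarrow> 0"
    proof (rule tendsto_sandwich[OF _ _ tendsto_const])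
      show "(\<lambda>k. (1/2::real)^k) \<longlonglongrightarrow> 0" by (rule LIMSEQ_realpow_zero) auto
      show "\<forall>\<^sub>F k in sequentially. dist (g (reindex (\<sigma> (J k)) \<omega>)) (g (reindex \<tau> \<omega>)) \<le> (1/2)^k"
        using elim by eventually_elim auto
    qed auto
    then show ?case by (rule tendsto_dist_iff[THEN iffD2])
  qed
  let ?h = "\<lambda>k \<omega>. ennreal ((norm (Z \<omega> - g (reindex (\<sigma> (J k)) \<omega>)) / c) powr q)"
  have "(\<integral>\<^sup>+\<omega>. ennreal ((norm (Z \<omega> - g (reindex \<tau> \<omega>)) / c) powr q) \<partial>M) \<le> (\<integral>\<^sup>+\<omega>. liminf (\<lambda>k. ?h k \<omega>) \<partial>M)"
  proof (rule nn_integral_mono_AE)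
    show "AE \<omega> in M. ennreal ((norm (Z \<omega> - g (reindex \<tau> \<omega>)) / c) powr q) \<le> liminf (\<lambda>k. ?h k \<omega>)"
      using conv
    proof eventually_elim
      case (elim \<omega>)
      have "(\<lambda>k. ?h k \<omega>) \<longlonglongrightarrow> ennreal ((norm (Z \<omega> - g (reindex \<tau> \<omega>)) / c) powr q)"
        using c \<open>0 < q\<close> by (intro tendsto_intros tendsto_ennrealI tendsto_powr' elim) auto
      then show ?case by (simp add: lim_imp_Liminf del: tendsto_ennreal_iff)
    qed
  qed
  also have "\<dots> \<le> liminf (\<lambda>k. \<integral>\<^sup>+\<omega>. ?h k \<omega> \<partial>M)"
    by (rule nn_integral_liminf) measurable
  also have "\<dots> \<le> 1"
  proof (rule Liminf_le)
    show "\<forall>\<^sub>F k in sequentially. (\<integral>\<^sup>+\<omega>. ?h k \<omega> \<partial>M) \<le> 1"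
      using lq_leD(3)[OF le] by auto
  qed simp
  finally show ?thesis using c by (simp add: lq_le_def)
qed

end

section \<open>Coupling\<close>

definition past :: "(int \<Rightarrow> real) \<Rightarrow> int \<Rightarrow> nat \<Rightarrow> real" where
  "past x s = (\<lambda>k. x (s - int k))"

lemma past_meas [measurable]: "(\<lambda>x. past x s) \<in> seqM \<rightarrow>\<^sub>M seqM"
  unfolding past_def by (rule measurable_PiM_single') (auto simp: space_PiM)

text \<open>\<open>Inl k\<close> indexes the innovation at time \<open>k\<close> and \<open>Inr k\<close> its independent copy.\<close>

definition renew :: "int \<Rightarrow> int \<Rightarrow> int + int" where
  "renew r k = (if k \<le> r then Inr k else Inl k)"

lemma inj_renew: "inj (renew r)"
  by (auto simp: inj_def renew_def split: if_splits)

locale innovations = iid_family M "case_sum eps epsS" D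
  for M :: "'w measure" and eps epsS :: "int \<Rightarrow> 'w \<Rightarrow> real" and D
begin

abbreviation path :: "'w \<Rightarrow> int \<Rightarrow> real" where "path \<equiv> reindex Inl"
abbreviation coupled :: "int \<Rightarrow> 'w \<Rightarrow> int \<Rightarrow> real" where "coupled r \<equiv> reindex (renew r)"

lemma epsvec_eq: "epsvec eps s \<omega> = past (path \<omega>) s"
  by (simp add: epsvec_def past_def reindex_def)

text \<open>Innovations at times up to \<open>r\<close> are exchanged one by one, backwards in time.
  Each exchange costs what the one-innovation hypothesis allows at that lag, the costs form a
  geometric series, and a limit removes the restriction to finitely many exchanges.\<close>

lemma full_coupling:
  fixes g :: "(nat \<Rightarrow> real) \<Rightarrow> 'b::euclidean_space"
  assumes g [measurable]: "g \<in> borel_measurable seqM" and C: "0 < C" and \<rho>: "0 < \<rho>" "\<rho> < 1" and q: "1 \<le> q"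
    and single: "\<And>j. lq_le M q (\<lambda>\<omega>. g (epsvec eps s \<omega>) - g (epstilde eps epsS s j \<omega>)) (C * \<rho> ^ j)"
    and "r \<le> s"
  shows "lq_le M q (\<lambda>\<omega>. g (past (path \<omega>) s) - g (past (coupled r \<omega>) s)) (C * \<rho> ^ nat (s - r) / (1 - \<rho>))"
proof -
  define h where "h = nat (s - r)"
  \<comment> \<open>The lag \<open>h\<close> is the first one whose time is at most
    \<open>r\<close>; after \<open>J\<close> exchanges, the lags from \<open>h\<close> to
    \<open>h + J - 1\<close> carry copies.\<close>
  define \<sigma> where "\<sigma> = (\<lambda>J k. if h \<le> k \<and> k < h + J then Inr (s - int k) else Inl (s - int k))"
  define \<tau> where "\<tau> = (\<lambda>k. renew r (s - int k))"
  have \<tau>: "\<tau> k = (if h \<le> k then Inr (s - int k) else Inl (s - int k))" for k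
    using \<open>r \<le> s\<close> by (auto simp: \<tau>_def renew_def h_def)
  have inj: "inj (\<sigma> J)" for J by (auto simp: inj_def \<sigma>_def split: if_splits)
  have inj': "inj \<tau>" by (auto simp: inj_def \<tau> split: if_splits)
  have ev: "\<forall>\<^sub>F J in sequentially. \<sigma> (Suc J) k = \<tau> k" for k
    using eventually_ge_at_top[of k] by eventually_elim (auto simp: \<sigma>_def \<tau>)
  \<comment> \<open>The hypothesis exchanges an innovation in the original sequence, not in a
    partially exchanged one. Both differences are the same functional \<open>\<phi>\<close> of a
    sequence together with one spare coordinate \<open>None\<close> holding the replacement, so
    equality in law transfers the bound.\<close>
  have step: "lq_le M q (\<lambda>\<omega>. g (reindex (\<sigma> J) \<omega>) - g (reindex (\<sigma> (Suc J)) \<omega>)) (C * \<rho> ^ (h + J))" for J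
  proof -
    define \<phi> where "\<phi> = (\<lambda>x :: nat option \<Rightarrow> real.
      g (\<lambda>k. x (Some k)) - g (\<lambda>k. if k = h + J then x None else x (Some k)))"
    have [measurable]: "(\<lambda>(x :: nat option \<Rightarrow> real) k. x (Some k)) \<in> seqM \<rightarrow>\<^sub>M seqM"
      by (rule measurable_PiM_single') (auto simp: space_PiM)
    have [measurable]: "(\<lambda>(x :: nat option \<Rightarrow> real) k. if k = h + J then x None else x (Some k)) \<in> seqM \<rightarrow>\<^sub>M seqM"
      by (rule measurable_PiM_single') (auto simp: space_PiM)
    have \<phi>: "\<phi> \<in> borel_measurable seqM" unfolding \<phi>_def by measurable
    define \<sigma>1 where "\<sigma>1 = case_option (Inr (s - int (h + J)) :: int + int) (\<sigma> J)"
    define \<sigma>2 where "\<sigma>2 = case_option (Inr (s - int (h + J)) :: int + int) (\<lambda>k. Inl (s - int k))"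
    have "inj \<sigma>1" "inj \<sigma>2"
      by (auto simp: inj_def \<sigma>1_def \<sigma>2_def \<sigma>_def split: option.splits if_splits)
    then have "lq_le M q (\<lambda>\<omega>. \<phi> (reindex \<sigma>1 \<omega>)) (C * \<rho> ^ (h + J))
      \<longleftrightarrow> lq_le M q (\<lambda>\<omega>. \<phi> (reindex \<sigma>2 \<omega>)) (C * \<rho> ^ (h + J))"
      using \<phi> by (rule reindex_lq_le)
    moreover have "(\<lambda>\<omega>. \<phi> (reindex \<sigma>2 \<omega>)) = (\<lambda>\<omega>. g (epsvec eps s \<omega>) - g (epstilde eps epsS s (h + J) \<omega>))"
      by (auto simp: \<phi>_def reindex_def \<sigma>2_def epsvec_def epstilde_def fun_eq_iff intro!: arg_cong[where f=g])
    moreover have "(\<lambda>\<omega>. \<phi> (reindex \<sigma>1 \<omega>)) = (\<lambda>\<omega>. g (reindex (\<sigma> J) \<omega>) - g (reindex (\<sigma> (Suc J)) \<omega>))"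
    proof
      fix \<omega>
      have 1: "(\<lambda>k. reindex \<sigma>1 \<omega> (Some k)) = reindex (\<sigma> J) \<omega>"
        by (simp add: reindex_def \<sigma>1_def)
      have 2: "(\<lambda>k. if k = h + J then reindex \<sigma>1 \<omega> None else reindex \<sigma>1 \<omega> (Some k)) = reindex (\<sigma> (Suc J)) \<omega>"
        by (rule ext) (auto simp: reindex_def \<sigma>1_def \<sigma>_def)
      show "\<phi> (reindex \<sigma>1 \<omega>) = g (reindex (\<sigma> J) \<omega>) - g (reindex (\<sigma> (Suc J)) \<omega>)"
        unfolding \<phi>_def 1 2 ..
    qed
    ultimately show ?thesis using single[of "h + J"] by simp
  qed
  have \<sigma>0: "reindex (\<sigma> 0) \<omega> = past (path \<omega>) s" for \<omega>
    by (rule ext) (auto simp: reindex_def \<sigma>_def past_def)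
  \<comment> \<open>Counting starts with one exchange because \<open>lq_le\<close> demands a
    strictly positive bound, which an empty sum would not provide.\<close>
  have part: "lq_le M q (\<lambda>\<omega>. g (past (path \<omega>) s) - g (reindex (\<sigma> (Suc J)) \<omega>)) (\<Sum>j\<le>J. C * \<rho> ^ (h + j))" for J
  proof (induction J)
    case 0
    then show ?case using step[of 0] by (simp add: \<sigma>0)
  next
    case (Suc J)
    show ?case using lq_le_add[OF Suc step[of "Suc J"] q] by simp
  qed
  have "(\<Sum>j\<le>J. C * \<rho> ^ (h + j)) \<le> C * \<rho> ^ h / (1 - \<rho>)" for J
  proof -
    have "(\<Sum>j\<le>J. C * \<rho> ^ (h + j)) = C * \<rho> ^ h * (\<Sum>j\<le>J. \<rho> ^ j)"
      by (simp add: power_add sum_distrib_left mult.assoc)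
    also have "(\<Sum>j\<le>J. \<rho> ^ j) \<le> (\<Sum>j. \<rho> ^ j)"
      using \<rho> by (intro sum_le_suminf summable_geometric) auto
    also have "(\<Sum>j. \<rho> ^ j) = 1 / (1 - \<rho>)" using \<rho> by (simp add: suminf_geometric)
    finally show ?thesis using C \<rho> by (simp add: mult_left_mono)
  qed
  then have "lq_le M q (\<lambda>\<omega>. g (past (path \<omega>) s) - g (reindex (\<sigma> (Suc J)) \<omega>)) (C * \<rho> ^ h / (1 - \<rho>))" for J
    using q by (intro lq_le_mono[OF part]) auto
  then have "lq_le M q (\<lambda>\<omega>. g (past (path \<omega>) s) - g (reindex \<tau> \<omega>)) (C * \<rho> ^ h / (1 - \<rho>))"
    using q by (intro lq_le_reindex_limit[OF inj inj' ev g]) auto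
  moreover have "reindex \<tau> \<omega> = past (coupled r \<omega>) s" for \<omega>
    by (simp add: reindex_def \<tau>_def past_def)
  ultimately show ?thesis by (simp add: h_def)
qed

text \<open>The coupled sequence shares no innovation up to time \<open>r\<close> with the original
  one and has the same law. Hence \<open>\<Psi>\<close> of it is independent of
  \<open>\<Phi>\<close> with unchanged mean, and the covariance equals the expectation of
  \<open>\<Phi>\<close> times the coupling difference.\<close>

lemma decoupled_cov:
  fixes \<Phi> \<Psi> :: "(int \<Rightarrow> real) \<Rightarrow> real"
  assumes m [measurable]: "\<Phi> \<in> borel_measurable seqM" "\<Psi> \<in> borel_measurable seqM"
    and causal: "\<And>x y. (\<And>k. k \<le> r \<Longrightarrow> x k = y k) \<Longrightarrow> \<Phi> x = \<Phi> y"
    and \<Phi>: "lq_le M 2 (\<lambda>\<omega>. \<Phi> (path \<omega>)) c" and \<Psi>: "lq_le M 2 (\<lambda>\<omega>. \<Psi> (path \<omega>)) c'"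
    and diff: "lq_le M 2 (\<lambda>\<omega>. \<Psi> (path \<omega>) - \<Psi> (coupled r \<omega>)) d"
  shows "\<bar>cov M (\<lambda>\<omega>. \<Phi> (path \<omega>)) (\<lambda>\<omega>. \<Psi> (path \<omega>))\<bar> \<le> c * d"
proof -
  \<comment> \<open>Folding all later times onto \<open>r\<close> makes the range disjoint from that
    of \<open>renew r\<close>; causality keeps the value of \<open>\<Phi>\<close>.\<close>
  let ?\<sigma> = "\<lambda>k. Inl (min k r) :: int + int"
  have \<Phi>_eq: "\<Phi> (reindex ?\<sigma> \<omega>) = \<Phi> (path \<omega>)" for \<omega>
    by (rule causal) (simp add: reindex_def)
  have \<Psi>': "lq_le M 2 (\<lambda>\<omega>. \<Psi> (coupled r \<omega>)) c'"
    using \<Psi> reindex_lq_le[of Inl "renew r" \<Psi> 2 c'] inj_renew by simp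
  have E\<Psi>: "(\<integral>\<omega>. \<Psi> (coupled r \<omega>) \<partial>M) = (\<integral>\<omega>. \<Psi> (path \<omega>) \<partial>M)"
    by (rule reindex_integral[OF inj_renew]) auto
  have "(\<integral>\<omega>. \<Phi> (reindex ?\<sigma> \<omega>) * \<Psi> (coupled r \<omega>) \<partial>M)
     = (\<integral>\<omega>. \<Phi> (reindex ?\<sigma> \<omega>) \<partial>M) * (\<integral>\<omega>. \<Psi> (coupled r \<omega>) \<partial>M)"
  proof (rule reindex_indep)
    show "range ?\<sigma> \<inter> range (renew r) = {}" by (auto simp: renew_def split: if_splits)
  qed (use lq_le_integral(1)[OF \<Phi>] lq_le_integral(1)[OF \<Psi>'] in \<open>auto simp: \<Phi>_eq\<close>)
  then have "(\<integral>\<omega>. \<Phi> (path \<omega>) * \<Psi> (coupled r \<omega>) \<partial>M) = (\<integral>\<omega>. \<Phi> (path \<omega>) \<partial>M) * (\<integral>\<omega>. \<Psi> (path \<omega>) \<partial>M)"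
    by (simp add: \<Phi>_eq E\<Psi>)
  then have "cov M (\<lambda>\<omega>. \<Phi> (path \<omega>)) (\<lambda>\<omega>. \<Psi> (path \<omega>))
      = (\<integral>\<omega>. \<Phi> (path \<omega>) * (\<Psi> (path \<omega>) - \<Psi> (coupled r \<omega>)) \<partial>M)"
    using lq_le_2_mult_integral(1)[OF \<Phi> \<Psi>] lq_le_2_mult_integral(1)[OF \<Phi> \<Psi>']
    by (simp add: cov_def right_diff_distrib)
  then show ?thesis using lq_le_2_mult_integral(2)[OF \<Phi> diff] by simp
qed

end

section \<open>Locally stationary processes\<close>

text \<open>The witness \<open>w v\<close> is the supremum of the partition sums over \<open>[0, v]\<close>.\<close>

lemma control_function:
  fixes d :: "real \<Rightarrow> real \<Rightarrow> real"
  assumes nonneg: "\<And>u v. 0 \<le> d u v"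
    and part: "\<And>m us. us 0 = 0 \<Longrightarrow> us m = 1 \<Longrightarrow> strict_mono_on {0..m::nat} us \<Longrightarrow>
       (\<Sum>i\<in>{1..m}. d (us (i - 1)) (us i)) \<le> B"
  obtains w where "\<And>u. 0 \<le> u \<Longrightarrow> u \<le> 1 \<Longrightarrow> 0 \<le> w u \<and> w u \<le> B"
    and "\<And>u v. 0 \<le> u \<Longrightarrow> u < v \<Longrightarrow> v \<le> 1 \<Longrightarrow> d u v \<le> w v - w u"
proof -
  define P where "P = (\<lambda>v. {S. \<exists>m us. S = (\<Sum>i\<in>{1..m}. d (us (i - 1)) (us i)) \<and>
    us 0 = 0 \<and> us m = v \<and> strict_mono_on {0..m::nat} us})"
  \<comment> \<open>Appending \<open>v\<close> to a partition of [0,u] adds exactly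
    \<open>d u v\<close>, which makes the suprema superadditive.\<close>
  have ext: "S + d u v \<in> P v" if S: "S \<in> P u" and "u < v" for S u v
  proof -
    obtain m us where m: "S = (\<Sum>i\<in>{1..m}. d (us (i - 1)) (us i))" "us 0 = 0" "us m = u" "strict_mono_on {0..m::nat} us"
      using S unfolding P_def by blast
    let ?us = "us(Suc m := v)"
    have le: "us i \<le> u" if "i \<le> m" for i
      using strict_mono_onD[OF m(4), of i m] that m(3) by (cases "i = m") auto
    have "strict_mono_on {0..Suc m} ?us"
    proof (rule strict_mono_onI)
      fix i j assume "i \<in> {0..Suc m}" "j \<in> {0..Suc m}" "i < j"
      then show "?us i < ?us j"
        using strict_mono_onD[OF m(4), of i j] le[of i] \<open>u < v\<close> by (cases "j = Suc m") auto
    qed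
    moreover have "S + d u v = (\<Sum>i\<in>{1..Suc m}. d (?us (i - 1)) (?us i))"
      unfolding m(1) by (simp add: m(3)) (intro sum.cong; force)
    ultimately show ?thesis unfolding P_def using m(2) by (intro CollectI exI[of _ "Suc m"] exI[of _ ?us]) auto
  qed
  have P0: "0 \<in> P 0"
    unfolding P_def by (intro CollectI exI[of _ 0] exI[of _ "\<lambda>_. 0"]) (auto simp: strict_mono_on_def)
  have ne: "P v \<noteq> {}" if "0 \<le> v" for v
    using P0 ext[OF P0, of v] that by (cases "v = 0") auto
  have P1: "S \<le> B" if "S \<in> P 1" for S using that part by (auto simp: P_def)
  \<comment> \<open>The hypothesis speaks of partitions of all of [0,1]; one ending at
    \<open>v < 1\<close> is completed by the point 1, which cannot decrease the sum.\<close>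
  have bd: "S \<le> B" if "S \<in> P v" "v \<le> 1" for S v
    using P1[of S] P1[OF ext[OF that(1), of 1]] that nonneg[of v 1] by (cases "v = 1") auto
  have bdd: "bdd_above (P v)" if "v \<le> 1" for v using bd that by (auto simp: bdd_above_def)
  have pos: "0 \<le> S" if "S \<in> P v" for S v using that nonneg by (auto simp: P_def intro!: sum_nonneg)
  define w where "w = (\<lambda>v. Sup (P v))"
  show ?thesis
  proof (rule that[of w])
    show "0 \<le> w u \<and> w u \<le> B" if "0 \<le> u" "u \<le> 1" for u
    proof -
      obtain S where "S \<in> P u" using ne[OF \<open>0 \<le> u\<close>] by auto
      then show ?thesis unfolding w_def using bd that ne pos
        by (auto intro!: cSup_least order_trans[OF pos cSup_upper] bdd)
    qed
    show "d u v \<le> w v - w u" if "0 \<le> u" "u < v" "v \<le> 1" for u v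
    proof -
      have "w u \<le> w v - d u v" unfolding w_def
      proof (rule cSup_least)
        show "P u \<noteq> {}" using ne that by auto
        fix S assume "S \<in> P u"
        from cSup_upper[OF ext[OF this that(2)] bdd[OF that(3)]] show "S \<le> Sup (P v) - d u v" by simp
      qed
      then show ?thesis by simp
    qed
  qed
qed

text \<open>\<open>Lq_norm\<close> passes through \<open>enn2real\<close>, which maps an infinite
  moment to 0. The a priori bound \<open>B\<close> rules this out, so a small norm really means a
  small moment.\<close>

lemma lq_le_of_norm:
  assumes Y: "lq_le M q Y B" and le: "Lq_norm M q Y \<le> c" and "0 < c" "0 < q"
  shows "lq_le M q Y c"
proof -
  have Ym: "Y \<in> borel_measurable M" and B: "0 < B" using lq_leD[OF Y] by auto
  have fin: "Lq_moment M q Y < top"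
    using iffD1[OF lq_le_iff_moment[OF Ym B] Y] by (rule order.strict_trans1) simp
  have "enn2real (Lq_moment M q Y) = (enn2real (Lq_moment M q Y) powr (1 / q)) powr q"
    using \<open>0 < q\<close> by (simp add: powr_powr)
  also have "\<dots> \<le> c powr q" using le \<open>0 < q\<close> by (intro powr_mono2) (auto simp: Lq_norm_def)
  finally have "Lq_moment M q Y \<le> ennreal (c powr q)"
    using fin by (metis ennreal_enn2real ennreal_leI)
  then show ?thesis using lq_le_iff_moment[OF Ym \<open>0 < c\<close>] by simp
qed

text \<open>Collects the conditions on the kernels alone, in terms of \<open>lq_le\<close>; the
  function \<open>f\<close> and the pilot estimators enter only at the plug-in stage.\<close>

locale locally_stationary = innovations M eps epsS D
  for M :: "'w measure" and eps epsS D +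
  fixes Gn :: "nat \<Rightarrow> real \<Rightarrow> (nat \<Rightarrow> real) \<Rightarrow> 'a::euclidean_space"
    and G :: "real \<Rightarrow> (nat \<Rightarrow> real) \<Rightarrow> 'a"
    and q p C \<rho> :: real
  assumes Gn_meas [measurable]: "\<And>n u. Gn n u \<in> borel_measurable seqM"
    and G_meas [measurable]: "\<And>u. G u \<in> borel_measurable seqM"
    and q_gt: "4 < q" and p_ge: "1 \<le> p" and C_pos: "0 < C" and \<rho>: "0 < \<rho>" "\<rho> < 1"
    and G_lim: "\<And>e. 0 < e \<Longrightarrow> \<forall>\<^sub>F n in sequentially. \<forall>u\<in>{0..1}.
      lq_le M q (\<lambda>\<omega>. Gn n u (epsvec eps 0 \<omega>) - G u (epsvec eps 0 \<omega>)) e"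
    and Gn_moment: "\<And>n u. u \<in> {0..1} \<Longrightarrow> lq_le M q (\<lambda>\<omega>. Gn n u (epsvec eps 0 \<omega>)) C"
    and Gn_pvar: "\<And>n m us. us 0 = 0 \<Longrightarrow> us m = 1 \<Longrightarrow> strict_mono_on {0..m::nat} us \<Longrightarrow>
      (\<Sum>i\<in>{1..m}. Lq_norm M q (\<lambda>\<omega>. Gn n (us i) (epsvec eps 0 \<omega>) - Gn n (us (i - 1)) (epsvec eps 0 \<omega>)) powr p)
        \<le> C powr p"
    and Gn_coupling: "\<And>j n t u. u \<in> {0..1} \<Longrightarrow>
      lq_le M q (\<lambda>\<omega>. Gn n u (epsvec eps t \<omega>) - Gn n u (epstilde eps epsS t j \<omega>)) (C * \<rho> ^ j)"
begin

definition mun :: "nat \<Rightarrow> real \<Rightarrow> 'a" where "mun n u = (\<integral>\<omega>. Gn n u (epsvec eps 0 \<omega>) \<partial>M)"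
definition mu :: "real \<Rightarrow> 'a" where "mu u = (\<integral>\<omega>. G u (epsvec eps 0 \<omega>) \<partial>M)"

lemma epsvec_meas [measurable]: "epsvec eps s \<in> M \<rightarrow>\<^sub>M seqM"
  unfolding epsvec_eq[abs_def] by measurable

lemma lq_le_shift:
  fixes \<phi> :: "(nat \<Rightarrow> real) \<Rightarrow> 'b::euclidean_space"
  assumes "\<phi> \<in> borel_measurable seqM"
  shows "lq_le M r (\<lambda>\<omega>. \<phi> (epsvec eps s \<omega>)) c \<longleftrightarrow> lq_le M r (\<lambda>\<omega>. \<phi> (epsvec eps 0 \<omega>)) c"
proof -
  have "epsvec eps t \<omega> = reindex (\<lambda>k. Inl (t - int k)) \<omega>" for t \<omega>
    by (simp add: epsvec_def reindex_def)
  moreover have "inj (\<lambda>k::nat. Inl (t - int k) :: int + int)" for t by (auto simp: inj_def)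
  ultimately show ?thesis using reindex_lq_le[OF _ _ assms] by presburger
qed

lemma Gn_lq: "u \<in> {0..1} \<Longrightarrow> lq_le M q (\<lambda>\<omega>. Gn n u (epsvec eps s \<omega>)) C"
  by (rule iffD2[OF lq_le_shift[OF Gn_meas] Gn_moment])

lemma Gn_mean:
  assumes "u \<in> {0..1}" shows "(\<integral>\<omega>. Gn n u (epsvec eps s \<omega>) \<partial>M) = mun n u" "norm (mun n u) \<le> C"
proof -
  show "norm (mun n u) \<le> C"
    using lq_le_integral(2)[OF Gn_moment[OF assms]] q_gt by (simp add: mun_def)
  have "epsvec eps t \<omega> = reindex (\<lambda>k. Inl (t - int k)) \<omega>" for t \<omega>
    by (simp add: epsvec_def reindex_def)
  moreover have "inj (\<lambda>k::nat. Inl (t - int k) :: int + int)" for t by (auto simp: inj_def)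
  ultimately show "(\<integral>\<omega>. Gn n u (epsvec eps s \<omega>) \<partial>M) = mun n u"
    unfolding mun_def using reindex_integral[OF _ _ Gn_meas] by presburger
qed

lemma G_lq: assumes "u \<in> {0..1}" shows "lq_le M q (\<lambda>\<omega>. G u (epsvec eps s \<omega>)) (C + 1)"
proof -
  have "\<exists>n. \<forall>u\<in>{0..1}. lq_le M q (\<lambda>\<omega>. Gn n u (epsvec eps 0 \<omega>) - G u (epsvec eps 0 \<omega>)) 1"
    using eventually_happens[OF G_lim[of 1]] by simp
  then obtain n where "lq_le M q (\<lambda>\<omega>. Gn n u (epsvec eps 0 \<omega>) - G u (epsvec eps 0 \<omega>)) 1"
    using assms by blast
  from lq_le_diff[OF Gn_moment[OF assms, of n] this] q_gt
  have "lq_le M q (\<lambda>\<omega>. G u (epsvec eps 0 \<omega>)) (C + 1)" by simp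
  then show ?thesis by (rule iffD2[OF lq_le_shift[OF G_meas]])
qed

lemma coupling:
  assumes "u \<in> {0..1}" "r \<le> s"
  shows "lq_le M q (\<lambda>\<omega>. Gn n u (past (path \<omega>) s) - Gn n u (past (coupled r \<omega>) s)) (C * \<rho> ^ nat (s - r) / (1 - \<rho>))"
  using full_coupling[OF Gn_meas C_pos \<rho> _ Gn_coupling[OF assms(1)] assms(2)] q_gt by simp

text \<open>Finite \<open>p\<close>-variation is turned into a monotone function whose increments
  dominate \<open>p\<close>-th powers of distances. Its boundedness later limits the total drift of
  the means, and its monotonicity limits the points of discontinuity.\<close>

lemma control:
  obtains w where "\<And>u. u \<in> {0..1} \<Longrightarrow> 0 \<le> w u \<and> w u \<le> C powr p"
    and "\<And>u v c. 0 \<le> u \<Longrightarrow> u \<le> v \<Longrightarrow> v \<le> 1 \<Longrightarrow> 0 < c \<Longrightarrow> w v - w u \<le> c powr p \<Longrightarrow>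
      lq_le M q (\<lambda>\<omega>. Gn n v (epsvec eps 0 \<omega>) - Gn n u (epsvec eps 0 \<omega>)) c"
    and "mono_on {0..1} w"
proof -
  let ?d = "\<lambda>u v. Lq_norm M q (\<lambda>\<omega>. Gn n v (epsvec eps 0 \<omega>) - Gn n u (epsvec eps 0 \<omega>)) powr p"
  obtain w where w: "\<And>u. 0 \<le> u \<Longrightarrow> u \<le> 1 \<Longrightarrow> 0 \<le> w u \<and> w u \<le> C powr p"
      "\<And>u v. 0 \<le> u \<Longrightarrow> u < v \<Longrightarrow> v \<le> 1 \<Longrightarrow> ?d u v \<le> w v - w u"
    using control_function[of ?d "C powr p"] Gn_pvar by auto
  have "mono_on {0..1} w"
  proof (rule mono_onI)
    fix u v :: real assume "u \<in> {0..1}" "v \<in> {0..1}" "u \<le> v"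
    then show "w u \<le> w v"
      using w(2)[of u v] powr_ge_zero[of "Lq_norm M q (\<lambda>\<omega>. Gn n v (epsvec eps 0 \<omega>) - Gn n u (epsvec eps 0 \<omega>))" p]
      by (cases "u = v") (auto simp del: powr_ge_zero)
  qed
  moreover have "lq_le M q (\<lambda>\<omega>. Gn n v (epsvec eps 0 \<omega>) - Gn n u (epsvec eps 0 \<omega>)) c"
    if "0 \<le> u" "u \<le> v" "v \<le> 1" "0 < c" "w v - w u \<le> c powr p" for u v c
  proof (cases "u = v")
    case True
    then show ?thesis using that q_gt lq_le_const[of c "0::'a" q] by simp
  next
    case False
    have "?d u v \<le> c powr p" using w(2)[of u v] that False by auto
    then have "Lq_norm M q (\<lambda>\<omega>. Gn n v (epsvec eps 0 \<omega>) - Gn n u (epsvec eps 0 \<omega>)) \<le> c"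
      using that p_ge powr_less_mono2[of p c] by (force simp: not_le[symmetric])
    then show ?thesis
      using lq_le_of_norm[OF lq_le_diff[OF Gn_moment Gn_moment]] that q_gt by auto
  qed
  ultimately show ?thesis using w(1) by (intro that[of w]) auto
qed

lemma mean_control:
  obtains w where "\<And>u. u \<in> {0..1} \<Longrightarrow> 0 \<le> w u \<and> w u \<le> C powr p"
    and "\<And>u v. 0 \<le> u \<Longrightarrow> u \<le> v \<Longrightarrow> v \<le> 1 \<Longrightarrow> norm (mun n v - mun n u) powr p \<le> w v - w u"
proof -
  obtain w where w: "\<And>u. u \<in> {0..1} \<Longrightarrow> 0 \<le> w u \<and> w u \<le> C powr p"
    "\<And>u v c. 0 \<le> u \<Longrightarrow> u \<le> v \<Longrightarrow> v \<le> 1 \<Longrightarrow> 0 < c \<Longrightarrow> w v - w u \<le> c powr p \<Longrightarrow>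
      lq_le M q (\<lambda>\<omega>. Gn n v (epsvec eps 0 \<omega>) - Gn n u (epsvec eps 0 \<omega>)) c" "mono_on {0..1} w"
    using control by blast
  have "norm (mun n v - mun n u) powr p \<le> w v - w u" if "0 \<le> u" "u \<le> v" "v \<le> 1" for u v
  proof -
    have le: "norm (mun n v - mun n u) \<le> c" if "0 < c" "w v - w u \<le> c powr p" for c
    proof -
      have "norm (\<integral>\<omega>. Gn n v (epsvec eps 0 \<omega>) - Gn n u (epsvec eps 0 \<omega>) \<partial>M) \<le> c"
        using lq_le_integral(2)[OF w(2)[OF \<open>0 \<le> u\<close> \<open>u \<le> v\<close> \<open>v \<le> 1\<close> that]] q_gt by simp
      also have "(\<integral>\<omega>. Gn n v (epsvec eps 0 \<omega>) - Gn n u (epsvec eps 0 \<omega>) \<partial>M) = mun n v - mun n u"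
        unfolding mun_def using \<open>0 \<le> u\<close> \<open>u \<le> v\<close> \<open>v \<le> 1\<close> q_gt
        by (intro Bochner_Integration.integral_diff lq_le_integral(1)[OF Gn_moment]) auto
      finally show ?thesis .
    qed
    have mono: "w u \<le> w v" using w(3) that by (auto simp: mono_on_def)
    show ?thesis
    proof (rule field_le_epsilon)
      fix e :: real assume "0 < e"
      \<comment> \<open>The slack \<open>e\<close> keeps \<open>c\<close> positive even where
        \<open>w\<close> is constant, as \<open>lq_le\<close> requires.\<close>
      define c where "c = (w v - w u + e) powr (1 / p)"
      have "c powr p = w v - w u + e" "0 < c"
        using mono \<open>0 < e\<close> p_ge by (simp_all add: c_def powr_powr)
      with le[of c] \<open>0 < e\<close> p_ge show "norm (mun n v - mun n u) powr p \<le> w v - w u + e"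
        using powr_mono2[of p "norm (mun n v - mun n u)" c] by auto
    qed
  qed
  with w(1) that show ?thesis by blast
qed

text \<open>At a continuity point of its control function a single kernel \<open>Gn n0\<close> is
  continuous in norm. Uniform closeness to \<open>G\<close> then transfers this to all later
  \<open>n\<close>, so no control uniform in \<open>n\<close> is required.\<close>

lemma equicontinuous_ae:
  obtains N where "countable N"
    "\<And>v e. v \<in> {0..1} - N \<Longrightarrow> 0 < e \<Longrightarrow> \<exists>\<eta>>0. \<forall>\<^sub>F n in sequentially. \<forall>x\<in>{0..1}. \<bar>x - v\<bar> < \<eta> \<longrightarrow>
      lq_le M q (\<lambda>\<omega>. Gn n x (epsvec eps 0 \<omega>) - G v (epsvec eps 0 \<omega>)) e"
proof -
  have "\<exists>w. mono_on {0..1} w \<and> (\<forall>u v c. 0 \<le> u \<longrightarrow> u \<le> v \<longrightarrow> v \<le> 1 \<longrightarrow> 0 < c \<longrightarrow> w v - w u \<le> c powr p \<longrightarrow>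
      lq_le M q (\<lambda>\<omega>. Gn n v (epsvec eps 0 \<omega>) - Gn n u (epsvec eps 0 \<omega>)) c)" for n
    by (rule control[of n]) blast
  then obtain w :: "nat \<Rightarrow> real \<Rightarrow> real" where mono: "\<And>n. mono_on {0..1} (w n)"
    and w: "\<And>n u v c. 0 \<le> u \<Longrightarrow> u \<le> v \<Longrightarrow> v \<le> 1 \<Longrightarrow> 0 < c \<Longrightarrow> w n v - w n u \<le> c powr p \<Longrightarrow>
      lq_le M q (\<lambda>\<omega>. Gn n v (epsvec eps 0 \<omega>) - Gn n u (epsvec eps 0 \<omega>)) c"
    by metis
  \<comment> \<open>The index \<open>n0\<close> chosen below depends on \<open>e\<close>, so the
    discontinuities for all \<open>n\<close> are removed together; a countable union of countable
    sets is countable.\<close>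
  define N where "N = (\<Union>n. {v \<in> {0..1}. \<not> continuous (at v within {0..1}) (w n)})"
  have q1: "1 \<le> q" using q_gt by simp
  show ?thesis
  proof (rule that[of N])
    show "countable N" unfolding N_def using mono_on_ctble_discont[OF mono] by auto
    fix v e :: real assume v: "v \<in> {0..1} - N" and e: "0 < e"
    obtain n0 where n0: "\<And>n u. n \<ge> n0 \<Longrightarrow> u \<in> {0..1} \<Longrightarrow>
        lq_le M q (\<lambda>\<omega>. Gn n u (epsvec eps 0 \<omega>) - G u (epsvec eps 0 \<omega>)) (e / 4)"
      using G_lim[of "e / 4"] e unfolding eventually_sequentially by (meson divide_pos_pos zero_less_numeral)
    have "continuous (at v within {0..1}) (w n0)" using v by (auto simp: N_def)
    then obtain \<eta> where \<eta>: "0 < \<eta>" "\<And>x. x \<in> {0..1} \<Longrightarrow> \<bar>x - v\<bar> < \<eta> \<Longrightarrow> \<bar>w n0 x - w n0 v\<bar> < (e / 4) powr p"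
      unfolding continuous_within_eps_delta using e by (force simp: dist_real_def dest: spec[of _ "(e / 4) powr p"])
    have "lq_le M q (\<lambda>\<omega>. Gn n x (epsvec eps 0 \<omega>) - G v (epsvec eps 0 \<omega>)) e"
      if n: "n \<ge> n0" and x: "x \<in> {0..1}" "\<bar>x - v\<bar> < \<eta>" for n x
    proof -
      have v': "v \<in> {0..1}" using v by simp
      have a: "lq_le M q (\<lambda>\<omega>. Gn n0 x (epsvec eps 0 \<omega>) - Gn n0 v (epsvec eps 0 \<omega>)) (e / 4)"
      proof (cases "v \<le> x")
        case True
        then show ?thesis using w[of v x "e / 4" n0] \<eta>(2)[OF x] v' x e by auto
      next
        case False
        then have "lq_le M q (\<lambda>\<omega>. Gn n0 v (epsvec eps 0 \<omega>) - Gn n0 x (epsvec eps 0 \<omega>)) (e / 4)"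
          using w[of x v "e / 4" n0] \<eta>(2)[OF x] v' x e by auto
        from lq_le_uminus[OF this] show ?thesis by simp
      qed
      \<comment> \<open>The chain runs from \<open>Gn n x\<close> through \<open>G x\<close>,
        \<open>Gn n0 x\<close> and \<open>Gn n0 v\<close> to \<open>G v\<close>, at a cost of
        \<open>e / 4\<close> per link.\<close>
      have "lq_le M q (\<lambda>\<omega>. (Gn n x (epsvec eps 0 \<omega>) - G x (epsvec eps 0 \<omega>))
          - (Gn n0 x (epsvec eps 0 \<omega>) - G x (epsvec eps 0 \<omega>))
          + ((Gn n0 x (epsvec eps 0 \<omega>) - Gn n0 v (epsvec eps 0 \<omega>))
          + (Gn n0 v (epsvec eps 0 \<omega>) - G v (epsvec eps 0 \<omega>)))) ((e / 4 + e / 4) + (e / 4 + e / 4))"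
        by (intro lq_le_add lq_le_diff a n0 x(1) v' n q1 order_refl)
      then show ?thesis by simp
    qed
    then show "\<exists>\<eta>>0. \<forall>\<^sub>F n in sequentially. \<forall>x\<in>{0..1}. \<bar>x - v\<bar> < \<eta> \<longrightarrow>
      lq_le M q (\<lambda>\<omega>. Gn n x (epsvec eps 0 \<omega>) - G v (epsvec eps 0 \<omega>)) e"
      using \<eta>(1) unfolding eventually_sequentially by blast
  qed
qed

lemma mean_diff:
  assumes "u \<in> {0..1}" "v \<in> {0..1}" "lq_le M q (\<lambda>\<omega>. Gn n u (epsvec eps 0 \<omega>) - G v (epsvec eps 0 \<omega>)) e"
  shows "norm (mun n u - mu v) \<le> e"
proof -
  have "(\<integral>\<omega>. Gn n u (epsvec eps 0 \<omega>) - G v (epsvec eps 0 \<omega>) \<partial>M) = mun n u - mu v"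
    unfolding mun_def mu_def using assms q_gt
    by (intro Bochner_Integration.integral_diff lq_le_integral(1)[OF Gn_moment] lq_le_integral(1)[OF G_lq]) auto
  then show ?thesis using lq_le_integral(2)[OF assms(3)] q_gt by simp
qed

lemma inner_lq:
  assumes "u \<in> {0..1}" "norm a \<le> A" "0 < A" "0 < r" "r \<le> q"
  shows "lq_le M r (\<lambda>\<omega>. a \<bullet> Gn n u (epsvec eps s \<omega>)) (A * C)"
  using lq_le_lower[OF lq_le_inner[OF Gn_lq[OF assms(1)] assms(2,3)]] assms q_gt by simp

lemma inner_G_lq:
  assumes "u \<in> {0..1}" "norm a \<le> A" "0 < A" "0 < r" "r \<le> q"
  shows "lq_le M r (\<lambda>\<omega>. a \<bullet> G u (epsvec eps s \<omega>)) (A * (C + 1))"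
  using lq_le_lower[OF lq_le_inner[OF G_lq[OF assms(1)] assms(2,3)]] assms q_gt by simp

lemma past_eqI: "(\<And>k. k \<le> r \<Longrightarrow> x k = y k) \<Longrightarrow> s \<le> r \<Longrightarrow> past x s = past y s"
  by (auto simp: past_def)

text \<open>Decoupling takes place at the earlier of the two times, so the later variable pays a
  coupling cost that is geometric in the time gap; the reverse order is symmetric.\<close>

lemma Gn_cov_decay:
  assumes "u \<in> {0..1}" "v \<in> {0..1}" "norm a \<le> A" "norm a' \<le> A" "0 < A"
  shows "\<bar>cov M (\<lambda>\<omega>. a \<bullet> Gn n u (epsvec eps s \<omega>)) (\<lambda>\<omega>. a' \<bullet> Gn n v (epsvec eps t \<omega>))\<bar>
    \<le> A\<^sup>2 * C\<^sup>2 / (1 - \<rho>) * \<rho> ^ nat \<bar>s - t\<bar>"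
proof -
  have *: "\<bar>cov M (\<lambda>\<omega>. a \<bullet> Gn n u (epsvec eps s \<omega>)) (\<lambda>\<omega>. a' \<bullet> Gn n v (epsvec eps t \<omega>))\<bar>
    \<le> A\<^sup>2 * C\<^sup>2 / (1 - \<rho>) * \<rho> ^ nat (t - s)"
    if "u \<in> {0..1}" "v \<in> {0..1}" "norm a \<le> A" "norm a' \<le> A" "s \<le> t" for u v s t a a'
  proof -
    have "\<bar>cov M (\<lambda>\<omega>. a \<bullet> Gn n u (past (path \<omega>) s)) (\<lambda>\<omega>. a' \<bullet> Gn n v (past (path \<omega>) t))\<bar>
      \<le> (A * C) * (A * (C * \<rho> ^ nat (t - s) / (1 - \<rho>)))"
    proof (rule decoupled_cov[where r=s])
      show "(\<lambda>x. a \<bullet> Gn n u (past x s)) \<in> borel_measurable seqM" "(\<lambda>x. a' \<bullet> Gn n v (past x t)) \<in> borel_measurable seqM"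
        by measurable
      show "a \<bullet> Gn n u (past x s) = a \<bullet> Gn n u (past y s)" if "\<And>k. k \<le> s \<Longrightarrow> x k = y k" for x y
        using past_eqI[of s x y s, OF that] by simp
      show "lq_le M 2 (\<lambda>\<omega>. a \<bullet> Gn n u (past (path \<omega>) s)) (A * C)"
        "lq_le M 2 (\<lambda>\<omega>. a' \<bullet> Gn n v (past (path \<omega>) t)) (A * C)"
        unfolding epsvec_eq[symmetric] using that q_gt assms by (auto intro: inner_lq)
      show "lq_le M 2 (\<lambda>\<omega>. a' \<bullet> Gn n v (past (path \<omega>) t) - a' \<bullet> Gn n v (past (coupled s \<omega>) t))
         (A * (C * \<rho> ^ nat (t - s) / (1 - \<rho>)))"
        using lq_le_lower[OF lq_le_inner[OF coupling[OF that(2) that(5)] that(4) assms(5)], of 2] q_gt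
        by (simp add: inner_diff_right)
    qed
    then show ?thesis by (simp add: epsvec_eq power2_eq_square mult_ac)
  qed
  show ?thesis
  proof (cases "s \<le> t")
    case True
    then show ?thesis using *[OF assms(1-4)] by simp
  next
    case False
    then show ?thesis using *[OF assms(2,1,4,3), of t s] cov_commute by simp
  qed
qed

lemma cov_shift:
  assumes "\<phi> \<in> borel_measurable seqM" "\<psi> \<in> borel_measurable seqM"
  shows "cov M (\<lambda>\<omega>. \<phi> (epsvec eps s \<omega>)) (\<lambda>\<omega>. \<psi> (epsvec eps t \<omega>))
    = cov M (\<lambda>\<omega>. \<phi> (epsvec eps 0 \<omega>)) (\<lambda>\<omega>. \<psi> (epsvec eps (t - s) \<omega>))"
proof -
  note [measurable] = assms
  let ?\<sigma> = "\<lambda>k. Inl (k + s) :: int + int"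
  have e: "epsvec eps r \<omega> = past (reindex ?\<sigma> \<omega>) (r - s)" for r \<omega>
    by (simp add: epsvec_def past_def reindex_def)
  have inj: "inj ?\<sigma>" by (auto simp: inj_def)
  have "(\<integral>\<omega>. \<phi> (past (reindex ?\<sigma> \<omega>) 0) * \<psi> (past (reindex ?\<sigma> \<omega>) (t - s)) \<partial>M)
     = (\<integral>\<omega>. \<phi> (past (path \<omega>) 0) * \<psi> (past (path \<omega>) (t - s)) \<partial>M)"
    using reindex_integral[OF inj inj_Inl, of "\<lambda>x. \<phi> (past x 0) * \<psi> (past x (t - s))"] by simp
  moreover have "(\<integral>\<omega>. \<phi> (past (reindex ?\<sigma> \<omega>) 0) \<partial>M) = (\<integral>\<omega>. \<phi> (past (path \<omega>) 0) \<partial>M)"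
    using reindex_integral[OF inj inj_Inl, of "\<lambda>x. \<phi> (past x 0)"] by simp
  moreover have "(\<integral>\<omega>. \<psi> (past (reindex ?\<sigma> \<omega>) (t - s)) \<partial>M) = (\<integral>\<omega>. \<psi> (past (path \<omega>) (t - s)) \<partial>M)"
    using reindex_integral[OF inj inj_Inl, of "\<lambda>x. \<psi> (past x (t - s))"] by simp
  ultimately show ?thesis
    unfolding cov_def e[of s] e[of t] by (simp add: epsvec_eq)
qed

lemma inner_diff_lq:
  assumes "u \<in> {0..1}" "v \<in> {0..1}" "norm a \<le> A" "norm a' \<le> A" "0 < A" "norm (a - a') \<le> e" "0 < e"
    and d: "lq_le M q (\<lambda>\<omega>. Gn n u (epsvec eps 0 \<omega>) - G v (epsvec eps 0 \<omega>)) e"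
  shows "lq_le M 2 (\<lambda>\<omega>. a \<bullet> Gn n u (epsvec eps s \<omega>) - a' \<bullet> G v (epsvec eps s \<omega>)) ((C + A) * e)"
proof -
  have "lq_le M q (\<lambda>\<omega>. Gn n u (epsvec eps s \<omega>) - G v (epsvec eps s \<omega>)) e"
    by (rule iffD2[OF lq_le_shift[of "\<lambda>x. Gn n u x - G v x"] d]) simp
  from lq_le_add[OF lq_le_inner[OF Gn_lq[OF assms(1), of n s] assms(6,7)] lq_le_inner[OF this assms(4,5)]]
  have "lq_le M q (\<lambda>\<omega>. (a - a') \<bullet> Gn n u (epsvec eps s \<omega>) + a' \<bullet> (Gn n u (epsvec eps s \<omega>) - G v (epsvec eps s \<omega>))) (e * C + A * e)"
    using q_gt by simp
  then have "lq_le M q (\<lambda>\<omega>. a \<bullet> Gn n u (epsvec eps s \<omega>) - a' \<bullet> G v (epsvec eps s \<omega>)) ((C + A) * e)"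
    by (simp add: algebra_simps)
  then show ?thesis by (rule lq_le_lower) (use q_gt in auto)
qed

text \<open>Weights and kernels are perturbed together. The bounds \<open>A * C\<close> for
  \<open>Gn\<close> and \<open>A * (C + 1)\<close> for \<open>G\<close> are merged into the larger
  one to obtain a single constant.\<close>

lemma cov_compare:
  assumes "u \<in> {0..1}" "u' \<in> {0..1}" "v \<in> {0..1}" and A: "0 < A"
    and ab: "norm a \<le> A" "norm a' \<le> A" "norm b \<le> A" "norm b' \<le> A" "norm (a - a') \<le> e" "norm (b - b') \<le> e" "0 < e"
    and d: "lq_le M q (\<lambda>\<omega>. Gn n u (epsvec eps 0 \<omega>) - G v (epsvec eps 0 \<omega>)) e"
      "lq_le M q (\<lambda>\<omega>. Gn n u' (epsvec eps 0 \<omega>) - G v (epsvec eps 0 \<omega>)) e"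
  shows "\<bar>cov M (\<lambda>\<omega>. a \<bullet> Gn n u (epsvec eps s \<omega>)) (\<lambda>\<omega>. b \<bullet> Gn n u' (epsvec eps t \<omega>))
     - cov M (\<lambda>\<omega>. a' \<bullet> G v (epsvec eps 0 \<omega>)) (\<lambda>\<omega>. b' \<bullet> G v (epsvec eps (t - s) \<omega>))\<bar>
     \<le> 4 * A * (C + 1) * (C + A) * e"
proof -
  have "cov M (\<lambda>\<omega>. a' \<bullet> G v (epsvec eps 0 \<omega>)) (\<lambda>\<omega>. b' \<bullet> G v (epsvec eps (t - s) \<omega>))
    = cov M (\<lambda>\<omega>. a' \<bullet> G v (epsvec eps s \<omega>)) (\<lambda>\<omega>. b' \<bullet> G v (epsvec eps t \<omega>))"
    by (subst (2) cov_shift) auto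
  moreover have "\<bar>cov M (\<lambda>\<omega>. a \<bullet> Gn n u (epsvec eps s \<omega>)) (\<lambda>\<omega>. b \<bullet> Gn n u' (epsvec eps t \<omega>))
     - cov M (\<lambda>\<omega>. a' \<bullet> G v (epsvec eps s \<omega>)) (\<lambda>\<omega>. b' \<bullet> G v (epsvec eps t \<omega>))\<bar>
     \<le> 2 * ((C + A) * e) * (A * C) + 2 * (A * (C + 1)) * ((C + A) * e)"
    by (rule cov_diff_bound[OF inner_lq[OF assms(1) ab(1) A] inner_G_lq[OF assms(3) ab(2) A]
          inner_diff_lq[OF assms(1,3) ab(1,2) A ab(5,7) d(1)] inner_lq[OF assms(2) ab(3) A]
          inner_G_lq[OF assms(3) ab(4) A] inner_diff_lq[OF assms(2,3) ab(3,4) A ab(6,7) d(2)]])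
      (use q_gt in auto)
  moreover have "2 * ((C + A) * e) * (A * C) \<le> 2 * ((C + A) * e) * (A * (C + 1))"
    using A C_pos ab by (intro mult_left_mono) auto
  moreover have "4 * A * (C + 1) * (C + A) * e = 2 * ((C + A) * e) * (A * (C + 1)) + 2 * (A * (C + 1)) * ((C + A) * e)"
    by (simp add: algebra_simps)
  ultimately show ?thesis by linarith
qed

text \<open>No coupling condition is imposed on \<open>G\<close> itself. Its decay is inherited from
  some \<open>Gn\<close> so close to it that the comparison error is exactly \<open>e\<close>, which
  also explains why \<open>C\<close> and not \<open>C + 1\<close> appears.\<close>

lemma G_cov_decay:
  assumes v: "v \<in> {0..1}" and ab: "norm a \<le> A" "norm b \<le> A" "0 < A"
  shows "\<bar>cov M (\<lambda>\<omega>. a \<bullet> G v (epsvec eps 0 \<omega>)) (\<lambda>\<omega>. b \<bullet> G v (epsvec eps h \<omega>))\<bar>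
    \<le> A\<^sup>2 * C\<^sup>2 / (1 - \<rho>) * \<rho> ^ nat \<bar>h\<bar>"
proof (rule field_le_epsilon)
  fix e :: real assume "0 < e"
  define e' where "e' = e / (4 * A * (C + 1) * (C + A))"
  have e': "0 < e'" "4 * A * (C + 1) * (C + A) * e' = e"
    using \<open>0 < e\<close> ab C_pos by (auto simp: e'_def less_imp_neq[symmetric])
  have "\<exists>n. \<forall>u\<in>{0..1}. lq_le M q (\<lambda>\<omega>. Gn n u (epsvec eps 0 \<omega>) - G u (epsvec eps 0 \<omega>)) e'"
    using eventually_happens[OF G_lim[OF e'(1)]] by simp
  then obtain n where n: "lq_le M q (\<lambda>\<omega>. Gn n v (epsvec eps 0 \<omega>) - G v (epsvec eps 0 \<omega>)) e'"
    using v by blast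
  show "\<bar>cov M (\<lambda>\<omega>. a \<bullet> G v (epsvec eps 0 \<omega>)) (\<lambda>\<omega>. b \<bullet> G v (epsvec eps h \<omega>))\<bar>
    \<le> A\<^sup>2 * C\<^sup>2 / (1 - \<rho>) * \<rho> ^ nat \<bar>h\<bar> + e"
    using cov_compare[OF v v v ab(3) ab(1,1,2,2) _ _ e'(1) n n, of 0 h]
      Gn_cov_decay[OF v v ab, of n 0 h] e' by auto
qed

end

section \<open>Averages and Riemann sums\<close>

text \<open>On either side of \<open>s\<close> the distance to \<open>s\<close> is injective, so
  each side contributes at most one full series.\<close>

lemma sum_abs_diff_le_suminf:
  fixes h :: "nat \<Rightarrow> real"
  assumes h: "summable h" "\<And>k. 0 \<le> h k" and F: "finite F"
  shows "(\<Sum>k\<in>F. h (nat \<bar>k - s\<bar>)) \<le> 2 * suminf h"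
proof -
  let ?F1 = "{k \<in> F. s \<le> k}" and ?F2 = "{k \<in> F. k < s}"
  have *: "(\<Sum>k\<in>F'. h (nat \<bar>k - s\<bar>)) \<le> suminf h" if "inj_on (\<lambda>k. nat \<bar>k - s\<bar>) F'" "finite F'" for F'
  proof -
    have "(\<Sum>k\<in>F'. h (nat \<bar>k - s\<bar>)) = sum h ((\<lambda>k. nat \<bar>k - s\<bar>) ` F')"
      by (simp add: sum.reindex[OF that(1)])
    also have "\<dots> \<le> suminf h" using h that(2) by (intro sum_le_suminf) auto
    finally show ?thesis .
  qed
  have "(\<Sum>k\<in>F. h (nat \<bar>k - s\<bar>)) = (\<Sum>k\<in>?F1 \<union> ?F2. h (nat \<bar>k - s\<bar>))"
    by (rule sum.cong) auto
  also have "\<dots> = (\<Sum>k\<in>?F1. h (nat \<bar>k - s\<bar>)) + (\<Sum>k\<in>?F2. h (nat \<bar>k - s\<bar>))"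
    using F by (intro sum.union_disjoint) auto
  also have "\<dots> \<le> suminf h + suminf h"
    using F by (intro add_mono * ) (auto simp: inj_on_def)
  finally show ?thesis by simp
qed

lemma sum_geometric_abs_diff:
  fixes \<rho> :: real
  assumes "0 < \<rho>" "\<rho> < 1" "finite F"
  shows "(\<Sum>k\<in>F. \<rho> ^ nat \<bar>k - s\<bar>) \<le> 2 / (1 - \<rho>)"
  using sum_abs_diff_le_suminf[of "\<lambda>k. \<rho> ^ k" F s] assms
  by (simp add: suminf_geometric summable_geometric)

lemma sum_nat_abs_diff:
  assumes "finite F" shows "(\<Sum>j\<in>F. h (nat \<bar>int j - s\<bar>)) = (\<Sum>k\<in>int ` F. h (nat \<bar>k - s\<bar>))"
  by (simp add: sum.reindex)

lemma geometric_bound_summable: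
  fixes \<gamma> :: "int \<Rightarrow> real"
  assumes "\<And>h. \<bar>\<gamma> h\<bar> \<le> K * \<rho> ^ nat \<bar>h\<bar>" "0 < \<rho>" "\<rho> < 1"
  shows "\<gamma> summable_on UNIV"
proof -
  have K: "0 \<le> K" using assms(1)[of 0] by simp
  have "(\<lambda>h. norm (\<gamma> h)) summable_on UNIV"
  proof (rule nonneg_bdd_above_summable_on)
    show "bdd_above (sum (\<lambda>h. norm (\<gamma> h)) ` {F. F \<subseteq> UNIV \<and> finite F})"
    proof (rule bdd_aboveI2)
      fix F :: "int set" assume "F \<in> {F. F \<subseteq> UNIV \<and> finite F}"
      then have F: "finite F" by simp
      have "sum (\<lambda>h. norm (\<gamma> h)) F \<le> (\<Sum>h\<in>F. K * \<rho> ^ nat \<bar>h\<bar>)" using assms(1) by (intro sum_mono) auto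
      also have "\<dots> = K * (\<Sum>h\<in>F. \<rho> ^ nat \<bar>h - 0\<bar>)" by (simp add: sum_distrib_left)
      also have "\<dots> \<le> K * (2 / (1 - \<rho>))" by (intro mult_left_mono sum_geometric_abs_diff assms F K)
      finally show "sum (\<lambda>h. norm (\<gamma> h)) F \<le> K * (2 / (1 - \<rho>))" .
    qed
  qed simp
  then show ?thesis by (rule abs_summable_summable)
qed

text \<open>A Cesaro argument: a row further than \<open>H\<close> from both ends contains all the
  lags that matter and sums nearly to the limit. The at most \<open>2 * H\<close> rows near the ends
  have bounded error and disappear after division.\<close>

lemma toeplitz_average:
  fixes \<gamma> :: "int \<Rightarrow> real"
  assumes \<gamma>: "\<And>h. \<bar>\<gamma> h\<bar> \<le> K * \<rho> ^ nat \<bar>h\<bar>" and \<rho>: "0 < \<rho>" "\<rho> < 1"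
    and b: "filterlim b at_top sequentially"
  shows "(\<lambda>n. (\<Sum>i\<in>{1..b n}. \<Sum>j\<in>{1..b n}. \<gamma> (int j - int i)) / real (b n)) \<longlonglongrightarrow> infsum \<gamma> UNIV"
proof (rule LIMSEQ_I)
  fix e :: real assume e: "0 < e"
  have K: "0 \<le> K" using \<gamma>[of 0] by simp
  let ?\<Gamma> = "infsum \<gamma> UNIV"
  define B where "B = K * (2 / (1 - \<rho>)) + \<bar>?\<Gamma>\<bar>"
  have B0: "0 \<le> B" using K \<rho> by (simp add: B_def)
  have "(sum \<gamma> \<longlongrightarrow> ?\<Gamma>) (finite_subsets_at_top UNIV)"
    using has_sum_infsum[OF geometric_bound_summable[OF \<gamma> \<rho>]] by (simp add: has_sum_def)
  then have "\<forall>\<^sub>F F in finite_subsets_at_top UNIV. dist (sum \<gamma> F) ?\<Gamma> < e / 2"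
    by (rule tendstoD) (use e in simp)
  then obtain F0 where F0: "finite F0" "\<And>F. finite F \<Longrightarrow> F0 \<subseteq> F \<Longrightarrow> \<bar>sum \<gamma> F - ?\<Gamma>\<bar> < e / 2"
    by (auto simp: eventually_finite_subsets_at_top dist_real_def)
  obtain H where H: "\<And>h. h \<in> F0 \<Longrightarrow> nat \<bar>h\<bar> \<le> H"
    using F0(1) by (metis finite_nat_set_iff_bounded_le finite_imageI imageI)
  have inner_eq: "(\<Sum>j\<in>{1..m}. \<gamma> (int j - int i)) = sum \<gamma> ((\<lambda>j. int j - int i) ` {1..m})" for i m :: nat
    by (subst sum.reindex) (auto simp: inj_on_def)
  have good: "\<bar>(\<Sum>j\<in>{1..m}. \<gamma> (int j - int i)) - ?\<Gamma>\<bar> \<le> e / 2" if "H < i" "i + H \<le> m" for i m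
  proof -
    have "F0 \<subseteq> (\<lambda>j. int j - int i) ` {1..m}"
    proof
      fix h assume "h \<in> F0"
      then have "nat \<bar>h\<bar> \<le> H" by (rule H)
      then show "h \<in> (\<lambda>j. int j - int i) ` {1..m}"
        using that by (intro image_eqI[of _ _ "nat (h + int i)"]) auto
    qed
    from F0(2)[OF _ this] show ?thesis unfolding inner_eq by simp
  qed
  have bad: "\<bar>(\<Sum>j\<in>{1..m}. \<gamma> (int j - int i)) - ?\<Gamma>\<bar> \<le> B" for i m
  proof -
    have "\<bar>\<Sum>j\<in>{1..m}. \<gamma> (int j - int i)\<bar> \<le> (\<Sum>j\<in>{1..m}. \<bar>\<gamma> (int j - int i)\<bar>)" by (rule sum_abs)
    also have "\<dots> \<le> (\<Sum>j\<in>{1..m}. K * \<rho> ^ nat \<bar>int j - int i\<bar>)" by (intro sum_mono \<gamma>)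
    also have "\<dots> = K * (\<Sum>k\<in>int ` {1..m}. \<rho> ^ nat \<bar>k - int i\<bar>)"
      using sum_nat_abs_diff[of "{1..m}" "\<lambda>k. \<rho> ^ k" "int i"] by (simp only: sum_distrib_left[symmetric] finite_atLeastAtMost)
    also have "\<dots> \<le> K * (2 / (1 - \<rho>))"
      by (intro mult_left_mono sum_geometric_abs_diff \<rho> K) auto
    finally show ?thesis unfolding B_def by linarith
  qed
  \<comment> \<open>Above this threshold the rows near the ends contribute
    \<open>2 * H * B / b n\<close>, which is less than \<open>e / 2\<close>.\<close>
  obtain n0 where n0: "\<And>n. n \<ge> n0 \<Longrightarrow> nat \<lceil>4 * real H * B / e\<rceil> + 2 * H + 1 \<le> b n"
    using b[unfolded filterlim_at_top] unfolding eventually_sequentially by metis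
  have "\<bar>(\<Sum>i\<in>{1..b n}. \<Sum>j\<in>{1..b n}. \<gamma> (int j - int i)) / real (b n) - ?\<Gamma>\<bar> < e" if "n \<ge> n0" for n
  proof -
    define m where "m = b n"
    have m: "4 * real H * B / e < real m" "2 * H < m" "0 < m"
      using n0[OF that] by (auto simp: m_def) linarith
    let ?x = "\<lambda>i. (\<Sum>j\<in>{1..m}. \<gamma> (int j - int i)) - ?\<Gamma>"
    have "(\<Sum>i\<in>{1..m}. \<Sum>j\<in>{1..m}. \<gamma> (int j - int i)) / real m - ?\<Gamma> = (\<Sum>i\<in>{1..m}. ?x i) / real m"
      using m(3) by (simp add: sum_subtractf field_simps)
    also have "\<bar>\<dots>\<bar> \<le> (\<Sum>i\<in>{1..m}. \<bar>?x i\<bar>) / real m"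
      by (simp add: divide_right_mono sum_abs)
    also have "(\<Sum>i\<in>{1..m}. \<bar>?x i\<bar>) \<le> (\<Sum>i\<in>{1..m}. e / 2 + (if i \<in> {1..H} \<union> {m-H<..m} then B else 0))"
    proof (rule sum_mono)
      fix i assume "i \<in> {1..m}"
      then show "\<bar>?x i\<bar> \<le> e / 2 + (if i \<in> {1..H} \<union> {m-H<..m} then B else 0)"
        using good[of i m] bad[of i m] e B0 m by (cases "H < i \<and> i + H \<le> m") auto
    qed
    also have "\<dots> = m * (e / 2) + card ({1..m} \<inter> ({1..H} \<union> {m-H<..m})) * B"
      unfolding sum.distrib sum.inter_restrict[OF finite_atLeastAtMost, symmetric] by simp
    also have "card ({1..m} \<inter> ({1..H} \<union> {m-H<..m})) \<le> card ({1..H} \<union> {m-H<..m})"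
      by (intro card_mono) auto
    also have "\<dots> \<le> card {1..H} + card {m-H<..m}" by (rule card_Un_le)
    also have "\<dots> = 2 * H" using m by simp
    finally have "\<bar>(\<Sum>i\<in>{1..m}. \<Sum>j\<in>{1..m}. \<gamma> (int j - int i)) / real m - ?\<Gamma>\<bar>
       \<le> (m * (e / 2) + real (2 * H) * B) / real m"
      using B0 m(3) by (auto simp: divide_right_mono mult_right_mono)
    also have "\<dots> < e"
    proof -
      have "4 * real H * B < e * m" using m(1) e by (simp add: divide_less_eq mult.commute)
      then show ?thesis using m(3) by (simp add: divide_less_eq field_simps)
    qed
    finally show ?thesis by (simp add: m_def)
  qed
  then show "\<exists>no. \<forall>n\<ge>no. norm ((\<Sum>i\<in>{1..b n}. \<Sum>j\<in>{1..b n}. \<gamma> (int j - int i)) / real (b n) - ?\<Gamma>) < e"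
    by auto
qed

text \<open>Uniformly small entrywise errors do not suffice, since about the square of
  \<open>b n\<close> entries are divided only by \<open>b n\<close>. Interpolating with the
  geometric decay makes the errors summable along each row, at the rate
  \<open>sqrt \<rho>\<close>.\<close>

lemma near_toeplitz_average:
  fixes \<gamma> :: "int \<Rightarrow> real" and c :: "nat \<Rightarrow> nat \<Rightarrow> nat \<Rightarrow> real"
  assumes \<gamma>: "\<And>h. \<bar>\<gamma> h\<bar> \<le> K * \<rho> ^ nat \<bar>h\<bar>" and \<rho>: "0 < \<rho>" "\<rho> < 1"
    and b: "filterlim b at_top sequentially"
    and c: "\<forall>\<^sub>F n in sequentially. \<forall>i\<in>{1..b n}. \<forall>j\<in>{1..b n}. \<bar>c n i j\<bar> \<le> K * \<rho> ^ nat \<bar>int j - int i\<bar>"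
    and lim: "\<And>e. 0 < e \<Longrightarrow> \<forall>\<^sub>F n in sequentially. \<forall>i\<in>{1..b n}. \<forall>j\<in>{1..b n}. \<bar>c n i j - \<gamma> (int j - int i)\<bar> \<le> e"
  shows "(\<lambda>n. (\<Sum>i\<in>{1..b n}. \<Sum>j\<in>{1..b n}. c n i j) / real (b n)) \<longlonglongrightarrow> infsum \<gamma> UNIV"
proof -
  have K: "0 \<le> K" using \<gamma>[of 0] by simp
  define R where "R = 2 / (1 - sqrt \<rho>)"
  have sr: "0 < sqrt \<rho>" "sqrt \<rho> < 1" using \<rho> by auto
  have R: "0 < R" using sr by (simp add: R_def)
  have "(\<lambda>n. (\<Sum>i\<in>{1..b n}. \<Sum>j\<in>{1..b n}. c n i j) / real (b n)
      - (\<Sum>i\<in>{1..b n}. \<Sum>j\<in>{1..b n}. \<gamma> (int j - int i)) / real (b n)) \<longlonglongrightarrow> 0"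
  proof (rule tendstoI)
    fix e :: real assume e: "0 < e"
    \<comment> \<open>Chosen so that the geometric mean of \<open>e'\<close> and
      \<open>2 * K\<close> is at most \<open>e / (2 * R)\<close>, where \<open>R\<close> bounds the
      row sums of powers of \<open>sqrt \<rho>\<close>. The added 1 avoids dividing by zero when
      \<open>K = 0\<close>.\<close>
    define e' where "e' = (e / (2 * R))\<^sup>2 / (2 * K + 1)"
    have e'_pos: "0 < e'" using e R K by (auto simp: e'_def)
    have "(2 * K + 1) * e' = (e / (2 * R))\<^sup>2" using K by (simp add: e'_def)
    moreover have "2 * K * e' \<le> (2 * K + 1) * e'" using e'_pos by (intro mult_right_mono) auto
    ultimately have e': "0 < e'" "2 * K * e' \<le> (e / (2 * R))\<^sup>2" using e'_pos by auto
    show "\<forall>\<^sub>F n in sequentially. dist ((\<Sum>i\<in>{1..b n}. \<Sum>j\<in>{1..b n}. c n i j) / real (b n)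
      - (\<Sum>i\<in>{1..b n}. \<Sum>j\<in>{1..b n}. \<gamma> (int j - int i)) / real (b n)) 0 < e"
      using c lim[OF e'(1)] b[unfolded filterlim_at_top, rule_format, of 1]
    proof eventually_elim
      case (elim n)
      \<comment> \<open>a quantity bounded by both \<open>e'\<close> and \<open>2 K \<rho>\<^sup>k\<close> is bounded by their geometric mean\<close>
      have pt: "\<bar>c n i j - \<gamma> (int j - int i)\<bar> \<le> e / (2 * R) * sqrt \<rho> ^ nat \<bar>int j - int i\<bar>"
        if ij: "i \<in> {1..b n}" "j \<in> {1..b n}" for i j
      proof -
        let ?y = "\<bar>c n i j - \<gamma> (int j - int i)\<bar>" and ?k = "nat \<bar>int j - int i\<bar>"
        have "?y \<le> \<bar>c n i j\<bar> + \<bar>\<gamma> (int j - int i)\<bar>" by simp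
        then have 1: "?y \<le> 2 * K * \<rho> ^ ?k" using elim(1) ij \<gamma>[of "int j - int i"] by fastforce
        have 2: "?y \<le> e'" using elim(2) ij by blast
        have "?y\<^sup>2 \<le> e' * (2 * K * \<rho> ^ ?k)"
          unfolding power2_eq_square using 1 2 e'(1) by (intro mult_mono) auto
        also have "\<dots> = 2 * K * e' * \<rho> ^ ?k" by simp
        also have "\<dots> \<le> (e / (2 * R))\<^sup>2 * \<rho> ^ ?k" using e'(2) \<rho> by (intro mult_right_mono) auto
        also have "\<rho> ^ ?k = (sqrt \<rho> ^ ?k)\<^sup>2"
          using \<rho> by (simp add: power_mult[symmetric] mult.commute[of _ 2]) (simp add: power_mult)
        finally have "?y\<^sup>2 \<le> (e / (2 * R) * sqrt \<rho> ^ ?k)\<^sup>2" unfolding power_mult_distrib .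
        then show ?thesis by (rule power2_le_imp_le) (use e R \<rho> in auto)
      qed
      have m: "0 < real (b n)" using elim(3) by simp
      have "\<bar>(\<Sum>i\<in>{1..b n}. \<Sum>j\<in>{1..b n}. c n i j) - (\<Sum>i\<in>{1..b n}. \<Sum>j\<in>{1..b n}. \<gamma> (int j - int i))\<bar>
         \<le> (\<Sum>i\<in>{1..b n}. \<Sum>j\<in>{1..b n}. \<bar>c n i j - \<gamma> (int j - int i)\<bar>)"
        unfolding sum_subtractf[symmetric] by (intro order_trans[OF sum_abs] sum_mono sum_abs)
      also have "\<dots> \<le> (\<Sum>i\<in>{1..b n}. \<Sum>j\<in>{1..b n}. e / (2 * R) * sqrt \<rho> ^ nat \<bar>int j - int i\<bar>)"
        by (intro sum_mono pt)
      also have "\<dots> \<le> (\<Sum>i\<in>{1..b n}. e / (2 * R) * R)"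
      proof (rule sum_mono)
        fix i assume "i \<in> {1..b n}"
        have "(\<Sum>j\<in>{1..b n}. e / (2 * R) * sqrt \<rho> ^ nat \<bar>int j - int i\<bar>)
           = e / (2 * R) * (\<Sum>k\<in>int ` {1..b n}. sqrt \<rho> ^ nat \<bar>k - int i\<bar>)"
          using sum_nat_abs_diff[of "{1..b n}" "\<lambda>k. sqrt \<rho> ^ k" "int i"] by (simp only: sum_distrib_left[symmetric] finite_atLeastAtMost)
        also have "\<dots> \<le> e / (2 * R) * R"
          unfolding R_def using sr e by (intro mult_left_mono sum_geometric_abs_diff) auto
        finally show "(\<Sum>j\<in>{1..b n}. e / (2 * R) * sqrt \<rho> ^ nat \<bar>int j - int i\<bar>) \<le> e / (2 * R) * R" .
      qed
      also have "\<dots> = real (b n) * (e / 2)" using R by simp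
      finally have le: "\<bar>(\<Sum>i\<in>{1..b n}. \<Sum>j\<in>{1..b n}. c n i j) - (\<Sum>i\<in>{1..b n}. \<Sum>j\<in>{1..b n}. \<gamma> (int j - int i))\<bar>
        \<le> real (b n) * (e / 2)" .
      have "\<bar>x / real (b n) - y / real (b n)\<bar> < e" if "\<bar>x - y\<bar> \<le> real (b n) * (e / 2)" for x y
      proof -
        have "\<bar>x / real (b n) - y / real (b n)\<bar> = \<bar>x - y\<bar> / real (b n)"
          using m by (simp add: diff_divide_distrib[symmetric])
        also have "\<dots> \<le> e / 2" using that m by (simp add: divide_le_eq mult.commute)
        finally show ?thesis using e by simp
      qed
      from this[OF le] show ?case by (simp add: dist_real_def)
    qed
  qed
  from tendsto_add[OF this toeplitz_average[OF \<gamma> \<rho> b]] show ?thesis by simp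
qed

section \<open>Riemann sums as integrals of step functions\<close>

lemma has_integral_step:
  fixes h :: "nat \<Rightarrow> real"
  assumes n: "0 < n"
  shows "((\<lambda>v. h (nat \<lceil>real n * v\<rceil>)) has_integral (\<Sum>t\<in>{1..k}. h t) / real n) {0..real k / real n}"
proof (induction k)
  case 0
  then show ?case using has_integral_refl(2) by simp
next
  case (Suc k)
  \<comment> \<open>To the right of \<open>k / n\<close> and up to \<open>(k + 1) / n\<close> the
    ceiling equals \<open>k + 1\<close>; only the left endpoint has to be discarded.\<close>
  have "((\<lambda>v. h (nat \<lceil>real n * v\<rceil>)) has_integral h (Suc k) / real n) {real k / real n..real (Suc k) / real n}"
  proof -
    have c: "((\<lambda>v. h (Suc k)) has_integral h (Suc k) / real n) {real k / real n..real (Suc k) / real n}"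
      using has_integral_const_real[of "h (Suc k)" "real k / real n" "real (Suc k) / real n"] n
      by (simp add: content_real field_simps diff_divide_distrib[symmetric])
    show ?thesis
    proof (rule has_integral_spike_finite[OF _ _ c])
      show "finite {real k / real n}" by simp
      fix v assume v: "v \<in> {real k / real n..real (Suc k) / real n} - {real k / real n}"
      then have "real k < real n * v" "real n * v \<le> real k + 1" using n by (auto simp: field_simps)
      then have "\<lceil>real n * v\<rceil> = int k + 1" by (intro ceiling_unique) auto
      then show "h (nat \<lceil>real n * v\<rceil>) = h (Suc k)" by (simp add: nat_add_distrib)
    qed
  qed
  from has_integral_combine[OF _ _ Suc this] n show ?case
    by (simp add: add_divide_distrib divide_right_mono)
qed

text \<open>The averages are integrals of step functions bounded by \<open>K\<close>. Dominated
  convergence then yields integrability of the limit as well, which is otherwise unclear for the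
  long-run variance.\<close>

lemma riemann_dominated:
  fixes m :: "nat \<Rightarrow> nat \<Rightarrow> real" and g :: "real \<Rightarrow> real"
  assumes u: "0 \<le> u" "u \<le> 1" and N: "countable N"
    and lo: "\<And>n. 1 \<le> lo n" "(\<lambda>n. real (lo n) / real n) \<longlonglongrightarrow> 0"
    and hi: "\<And>n. real (hi n) \<le> real n * u" "(\<lambda>n. real (hi n) / real n) \<longlonglongrightarrow> u"
    and K: "\<And>n t. \<bar>m n t\<bar> \<le> K"
    and lim: "\<And>v. 0 < v \<Longrightarrow> v < u \<Longrightarrow> v \<notin> N \<Longrightarrow> (\<lambda>n. m n (nat \<lceil>real n * v\<rceil>)) \<longlonglongrightarrow> g v"
  shows "g integrable_on {0..u}"
    and "(\<lambda>n. (\<Sum>t\<in>{lo n..hi n}. m n t) / real n) \<longlonglongrightarrow> integral {0..u} g"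
proof -
  define h where "h = (\<lambda>n t. if t \<in> {lo n..hi n} then m n t else 0)"
  define N' where "N' = N \<union> {0, u}"
  have "negligible (\<Union>((\<lambda>x. {x}) ` N'))"
    using N by (intro negligible_countable_Union) (auto simp: N'_def)
  then have neg: "negligible N'" by simp
  \<comment> \<open>Setting the functions to 0 on the negligible set turns convergence almost
    everywhere into convergence at every point.\<close>
  define F where "F = (\<lambda>n v. if v \<in> N' then 0 else h n (nat \<lceil>real n * v\<rceil>))"
  define g' where "g' = (\<lambda>v. if v \<in> N' then 0 else if v \<in> {0..u} then g v else 0)"
  have hi_le: "hi n \<le> n" for n
  proof -
    have "real (hi n) \<le> real n * 1" using hi(1)[of n] u by (meson mult_left_mono of_nat_0_le_iff order_trans)
    then show ?thesis by simp
  qed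
  have F: "(F n has_integral (\<Sum>t\<in>{lo n..hi n}. m n t) / real n) {0..1}" if "0 < n" for n
  proof -
    have "(\<Sum>t\<in>{1..n}. h n t) = (\<Sum>t\<in>{lo n..hi n}. m n t)"
      unfolding h_def using lo(1)[of n] hi_le[of n] by (intro sum.mono_neutral_cong_right) auto
    then have "((\<lambda>v. h n (nat \<lceil>real n * v\<rceil>)) has_integral (\<Sum>t\<in>{lo n..hi n}. m n t) / real n) {0..1}"
      using has_integral_step[OF that, of "h n" n] that by simp
    then show ?thesis by (rule has_integral_spike[OF neg, rotated]) (auto simp: F_def)
  qed
  have K0: "0 \<le> K" using K[of 0 0] by simp
  have conv: "(\<lambda>n. F n v) \<longlonglongrightarrow> g' v" if v: "v \<in> {0..1}" for v
  proof (cases "v \<in> N' \<or> u < v")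
    case True
    have "F n v = 0" if "v \<notin> N'" "u < v" for n
    proof -
      \<comment> \<open>For \<open>n = 0\<close> the index does not exceed \<open>hi n\<close>: both
        are 0, and the index is excluded only because \<open>lo n \<ge> 1\<close>.\<close>
      have "hi n < nat \<lceil>real n * v\<rceil> \<or> hi n = 0 \<and> nat \<lceil>real n * v\<rceil> = 0"
      proof (cases "n = 0")
        case False
        then have "real n * u < real n * v" using that by simp
        then show ?thesis using hi(1)[of n] by linarith
      qed (use hi_le[of 0] in auto)
      then have "nat \<lceil>real n * v\<rceil> \<notin> {lo n..hi n}" 
      proof (elim disjE conjE)
        assume "nat \<lceil>real n * v\<rceil> = 0"
        then show ?thesis using lo(1)[of n] unfolding \<open>nat \<lceil>real n * v\<rceil> = 0\<close> by simp
      qed (metis atLeastAtMost_iff leD)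
      then show ?thesis by (simp only: F_def h_def if_False if_cancel)
    qed
    then show ?thesis using True by (auto simp: F_def g'_def)
  next
    case False
    then have v': "0 < v" "v < u" "v \<notin> N" "v \<notin> N'" using v by (auto simp: N'_def)
    have l1: "\<forall>\<^sub>F n in sequentially. real (lo n) / real n < v"
      using order_tendstoD(2)[OF lo(2), of v] v' by simp
    \<comment> \<open>The margin \<open>1 / n\<close> allows for the rounding up of
      \<open>n * v\<close>.\<close>
    have "(\<lambda>n. real (hi n) / real n - 1 / real n) \<longlonglongrightarrow> u - 0"
      by (intro tendsto_diff hi(2) lim_1_over_n)
    then have l2: "\<forall>\<^sub>F n in sequentially. v < real (hi n) / real n - 1 / real n"
      using order_tendstoD(1)[of _ "u - 0" _ v] v' by simp
    have "\<forall>\<^sub>F n in sequentially. m n (nat \<lceil>real n * v\<rceil>) = F n v"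
      using l1 l2 eventually_gt_at_top[of 0]
    proof eventually_elim
      case (elim n)
      have "real (lo n) < real n * v" "real n * v < real (hi n) - 1"
        using elim by (auto simp: field_simps)
      then have "lo n \<le> nat \<lceil>real n * v\<rceil>" "nat \<lceil>real n * v\<rceil> \<le> hi n" by linarith+
      then show ?case using v' by (simp add: F_def h_def)
    qed
    from Lim_transform_eventually[OF lim[OF v'(1-3)] this] show ?thesis
      using v' by (simp add: g'_def)
  qed
  have dom: "norm (F n v) \<le> K" for n v using K K0 by (auto simp: F_def h_def)
  \<comment> \<open>The sequence is shifted by one because the identification with the Riemann sum
    holds only for \<open>n > 0\<close>.\<close>
  have dc: "g' integrable_on {0..1}" "(\<lambda>n. integral {0..1} (F (Suc n))) \<longlonglongrightarrow> integral {0..1} g'"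
    using dominated_convergence[of "\<lambda>n. F (Suc n)" "{0..1}" "\<lambda>_. K" g'] F dom LIMSEQ_Suc[OF conv]
    by (auto simp: has_integral_integrable_integral)
  have sp: "(\<lambda>v. if v \<in> {0..u} then g v else 0) integrable_on {0..1}"
    by (rule integrable_spike[OF dc(1) neg]) (simp add: g'_def)
  have sub: "{0..u} \<subseteq> {0..1}" using u by auto
  show "g integrable_on {0..u}" using sp unfolding integrable_restrict_Int Int_absorb2[OF sub] .
  have "integral {0..1} g' = integral {0..1} (\<lambda>v. if v \<in> {0..u} then g v else 0)"
    by (intro integral_spike[OF neg]) (auto simp: g'_def)
  also have "\<dots> = integral {0..u} g" unfolding integral_restrict_Int Int_absorb2[OF sub] ..
  finally have "(\<lambda>n. integral {0..1} (F (Suc n))) \<longlonglongrightarrow> integral {0..u} g" using dc(2) by simp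
  moreover have "integral {0..1} (F (Suc n)) = (\<Sum>t\<in>{lo (Suc n)..hi (Suc n)}. m (Suc n) t) / real (Suc n)" for n
    by (rule integral_unique[OF F]) simp
  ultimately have "(\<lambda>n. (\<Sum>t\<in>{lo (Suc n)..hi (Suc n)}. m (Suc n) t) / real (Suc n)) \<longlonglongrightarrow> integral {0..u} g"
    by (simp only:)
  then show "(\<lambda>n. (\<Sum>t\<in>{lo n..hi n}. m n t) / real n) \<longlonglongrightarrow> integral {0..u} g"
    by (rule LIMSEQ_imp_Suc)
qed

section \<open>Squared windows\<close>

lemma has_sum_sum:
  fixes f :: "'i \<Rightarrow> 'x \<Rightarrow> real"
  assumes "finite I" "\<And>i. i \<in> I \<Longrightarrow> (f i has_sum s i) A"
  shows "((\<lambda>x. \<Sum>i\<in>I. f i x) has_sum (\<Sum>i\<in>I. s i)) A"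
  using assms by (induction I rule: finite_induct) (auto intro!: has_sum_add)

context locally_stationary
begin

text \<open>A functional of the whole two-sided sequence instead of the sample point, so that it can
  be evaluated at \<open>path\<close> and at \<open>coupled r\<close> alike.\<close>

definition win :: "'a \<Rightarrow> nat \<Rightarrow> nat \<Rightarrow> nat \<Rightarrow> (int \<Rightarrow> real) \<Rightarrow> real" where
  "win a n t b x = (\<Sum>i\<in>{1..b}. a \<bullet> (Gn n (real (t + i) / real n) (past x (int (t + i))) - mun n (real (t + i) / real n)))"

definition sqwin :: "'a \<Rightarrow> nat \<Rightarrow> nat \<Rightarrow> nat \<Rightarrow> (int \<Rightarrow> real) \<Rightarrow> real" where
  "sqwin a n t b x = (win a n t b x)\<^sup>2 / real b"

lemma win_meas [measurable]: "win a n t b \<in> borel_measurable seqM"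
  unfolding win_def by measurable

lemma sqwin_meas [measurable]: "sqwin a n t b \<in> borel_measurable seqM"
  unfolding sqwin_def by measurable

lemma grid_mem: "t + b \<le> n \<Longrightarrow> i \<in> {1..b} \<Longrightarrow> real (t + i) / real n \<in> {0..1}"
  by (auto simp: divide_le_eq)

lemma centred_lq:
  assumes "u \<in> {0..1}"
  shows "lq_le M q (\<lambda>\<omega>. Gn n u (epsvec eps s \<omega>) - mun n u) (2 * C)"
  using lq_le_diff[OF Gn_lq[OF assms, of n s] lq_le_const[OF C_pos Gn_mean(2)[OF assms]]] q_gt by simp

text \<open>Minkowski's inequality alone. Ignoring cancellation costs the order \<open>b\<close>,
  and this is what leads to a variance of order \<open>b^3 / n\<close>.\<close>

lemma win_lq:
  assumes "t + b \<le> n" "1 \<le> b" "norm a \<le> A" "0 < A"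
  shows "lq_le M 4 (\<lambda>\<omega>. win a n t b (path \<omega>)) (real b * (2 * A * C))"
proof -
  have "lq_le M 4 (\<lambda>\<omega>. win a n t b (path \<omega>)) (\<Sum>i\<in>{1..b}. A * (2 * C))"
    unfolding win_def epsvec_eq[symmetric]
    by (intro lq_le_sum lq_le_inner lq_le_lower[OF centred_lq] grid_mem) (use assms q_gt in auto)
  then show ?thesis by (simp add: mult_ac)
qed

text \<open>The \<open>i\<close>-th observation lies \<open>i\<close> further steps after the
  renewed past, so the errors within a window sum geometrically. The bound is free of
  \<open>b\<close>, and the second factor \<open>1 - \<rho>\<close> comes from this sum.\<close>

lemma win_coupled:
  assumes "t + b \<le> n" "1 \<le> b" "norm a \<le> A" "0 < A" "r \<le> int t"
  shows "lq_le M 4 (\<lambda>\<omega>. win a n t b (path \<omega>) - win a n t b (coupled r \<omega>)) (A * C / (1 - \<rho>)\<^sup>2 * \<rho> ^ nat (int t - r))"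
proof -
  have "lq_le M 4 (\<lambda>\<omega>. \<Sum>i\<in>{1..b}. a \<bullet> (Gn n (real (t + i) / real n) (past (path \<omega>) (int (t + i)))
       - Gn n (real (t + i) / real n) (past (coupled r \<omega>) (int (t + i)))))
     (\<Sum>i\<in>{1..b}. A * (C * \<rho> ^ nat (int (t + i) - r) / (1 - \<rho>)))"
    by (intro lq_le_sum lq_le_inner lq_le_lower[OF coupling] grid_mem) (use assms q_gt in auto)
  moreover have "(\<Sum>i\<in>{1..b}. a \<bullet> (Gn n (real (t + i) / real n) (past (path \<omega>) (int (t + i)))
       - Gn n (real (t + i) / real n) (past (coupled r \<omega>) (int (t + i)))))
    = win a n t b (path \<omega>) - win a n t b (coupled r \<omega>)" for \<omega>
    unfolding win_def sum_subtractf[symmetric] by (intro sum.cong) (auto simp: algebra_simps)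
  moreover have "(\<Sum>i\<in>{1..b}. A * (C * \<rho> ^ nat (int (t + i) - r) / (1 - \<rho>))) \<le> A * C / (1 - \<rho>)\<^sup>2 * \<rho> ^ nat (int t - r)"
  proof -
    have "nat (int (t + i) - r) = nat (int t - r) + i" for i
      using assms(5) by simp
    then have "(\<Sum>i\<in>{1..b}. A * (C * \<rho> ^ nat (int (t + i) - r) / (1 - \<rho>)))
       = A * C / (1 - \<rho>) * \<rho> ^ nat (int t - r) * (\<Sum>i\<in>{1..b}. \<rho> ^ i)"
      unfolding sum_distrib_left by (intro sum.cong refl) (simp add: power_add)
    also have "\<dots> \<le> A * C / (1 - \<rho>) * \<rho> ^ nat (int t - r) * (1 / (1 - \<rho>))"
    proof (rule mult_left_mono)
      have "(\<Sum>i\<in>{1..b}. \<rho> ^ i) \<le> (\<Sum>i. \<rho> ^ i)"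
        using \<rho> by (intro sum_le_suminf summable_geometric) auto
      then show "(\<Sum>i\<in>{1..b}. \<rho> ^ i) \<le> 1 / (1 - \<rho>)" using \<rho> by (simp add: suminf_geometric)
    qed (use \<rho> C_pos assms in auto)
    finally show ?thesis by (simp add: power2_eq_square)
  qed
  ultimately show ?thesis by (auto intro: lq_le_mono)
qed

lemma sqwin_lq:
  assumes "t + b \<le> n" "1 \<le> b" "norm a \<le> A" "0 < A"
  shows "lq_le M 2 (\<lambda>\<omega>. sqwin a n t b (path \<omega>)) (real b * (2 * A * C)\<^sup>2)"
proof -
  have "lq_le M 2 (\<lambda>\<omega>. win a n t b (path \<omega>) * win a n t b (path \<omega>)) (real b * (2 * A * C) * (real b * (2 * A * C)))"
    by (rule lq_le_mult) (use win_lq[OF assms] in simp_all)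
  then have "lq_le M 2 (\<lambda>\<omega>. sqwin a n t b (path \<omega>)) (1 / real b * (real b * (2 * A * C) * (real b * (2 * A * C))))"
    by (rule lq_le_scaled) (use assms in \<open>auto simp: sqwin_def power2_eq_square abs_mult\<close>)
  then show ?thesis using assms(2) by (simp add: power2_eq_square mult_ac)
qed

text \<open>A difference of squares is the coupling error times the sum of the two windows; the
  factor \<open>b\<close> in the bound of that sum cancels the normalisation.\<close>

lemma sqwin_coupled:
  assumes "t + b \<le> n" "1 \<le> b" "norm a \<le> A" "0 < A" "r \<le> int t"
  shows "lq_le M 2 (\<lambda>\<omega>. sqwin a n t b (path \<omega>) - sqwin a n t b (coupled r \<omega>))
    ((2 * A * C)\<^sup>2 / (1 - \<rho>)\<^sup>2 * \<rho> ^ nat (int t - r))"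
proof -
  let ?w = "\<lambda>\<omega>. win a n t b (path \<omega>)" and ?w' = "\<lambda>\<omega>. win a n t b (coupled r \<omega>)"
  let ?c = "real b * (2 * A * C)" and ?d = "A * C / (1 - \<rho>)\<^sup>2 * \<rho> ^ nat (int t - r)"
  have w': "lq_le M 4 ?w' ?c"
    using win_lq[OF assms(1-4)] reindex_lq_le[OF inj_Inl inj_renew win_meas] by blast
  have sum: "lq_le M 4 (\<lambda>\<omega>. ?w \<omega> + ?w' \<omega>) (?c + ?c)"
    by (rule lq_le_add[OF win_lq[OF assms(1-4)] w']) simp
  have "lq_le M 2 (\<lambda>\<omega>. (?w \<omega> - ?w' \<omega>) * (?w \<omega> + ?w' \<omega>)) (?d * (?c + ?c))"
    by (rule lq_le_mult) (use win_coupled[OF assms] sum in simp_all)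
  then have "lq_le M 2 (\<lambda>\<omega>. sqwin a n t b (path \<omega>) - sqwin a n t b (coupled r \<omega>)) (1 / real b * (?d * (?c + ?c)))"
  proof (rule lq_le_scaled)
    show "norm (sqwin a n t b (path \<omega>) - sqwin a n t b (coupled r \<omega>)) \<le> 1 / real b * norm ((?w \<omega> - ?w' \<omega>) * (?w \<omega> + ?w' \<omega>))" for \<omega>
    proof -
      have "sqwin a n t b (path \<omega>) - sqwin a n t b (coupled r \<omega>) = 1 / real b * ((?w \<omega> - ?w' \<omega>) * (?w \<omega> + ?w' \<omega>))"
        by (simp add: sqwin_def diff_divide_distrib[symmetric] square_diff_square_factored power2_eq_square mult.commute)
      then show ?thesis by (simp add: abs_mult)
    qed
  qed (use assms in auto)
  moreover have "1 / real b * (?d * (?c + ?c)) = (2 * A * C)\<^sup>2 / (1 - \<rho>)\<^sup>2 * \<rho> ^ nat (int t - r)"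
    using assms(2) by (simp add: power2_eq_square field_simps)
  ultimately show ?thesis by (simp only:)
qed

lemma win_causal:
  assumes "\<And>k. k \<le> int (t + b) \<Longrightarrow> x k = y k"
  shows "win a n t b x = win a n t b y"
  unfolding win_def
proof (rule sum.cong)
  fix i assume "i \<in> {1..b}"
  then have "past x (int (t + i)) = past y (int (t + i))"
    using past_eqI[of "int (t + b)" x y "int (t + i)", OF assms] by auto
  then show "a \<bullet> (Gn n (real (t + i) / real n) (past x (int (t + i))) - mun n (real (t + i) / real n))
    = a \<bullet> (Gn n (real (t + i) / real n) (past y (int (t + i))) - mun n (real (t + i) / real n))" by simp
qed simp

text \<open>Separated windows are decoupled at the last time of the earlier one; overlapping windows
  are left to Cauchy-Schwarz. Truncated subtraction in the exponent lets one formula cover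
  both.\<close>

lemma sqwin_cov:
  assumes st: "s + b \<le> n" "t + b \<le> n" and b: "1 \<le> b" and a: "norm a \<le> A" "norm a' \<le> A" "0 < A"
  shows "\<bar>cov M (\<lambda>\<omega>. sqwin a n s b (path \<omega>)) (\<lambda>\<omega>. sqwin a' n t b (path \<omega>))\<bar>
    \<le> 2 * (2 * A * C) ^ 4 / (1 - \<rho>)\<^sup>2 * (real b)\<^sup>2 * \<rho> ^ (nat \<bar>int t - int s\<bar> - b)"
proof -
  let ?c = "2 * A * C"
  have c: "0 < ?c" using a C_pos by simp
  have r1: "1 \<le> 1 / (1 - \<rho>)\<^sup>2" using \<rho> by (simp add: power_le_one)
  have far: "\<bar>cov M (\<lambda>\<omega>. sqwin a n s b (path \<omega>)) (\<lambda>\<omega>. sqwin a' n t b (path \<omega>))\<bar>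
    \<le> 2 * ?c ^ 4 / (1 - \<rho>)\<^sup>2 * (real b)\<^sup>2 * \<rho> ^ (nat \<bar>int t - int s\<bar> - b)"
    if "s + b \<le> n" "t + b \<le> n" "norm a \<le> A" "norm a' \<le> A" "s + b \<le> t" for s t a a'
  proof -
    have "\<bar>cov M (\<lambda>\<omega>. sqwin a n s b (path \<omega>)) (\<lambda>\<omega>. sqwin a' n t b (path \<omega>))\<bar>
      \<le> (real b * ?c\<^sup>2) * (?c\<^sup>2 / (1 - \<rho>)\<^sup>2 * \<rho> ^ nat (int t - int (s + b)))"
    proof (rule decoupled_cov[where r = "int (s + b)"])
      show "sqwin a n s b x = sqwin a n s b y" if "\<And>k. k \<le> int (s + b) \<Longrightarrow> x k = y k" for x y
        unfolding sqwin_def using win_causal[OF that] by simp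
      show "lq_le M 2 (\<lambda>\<omega>. sqwin a' n t b (path \<omega>) - sqwin a' n t b (coupled (int (s + b)) \<omega>))
        (?c\<^sup>2 / (1 - \<rho>)\<^sup>2 * \<rho> ^ nat (int t - int (s + b)))"
        by (rule sqwin_coupled) (use that a b in auto)
      show "lq_le M 2 (\<lambda>\<omega>. sqwin a n s b (path \<omega>)) (real b * ?c\<^sup>2)"
        by (rule sqwin_lq) (use that a b in auto)
      show "lq_le M 2 (\<lambda>\<omega>. sqwin a' n t b (path \<omega>)) (real b * ?c\<^sup>2)"
        by (rule sqwin_lq) (use that a b in auto)
    qed measurable
    also have "nat (int t - int (s + b)) = nat \<bar>int t - int s\<bar> - b" using that(5) by linarith
    also have "(real b * ?c\<^sup>2) * (?c\<^sup>2 / (1 - \<rho>)\<^sup>2 * \<rho> ^ (nat \<bar>int t - int s\<bar> - b))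
      = real b * (?c ^ 4 / (1 - \<rho>)\<^sup>2 * \<rho> ^ (nat \<bar>int t - int s\<bar> - b))"
      by (simp add: power4_eq_xxxx power2_eq_square)
    \<comment> \<open>The order \<open>b\<close> is enlarged to \<open>2 * b^2\<close> to match the
      bound for overlapping windows.\<close>
    also have "\<dots> \<le> (2 * (real b)\<^sup>2) * (?c ^ 4 / (1 - \<rho>)\<^sup>2 * \<rho> ^ (nat \<bar>int t - int s\<bar> - b))"
      using b \<rho> by (intro mult_right_mono) (auto simp: power2_eq_square)
    finally show ?thesis by (simp add: mult_ac)
  qed
  consider "s + b \<le> t" | "t + b \<le> s" | "nat \<bar>int t - int s\<bar> - b = 0" by linarith
  then show ?thesis
  proof cases
    case 1
    then show ?thesis using far st a by blast
  next
    case 2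
    then show ?thesis using far[OF st(2,1) a(2,1)] by (simp add: cov_commute abs_minus_commute)
  next
    case 3
    have "\<bar>cov M (\<lambda>\<omega>. sqwin a n s b (path \<omega>)) (\<lambda>\<omega>. sqwin a' n t b (path \<omega>))\<bar> \<le> 2 * (real b * ?c\<^sup>2) * (real b * ?c\<^sup>2)"
      by (rule cov_bound) (use assms in \<open>auto intro!: sqwin_lq\<close>)
    also have "\<dots> = 2 * ?c ^ 4 * (real b)\<^sup>2 * 1" by (simp add: power4_eq_xxxx power2_eq_square)
    also have "\<dots> \<le> 2 * ?c ^ 4 * (real b)\<^sup>2 * (1 / (1 - \<rho>)\<^sup>2)" using r1 c by (intro mult_left_mono) auto
    finally show ?thesis using 3 by simp
  qed
qed

text \<open>The first \<open>b\<close> exponents are truncated to 0 and contribute 1 each; the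
  remaining terms form the full geometric series.\<close>

lemma sum_truncated_geometric:
  "(\<Sum>k. \<rho> ^ (k - b)) = real b + 1 / (1 - \<rho>)" "summable (\<lambda>k. \<rho> ^ (k - b))" for b :: nat
proof -
  have s: "summable (\<lambda>k. \<rho> ^ (k + b - b))" using \<rho> by (simp add: summable_geometric)
  show "summable (\<lambda>k. \<rho> ^ (k - b))" using s by (subst (asm) summable_iff_shift)
  from suminf_split_initial_segment[OF this, of b] \<rho>
  show "(\<Sum>k. \<rho> ^ (k - b)) = real b + 1 / (1 - \<rho>)" by (simp add: suminf_geometric)
qed

text \<open>Each row of the covariance matrix sums to order \<open>b^3\<close>: entries of order
  \<open>b^2\<close> on a band of width about \<open>b\<close>. There are at most \<open>n\<close>
  rows, and the average divides the variance by \<open>n^2\<close>. The factor 4 is the 2 of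
  \<open>sqwin_cov\<close> times the two sides of the band.\<close>

lemma sqwin_lln:
  assumes T: "finite T" "card T \<le> n" "\<And>t. t \<in> T \<Longrightarrow> t + b \<le> n" and n: "0 < n" and b: "1 \<le> b"
    and a: "\<And>t. norm (a t) \<le> A" "0 < A" and e: "0 < e"
  shows "prob {\<omega> \<in> space M. e \<le> \<bar>(\<Sum>t\<in>T. sqwin (a t) n t b (path \<omega>)) / real n
      - (\<Sum>t\<in>T. \<integral>\<omega>. sqwin (a t) n t b (path \<omega>) \<partial>M) / real n\<bar>}
    \<le> 4 * (2 * A * C) ^ 4 / (1 - \<rho>)\<^sup>2 / e\<^sup>2 * ((real b)\<^sup>2 * (real b + 1 / (1 - \<rho>)) / real n)"
proof -
  let ?K = "2 * (2 * A * C) ^ 4 / (1 - \<rho>)\<^sup>2 * (real b)\<^sup>2" and ?R = "real b + 1 / (1 - \<rho>)"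
  have K: "0 \<le> ?K" using \<rho> by simp
  have R: "0 \<le> ?R" using \<rho> by simp
  have "(\<Sum>s\<in>T. \<Sum>t\<in>T. cov M (\<lambda>\<omega>. sqwin (a s) n s b (path \<omega>)) (\<lambda>\<omega>. sqwin (a t) n t b (path \<omega>)))
     \<le> (\<Sum>s\<in>T. ?K * (2 * ?R))"
  proof (rule sum_mono)
    fix s assume s: "s \<in> T"
    have "(\<Sum>t\<in>T. cov M (\<lambda>\<omega>. sqwin (a s) n s b (path \<omega>)) (\<lambda>\<omega>. sqwin (a t) n t b (path \<omega>)))
      \<le> (\<Sum>t\<in>T. ?K * \<rho> ^ (nat \<bar>int t - int s\<bar> - b))"
      using sqwin_cov[OF T(3)[OF s] T(3) b a(1,1,2)] by (intro sum_mono) (meson abs_le_D1)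
    also have "\<dots> = ?K * (\<Sum>k\<in>int ` T. \<rho> ^ (nat \<bar>k - int s\<bar> - b))"
      using sum_nat_abs_diff[OF T(1), of "\<lambda>k. \<rho> ^ (k - b)" "int s"] by (simp only: sum_distrib_left[symmetric])
    also have "\<dots> \<le> ?K * (2 * ?R)"
    proof (rule mult_left_mono[OF _ K])
      have "(\<Sum>k\<in>int ` T. \<rho> ^ (nat \<bar>k - int s\<bar> - b)) \<le> 2 * (\<Sum>k. \<rho> ^ (k - b))"
        using \<rho> T(1) by (intro sum_abs_diff_le_suminf sum_truncated_geometric(2)) auto
      then show "(\<Sum>k\<in>int ` T. \<rho> ^ (nat \<bar>k - int s\<bar> - b)) \<le> 2 * ?R"
        unfolding sum_truncated_geometric(1) .
    qed
    finally show "(\<Sum>t\<in>T. cov M (\<lambda>\<omega>. sqwin (a s) n s b (path \<omega>)) (\<lambda>\<omega>. sqwin (a t) n t b (path \<omega>))) \<le> ?K * (2 * ?R)" .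
  qed
  also have "\<dots> = real (card T) * (?K * (2 * ?R))" by simp
  also have "\<dots> \<le> real n * (?K * (2 * ?R))" using T(2) K R by (intro mult_right_mono) auto
  finally have cov: "(\<Sum>s\<in>T. \<Sum>t\<in>T. cov M (\<lambda>\<omega>. sqwin (a s) n s b (path \<omega>)) (\<lambda>\<omega>. sqwin (a t) n t b (path \<omega>)))
     \<le> real n * (?K * (2 * ?R))" .
  have "prob {\<omega> \<in> space M. e * real n \<le> \<bar>(\<Sum>t\<in>T. sqwin (a t) n t b (path \<omega>))
      - (\<Sum>t\<in>T. \<integral>\<omega>. sqwin (a t) n t b (path \<omega>) \<partial>M)\<bar>} \<le> real n * (?K * (2 * ?R)) / (e * real n)\<^sup>2"
    by (rule lln_bound[OF T(1) _ _ cov, of "\<lambda>_. real b * (2 * A * C)\<^sup>2"])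
       (use sqwin_lq[OF T(3) b a] e n in auto)
  also have "\<dots> = 4 * (2 * A * C) ^ 4 / (1 - \<rho>)\<^sup>2 / e\<^sup>2 * ((real b)\<^sup>2 * ?R / real n)"
    using e n by (simp add: power2_eq_square divide_simps)
  also have "(\<lambda>\<omega>. e * real n \<le> \<bar>(\<Sum>t\<in>T. sqwin (a t) n t b (path \<omega>)) - (\<Sum>t\<in>T. \<integral>\<omega>. sqwin (a t) n t b (path \<omega>) \<partial>M)\<bar>)
    = (\<lambda>\<omega>. e \<le> \<bar>(\<Sum>t\<in>T. sqwin (a t) n t b (path \<omega>)) / real n - (\<Sum>t\<in>T. \<integral>\<omega>. sqwin (a t) n t b (path \<omega>) \<partial>M) / real n\<bar>)"
  proof -
    have "(e * real n \<le> \<bar>x - y\<bar>) = (e \<le> \<bar>x / real n - y / real n\<bar>)" for x y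
      using n by (simp add: diff_divide_distrib[symmetric] le_divide_eq)
    then show ?thesis by simp
  qed
  finally show ?thesis .
qed

section \<open>Expected squared windows and the long-run variance\<close>

lemma sqwin_mean:
  assumes tb: "t + b \<le> n"
  shows "(\<integral>\<omega>. sqwin a n t b (path \<omega>) \<partial>M) =
    (\<Sum>i\<in>{1..b}. \<Sum>j\<in>{1..b}. cov M (\<lambda>\<omega>. a \<bullet> Gn n (real (t + i) / real n) (epsvec eps (int (t + i)) \<omega>))
       (\<lambda>\<omega>. a \<bullet> Gn n (real (t + j) / real n) (epsvec eps (int (t + j)) \<omega>))) / real b"
proof -
  define U where "U = (\<lambda>i \<omega>. a \<bullet> Gn n (real (t + i) / real n) (epsvec eps (int (t + i)) \<omega>))"
  define S where "S = (\<lambda>\<omega>. \<Sum>i\<in>{1..b}. U i \<omega>)"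
  have U: "lq_le M 2 (U i) ((norm a + 1) * C)" if "i \<in> {1..b}" for i
    unfolding U_def using q_gt by (intro inner_lq grid_mem[OF tb that]) (auto simp: add_nonneg_pos)
  have iU: "integrable M (U i)" if "i \<in> {1..b}" for i using lq_le_integral(1)[OF U[OF that]] by simp
  have EU: "(\<integral>\<omega>. U i \<omega> \<partial>M) = a \<bullet> mun n (real (t + i) / real n)" if "i \<in> {1..b}" for i
  proof -
    have "integrable M (\<lambda>\<omega>. Gn n (real (t + i) / real n) (epsvec eps (int (t + i)) \<omega>))"
      using lq_le_integral(1)[OF Gn_lq[OF grid_mem[OF tb that]]] q_gt by simp
    then show ?thesis unfolding U_def using Gn_mean(1)[OF grid_mem[OF tb that]] by simp
  qed
  have iUU: "integrable M (\<lambda>\<omega>. U i \<omega> * U j \<omega>)" if "i \<in> {1..b}" "j \<in> {1..b}" for i j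
    using lq_le_2_mult_integral(1)[OF U U] that by simp
  have iS: "integrable M S" unfolding S_def by (intro Bochner_Integration.integrable_sum iU)
  have iSS: "integrable M (\<lambda>\<omega>. (S \<omega>)\<^sup>2)"
    unfolding S_def power2_eq_square sum_product by (intro Bochner_Integration.integrable_sum iUU)
  have ES: "expectation S = (\<Sum>i\<in>{1..b}. a \<bullet> mun n (real (t + i) / real n))"
    unfolding S_def by (simp add: Bochner_Integration.integral_sum iU EU)
  have "win a n t b (path \<omega>) = S \<omega> - expectation S" for \<omega>
    unfolding ES by (simp add: win_def S_def U_def epsvec_eq inner_diff_right sum_subtractf)
  then have "(\<integral>\<omega>. sqwin a n t b (path \<omega>) \<partial>M) = variance S / real b"
    by (simp add: sqwin_def)
  also have "variance S = cov M S S"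
    using variance_eq[OF iS iSS] by (simp add: cov_def power2_eq_square)
  also have "\<dots> = (\<Sum>i\<in>{1..b}. \<Sum>j\<in>{1..b}. cov M (U i) (U j))"
    unfolding S_def by (rule cov_sum) (use U in auto)
  finally show ?thesis by (simp add: U_def)
qed

text \<open>In contrast to \<open>sqwin_lq\<close> the bound does not grow with \<open>b\<close>,
  because decay of covariances bounds every row sum. It serves as the dominating constant for the
  Riemann sums.\<close>

lemma sqwin_mean_bound:
  assumes tb: "t + b \<le> n" and b: "1 \<le> b" and a: "norm a \<le> A" "0 < A"
  shows "\<bar>\<integral>\<omega>. sqwin a n t b (path \<omega>) \<partial>M\<bar> \<le> A\<^sup>2 * C\<^sup>2 / (1 - \<rho>) * (2 / (1 - \<rho>))"
proof -
  let ?c = "\<lambda>i j. cov M (\<lambda>\<omega>. a \<bullet> Gn n (real (t + i) / real n) (epsvec eps (int (t + i)) \<omega>))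
       (\<lambda>\<omega>. a \<bullet> Gn n (real (t + j) / real n) (epsvec eps (int (t + j)) \<omega>))"
  let ?K = "A\<^sup>2 * C\<^sup>2 / (1 - \<rho>)"
  have K: "0 \<le> ?K" using \<rho> by simp
  have "\<bar>\<Sum>i\<in>{1..b}. \<Sum>j\<in>{1..b}. ?c i j\<bar> \<le> (\<Sum>i\<in>{1..b}. \<Sum>j\<in>{1..b}. \<bar>?c i j\<bar>)"
    by (intro order_trans[OF sum_abs] sum_mono sum_abs)
  also have "\<dots> \<le> (\<Sum>i\<in>{1..b}. ?K * (2 / (1 - \<rho>)))"
  proof (rule sum_mono)
    fix i assume i: "i \<in> {1..b}"
    have "(\<Sum>j\<in>{1..b}. \<bar>?c i j\<bar>) \<le> (\<Sum>j\<in>{1..b}. ?K * \<rho> ^ nat \<bar>int j - int i\<bar>)"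
    proof (rule sum_mono)
      fix j assume j: "j \<in> {1..b}"
      show "\<bar>?c i j\<bar> \<le> ?K * \<rho> ^ nat \<bar>int j - int i\<bar>"
        using Gn_cov_decay[OF grid_mem[OF tb i] grid_mem[OF tb j] a(1,1,2), of n "int (t + i)" "int (t + j)"]
        by (simp add: abs_minus_commute)
    qed
    also have "\<dots> = ?K * (\<Sum>k\<in>int ` {1..b}. \<rho> ^ nat \<bar>k - int i\<bar>)"
      using sum_nat_abs_diff[of "{1..b}" "\<lambda>k. \<rho> ^ k" "int i"] by (simp only: sum_distrib_left[symmetric] finite_atLeastAtMost)
    also have "\<dots> \<le> ?K * (2 / (1 - \<rho>))"
      using \<rho> by (intro mult_left_mono sum_geometric_abs_diff K) auto
    finally show "(\<Sum>j\<in>{1..b}. \<bar>?c i j\<bar>) \<le> ?K * (2 / (1 - \<rho>))" .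
  qed
  also have "\<dots> = real b * (?K * (2 / (1 - \<rho>)))" by simp
  finally show ?thesis unfolding sqwin_mean[OF tb] using b by (simp add: divide_le_eq mult.commute)
qed

text \<open>Every coordinate series converges by the geometric decay, so the finite sums over the
  basis may be moved inside and a scalar series remains.\<close>

lemma longrun_quad_form:
  assumes v: "v \<in> {0..1}"
  shows "quad_form (longrun_cov M eps G v) a
    = (\<Sum>\<^sub>\<infinity>h. cov M (\<lambda>\<omega>. a \<bullet> G v (epsvec eps 0 \<omega>)) (\<lambda>\<omega>. a \<bullet> G v (epsvec eps h \<omega>)))"
proof -
  let ?c = "\<lambda>i j h. cov M (\<lambda>\<omega>. G v (epsvec eps 0 \<omega>) \<bullet> i) (\<lambda>\<omega>. G v (epsvec eps h \<omega>) \<bullet> j)"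
  have sm: "?c i j summable_on UNIV" if "i \<in> Basis" "j \<in> Basis" for i j
    using G_cov_decay[OF v, of i 1 j] that \<rho>
    by (intro geometric_bound_summable[of _ "1\<^sup>2 * C\<^sup>2 / (1 - \<rho>)" \<rho>]) (auto simp: inner_commute)
  have "cov M (\<lambda>\<omega>. a \<bullet> G v (epsvec eps 0 \<omega>)) (\<lambda>\<omega>. a \<bullet> G v (epsvec eps h \<omega>))
    = (\<Sum>i\<in>Basis. \<Sum>j\<in>Basis. (a \<bullet> i) * (a \<bullet> j) * ?c i j h)" for h
  proof -
    have e: "(\<lambda>\<omega>. a \<bullet> G v (epsvec eps s \<omega>)) = (\<lambda>\<omega>. \<Sum>i\<in>Basis. (a \<bullet> i) * (G v (epsvec eps s \<omega>) \<bullet> i))" for s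
      by (intro ext euclidean_inner)
    have l: "lq_le M 2 (\<lambda>\<omega>. (a \<bullet> i) * (G v (epsvec eps s \<omega>) \<bullet> i)) ((norm a + 1) * (C + 1))" if "i \<in> Basis" for i s
    proof -
      have "norm ((a \<bullet> i) *\<^sub>R i) \<le> norm a + 1" using that Basis_le_norm[of i a] by (simp add: abs_mult)
      from inner_G_lq[OF v this, of 2 s] q_gt show ?thesis
        by (simp add: add_nonneg_pos inner_commute[of i])
    qed
    show ?thesis unfolding e by (subst cov_sum[OF finite_Basis finite_Basis l l]) (auto simp: cov_scale)
  qed
  moreover have "((\<lambda>h. \<Sum>i\<in>Basis. \<Sum>j\<in>Basis. (a \<bullet> i) * (a \<bullet> j) * ?c i j h) has_sum
     (\<Sum>i\<in>Basis. \<Sum>j\<in>Basis. (a \<bullet> i) * (a \<bullet> j) * infsum (?c i j) UNIV)) UNIV"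
    by (intro has_sum_sum has_sum_cmult_right has_sum_infsum sm) auto
  ultimately show ?thesis
    by (simp add: infsumI quad_form_def longrun_cov_def mult_ac)
qed

text \<open>Since \<open>b / n\<close> tends to 0 the whole window collapses to \<open>v\<close>.
  Its covariance matrix then approaches, entry by entry and uniformly, the Toeplitz matrix of the
  stationary process frozen at \<open>v\<close>.\<close>

lemma sqwin_mean_lim:
  assumes v: "v \<in> {0..1}"
    and cont: "\<And>e. 0 < e \<Longrightarrow> \<exists>\<eta>>0. \<forall>\<^sub>F n in sequentially. \<forall>x\<in>{0..1}. \<bar>x - v\<bar> < \<eta> \<longrightarrow>
      lq_le M q (\<lambda>\<omega>. Gn n x (epsvec eps 0 \<omega>) - G v (epsvec eps 0 \<omega>)) e"
    and a: "a \<longlonglongrightarrow> \<alpha>" "\<And>n. norm (a n) \<le> A" "0 < A"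
    and t: "(\<lambda>n. real (t n) / real n) \<longlonglongrightarrow> v" and b: "filterlim b at_top sequentially"
    and bn: "(\<lambda>n. real (b n) / real n) \<longlonglongrightarrow> 0" and tb: "\<forall>\<^sub>F n in sequentially. t n + b n \<le> n"
  shows "(\<lambda>n. \<integral>\<omega>. sqwin (a n) n (t n) (b n) (path \<omega>) \<partial>M) \<longlonglongrightarrow> quad_form (longrun_cov M eps G v) \<alpha>"
proof -
  have \<alpha>: "norm \<alpha> \<le> A"
    using LIMSEQ_le_const2[OF tendsto_norm[OF a(1)]] a(2) by auto
  define c where "c = (\<lambda>n i j. cov M (\<lambda>\<omega>. a n \<bullet> Gn n (real (t n + i) / real n) (epsvec eps (int (t n + i)) \<omega>))
       (\<lambda>\<omega>. a n \<bullet> Gn n (real (t n + j) / real n) (epsvec eps (int (t n + j)) \<omega>)))"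
  define \<gamma> where "\<gamma> = (\<lambda>h. cov M (\<lambda>\<omega>. \<alpha> \<bullet> G v (epsvec eps 0 \<omega>)) (\<lambda>\<omega>. \<alpha> \<bullet> G v (epsvec eps h \<omega>)))"
  have "(\<lambda>n. (\<Sum>i\<in>{1..b n}. \<Sum>j\<in>{1..b n}. c n i j) / real (b n)) \<longlonglongrightarrow> infsum \<gamma> UNIV"
  proof (rule near_toeplitz_average[OF _ \<rho> b])
    show "\<bar>\<gamma> h\<bar> \<le> A\<^sup>2 * C\<^sup>2 / (1 - \<rho>) * \<rho> ^ nat \<bar>h\<bar>" for h
      unfolding \<gamma>_def by (rule G_cov_decay[OF v \<alpha> \<alpha> a(3)])
    show "\<forall>\<^sub>F n in sequentially. \<forall>i\<in>{1..b n}. \<forall>j\<in>{1..b n}. \<bar>c n i j\<bar> \<le> A\<^sup>2 * C\<^sup>2 / (1 - \<rho>) * \<rho> ^ nat \<bar>int j - int i\<bar>"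
      using tb
    proof eventually_elim
      case (elim n)
      show ?case
      proof (intro ballI)
        fix i j assume i: "i \<in> {1..b n}" and j: "j \<in> {1..b n}"
        show "\<bar>c n i j\<bar> \<le> A\<^sup>2 * C\<^sup>2 / (1 - \<rho>) * \<rho> ^ nat \<bar>int j - int i\<bar>"
          using Gn_cov_decay[OF grid_mem[OF elim i] grid_mem[OF elim j] a(2) a(2) a(3),
              where s = "int (t n + i)" and t = "int (t n + j)" and n = n]
          by (simp add: c_def abs_minus_commute)
      qed
    qed
    fix e :: real assume e: "0 < e"
    define e' where "e' = e / (4 * A * (C + 1) * (C + A))"
    have e': "0 < e'" "4 * A * (C + 1) * (C + A) * e' = e"
      using e a(3) C_pos by (auto simp: e'_def less_imp_neq[symmetric])
    obtain \<eta> where \<eta>: "0 < \<eta>" "\<forall>\<^sub>F n in sequentially. \<forall>x\<in>{0..1}. \<bar>x - v\<bar> < \<eta> \<longrightarrow>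
      lq_le M q (\<lambda>\<omega>. Gn n x (epsvec eps 0 \<omega>) - G v (epsvec eps 0 \<omega>)) e'"
      using cont[OF e'(1)] by blast
    have "\<forall>\<^sub>F n in sequentially. dist (real (t n) / real n) v < \<eta> / 2" by (rule tendstoD[OF t]) (use \<eta> in simp)
    moreover have "\<forall>\<^sub>F n in sequentially. dist (real (b n) / real n) 0 < \<eta> / 2" by (rule tendstoD[OF bn]) (use \<eta> in simp)
    moreover have "\<forall>\<^sub>F n in sequentially. dist (a n) \<alpha> < e'" by (rule tendstoD[OF a(1) e'(1)])
    ultimately show "\<forall>\<^sub>F n in sequentially. \<forall>i\<in>{1..b n}. \<forall>j\<in>{1..b n}. \<bar>c n i j - \<gamma> (int j - int i)\<bar> \<le> e"
      using \<eta>(2) tb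
    proof eventually_elim
      case (elim n)
      have near: "lq_le M q (\<lambda>\<omega>. Gn n (real (t n + i) / real n) (epsvec eps 0 \<omega>) - G v (epsvec eps 0 \<omega>)) e'"
        if i: "i \<in> {1..b n}" for i
      proof -
        have "real i / real n \<le> real (b n) / real n" "0 \<le> real i / real n" using i by (auto intro: divide_right_mono)
        then have "\<bar>real (t n + i) / real n - v\<bar> < \<eta>"
          using elim(1,2) unfolding dist_real_def of_nat_add add_divide_distrib by linarith
        then show ?thesis using elim(4) grid_mem[OF elim(5) i] by blast
      qed
      have d: "norm (a n - \<alpha>) \<le> e'" using elim(3) by (simp add: dist_norm)
      show ?case
      proof (intro ballI)
        fix i j assume ij: "i \<in> {1..b n}" "j \<in> {1..b n}"
        have "int (t n + j) - int (t n + i) = int j - int i" by simp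
        with cov_compare[OF grid_mem[OF elim(5) ij(1)] grid_mem[OF elim(5) ij(2)] v a(3) a(2) \<alpha> a(2) \<alpha> d d e'(1)
            near[OF ij(1)] near[OF ij(2)], of "int (t n + i)" "int (t n + j)"]
        show "\<bar>c n i j - \<gamma> (int j - int i)\<bar> \<le> e" unfolding c_def \<gamma>_def e'(2) by (simp only:)
      qed
    qed
  qed
  moreover have "\<forall>\<^sub>F n in sequentially. (\<Sum>i\<in>{1..b n}. \<Sum>j\<in>{1..b n}. c n i j) / real (b n)
      = (\<integral>\<omega>. sqwin (a n) n (t n) (b n) (path \<omega>) \<partial>M)"
    using tb by eventually_elim (simp only: sqwin_mean c_def)
  ultimately show ?thesis unfolding longrun_quad_form[OF v] \<gamma>_def[symmetric]
    by (rule Lim_transform_eventually)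
qed

text \<open>Half of \<open>e\<close> is spent on the deviation from the mean, controlled by
  \<open>sqwin_lln\<close>, and half on the distance of the mean from the integral. The exceptional
  points are those of the weights and those of the kernels.\<close>

lemma sqwin_average_lim:
  fixes a :: "nat \<Rightarrow> nat \<Rightarrow> 'a" and \<alpha> :: "real \<Rightarrow> 'a"
  assumes a: "\<And>n t. norm (a n t) \<le> A" "0 < A" and N: "countable N"
    and alim: "\<And>v. 0 < v \<Longrightarrow> v < 1 \<Longrightarrow> v \<notin> N \<Longrightarrow> (\<lambda>n. a n (nat \<lceil>real n * v\<rceil>)) \<longlonglongrightarrow> \<alpha> v"
    and b: "filterlim b at_top sequentially" and b3: "(\<lambda>n. real (b n) ^ 3 / real n) \<longlonglongrightarrow> 0"
    and lo: "\<And>n. 1 \<le> lo n" "(\<lambda>n. real (lo n) / real n) \<longlonglongrightarrow> 0"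
    and u: "0 \<le> u" "u \<le> 1"
  shows "(\<lambda>v. quad_form (longrun_cov M eps G v) (\<alpha> v)) integrable_on {0..u}"
    and "0 < e \<Longrightarrow> (\<lambda>n. prob {\<omega> \<in> space M. e \<le> \<bar>(\<Sum>t\<in>{lo n..nat \<lfloor>real n * u\<rfloor> - b n}. sqwin (a n t) n t (b n) (path \<omega>)) / real n
       - integral {0..u} (\<lambda>v. quad_form (longrun_cov M eps G v) (\<alpha> v))\<bar>}) \<longlonglongrightarrow> 0"
proof -
  let ?g = "\<lambda>v. quad_form (longrun_cov M eps G v) (\<alpha> v)"
  obtain N2 where N2: "countable N2"
    "\<And>v e. v \<in> {0..1} - N2 \<Longrightarrow> 0 < e \<Longrightarrow> \<exists>\<eta>>0. \<forall>\<^sub>F n in sequentially. \<forall>x\<in>{0..1}. \<bar>x - v\<bar> < \<eta> \<longrightarrow>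
      lq_le M q (\<lambda>\<omega>. Gn n x (epsvec eps 0 \<omega>) - G v (epsvec eps 0 \<omega>)) e"
    using equicontinuous_ae by blast
  have b1: "\<forall>\<^sub>F n in sequentially. 1 \<le> b n" using b by (simp add: filterlim_at_top)
  have bn: "(\<lambda>n. real (b n) / real n) \<longlonglongrightarrow> 0"
  proof (rule tendsto_sandwich[OF _ _ tendsto_const b3])
    show "\<forall>\<^sub>F n in sequentially. real (b n) / real n \<le> real (b n) ^ 3 / real n"
      using b1
    proof eventually_elim
      case (elim n)
      then show ?case using power_increasing[of 1 3 "real (b n)"] by (intro divide_right_mono) auto
    qed
  qed auto
  define hi where "hi = (\<lambda>n. nat \<lfloor>real n * u\<rfloor> - b n)"
  have hi_le: "real (hi n) \<le> real n * u" for n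
  proof -
    have "real (nat \<lfloor>real n * u\<rfloor>) \<le> real n * u" using u by simp
    moreover have "real (hi n) \<le> real (nat \<lfloor>real n * u\<rfloor>)" by (simp add: hi_def)
    ultimately show ?thesis by linarith
  qed
  have hi_lim: "(\<lambda>n. real (hi n) / real n) \<longlonglongrightarrow> u"
  proof (rule tendsto_sandwich)
    have "(\<lambda>n. u - real (b n) / real n - 1 / real n) \<longlonglongrightarrow> u - 0 - 0"
      by (intro tendsto_diff tendsto_const bn lim_1_over_n)
    then show "(\<lambda>n. u - real (b n) / real n - 1 / real n) \<longlonglongrightarrow> u" by (simp only: diff_zero)
    show "\<forall>\<^sub>F n in sequentially. u - real (b n) / real n - 1 / real n \<le> real (hi n) / real n"
      using eventually_gt_at_top[of 0]
    proof eventually_elim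
      case (elim n)
      have "real n * u - 1 \<le> real (nat \<lfloor>real n * u\<rfloor>)" by linarith
      moreover have "real (nat \<lfloor>real n * u\<rfloor>) - real (b n) \<le> real (hi n)" by (simp add: hi_def)
      ultimately have "real n * u - real (b n) - 1 \<le> real (hi n)" by linarith
      then have "(real n * u - real (b n) - 1) / real n \<le> real (hi n) / real n" by (rule divide_right_mono) simp
      then show ?case using elim by (simp add: diff_divide_distrib)
    qed
    show "\<forall>\<^sub>F n in sequentially. real (hi n) / real n \<le> u"
      using eventually_gt_at_top[of 0] by eventually_elim (use hi_le in \<open>simp add: divide_le_eq mult.commute\<close>)
  qed simp
  \<comment> \<open>Natural subtraction in \<open>hi n\<close> could truncate to 0; as
    \<open>lo n \<ge> 1\<close>, a nonempty index range excludes this.\<close>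
  have fit: "t + b n \<le> n" if "t \<in> {lo n..hi n}" for t n
  proof -
    have "real n * u \<le> real n * 1" using u by (intro mult_left_mono) auto
    then have "nat \<lfloor>real n * u\<rfloor> \<le> n" by linarith
    then show ?thesis using that lo(1)[of n] unfolding hi_def atLeastAtMost_iff by linarith
  qed
  \<comment> \<open>The default 0 for windows that are empty or leave the sample makes the bound
    valid for all \<open>n\<close> and \<open>t\<close>, as \<open>riemann_dominated\<close>
    demands.\<close>
  define m where "m = (\<lambda>n t. if 1 \<le> b n \<and> t + b n \<le> n then \<integral>\<omega>. sqwin (a n t) n t (b n) (path \<omega>) \<partial>M else 0)"
  let ?K = "A\<^sup>2 * C\<^sup>2 / (1 - \<rho>) * (2 / (1 - \<rho>))"
  have K0: "0 \<le> ?K" using \<rho> by simp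
  have mK: "\<bar>m n t\<bar> \<le> ?K" for n t
    using sqwin_mean_bound[OF _ _ a] K0 by (auto simp: m_def)
  have mlim: "(\<lambda>n. m n (nat \<lceil>real n * v\<rceil>)) \<longlonglongrightarrow> ?g v" if v: "0 < v" "v < u" "v \<notin> N \<union> N2" for v
  proof -
    have v1: "v \<in> {0..1} - N2" "v < 1" "v \<notin> N" using v u by auto
    have tlim: "(\<lambda>n. real (nat \<lceil>real n * v\<rceil>) / real n) \<longlonglongrightarrow> v"
    proof (rule tendsto_sandwich[where f = "\<lambda>_. v" and h = "\<lambda>n. v + 1 / real n"])
      have "(\<lambda>n. v + 1 / real n) \<longlonglongrightarrow> v + 0" by (intro tendsto_add tendsto_const lim_1_over_n)
      then show "(\<lambda>n. v + 1 / real n) \<longlonglongrightarrow> v" by simp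
      show "\<forall>\<^sub>F n in sequentially. v \<le> real (nat \<lceil>real n * v\<rceil>) / real n"
        using eventually_gt_at_top[of 0]
      proof eventually_elim
        case (elim n)
        have "real n * v \<le> real (nat \<lceil>real n * v\<rceil>)" by linarith
        then show ?case using elim by (simp add: field_simps)
      qed
      show "\<forall>\<^sub>F n in sequentially. real (nat \<lceil>real n * v\<rceil>) / real n \<le> v + 1 / real n"
        using eventually_gt_at_top[of 0]
      proof eventually_elim
        case (elim n)
        have "0 \<le> real n * v" using v by simp
        then have "real (nat \<lceil>real n * v\<rceil>) \<le> real n * v + 1" by linarith
        then show ?case using elim by (simp add: field_simps)
      qed
    qed simp
    have "(\<lambda>n. real (nat \<lceil>real n * v\<rceil>) / real n + real (b n) / real n) \<longlonglongrightarrow> v + 0"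
      by (intro tendsto_add tlim bn)
    then have "\<forall>\<^sub>F n in sequentially. real (nat \<lceil>real n * v\<rceil>) / real n + real (b n) / real n < 1"
      using v1 by (intro order_tendstoD) auto
    then have ev: "\<forall>\<^sub>F n in sequentially. nat \<lceil>real n * v\<rceil> + b n \<le> n"
      using eventually_gt_at_top[of 0]
    proof eventually_elim
      case (elim n)
      then have "real (nat \<lceil>real n * v\<rceil>) + real (b n) < real n" by (simp add: add_divide_distrib[symmetric])
      then show ?case by linarith
    qed
    have "(\<lambda>n. \<integral>\<omega>. sqwin (a n (nat \<lceil>real n * v\<rceil>)) n (nat \<lceil>real n * v\<rceil>) (b n) (path \<omega>) \<partial>M) \<longlonglongrightarrow> ?g v"
      using v1(1) N2(2)[OF v1(1)] alim[OF v(1) v1(2,3)] a tlim b bn ev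
      by (intro sqwin_mean_lim) auto
    moreover have "\<forall>\<^sub>F n in sequentially. (\<integral>\<omega>. sqwin (a n (nat \<lceil>real n * v\<rceil>)) n (nat \<lceil>real n * v\<rceil>) (b n) (path \<omega>) \<partial>M)
       = m n (nat \<lceil>real n * v\<rceil>)"
      using ev b1 by eventually_elim (simp only: m_def simp_thms if_True)
    ultimately show ?thesis by (rule Lim_transform_eventually)
  qed
  note rd = riemann_dominated[where m = m and g = ?g, OF u countable_Un[OF N N2(1)] lo hi_le hi_lim mK mlim]
  show "?g integrable_on {0..u}" by (rule rd(1))
  assume e: "0 < e"
  define V where "V = (\<lambda>n \<omega>. (\<Sum>t\<in>{lo n..hi n}. sqwin (a n t) n t (b n) (path \<omega>)) / real n)"
  define B where "B = (\<lambda>n. 4 * (2 * A * C) ^ 4 / (1 - \<rho>)\<^sup>2 / (e / 2)\<^sup>2 * ((real (b n))\<^sup>2 * (real (b n) + 1 / (1 - \<rho>)) / real n))"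
  have "B \<longlonglongrightarrow> 4 * (2 * A * C) ^ 4 / (1 - \<rho>)\<^sup>2 / (e / 2)\<^sup>2 * 0"
    unfolding B_def
  proof (intro tendsto_mult tendsto_const)
    have l: "(\<lambda>n. (1 + 1 / (1 - \<rho>)) * (real (b n) ^ 3 / real n)) \<longlonglongrightarrow> 0"
      by (rule tendsto_mult_right_zero[OF b3])
    show "(\<lambda>n. (real (b n))\<^sup>2 * (real (b n) + 1 / (1 - \<rho>)) / real n) \<longlonglongrightarrow> 0"
    proof (rule tendsto_sandwich[OF _ _ tendsto_const l])
      show "\<forall>\<^sub>F n in sequentially. (real (b n))\<^sup>2 * (real (b n) + 1 / (1 - \<rho>)) / real n
        \<le> (1 + 1 / (1 - \<rho>)) * (real (b n) ^ 3 / real n)"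
        using b1
      proof eventually_elim
        case (elim n)
        have "1 / (1 - \<rho>) * 1 \<le> 1 / (1 - \<rho>) * real (b n)" using elim \<rho> by (intro mult_left_mono) auto
        then have "real (b n) + 1 / (1 - \<rho>) \<le> (1 + 1 / (1 - \<rho>)) * real (b n)" by (simp add: distrib_right)
        then have "(real (b n))\<^sup>2 * (real (b n) + 1 / (1 - \<rho>)) \<le> (real (b n))\<^sup>2 * ((1 + 1 / (1 - \<rho>)) * real (b n))"
          by (rule mult_left_mono) simp
        also have "\<dots> = (1 + 1 / (1 - \<rho>)) * real (b n) ^ 3" by (simp add: power2_eq_square power3_eq_cube)
        finally show ?case by (simp add: divide_right_mono)
      qed
    qed (use \<rho> in \<open>auto intro!: always_eventually\<close>)
  qed
  then have B0: "B \<longlonglongrightarrow> 0" by simp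
  have close: "\<forall>\<^sub>F n in sequentially. \<bar>(\<Sum>t\<in>{lo n..hi n}. m n t) / real n - integral {0..u} ?g\<bar> < e / 2"
    using tendstoD[OF rd(2), of "e / 2"] e by (simp add: dist_real_def)
  have "\<forall>\<^sub>F n in sequentially. prob {\<omega> \<in> space M. e \<le> \<bar>V n \<omega> - integral {0..u} ?g\<bar>} \<le> B n"
    using close b1 eventually_gt_at_top[of 0]
  proof eventually_elim
    case (elim n)
    have hin: "hi n \<le> n"
    proof -
      have "real n * u \<le> real n * 1" using u by (intro mult_left_mono) auto
      then show ?thesis using hi_le[of n] by simp
    qed
    have meq: "(\<Sum>t\<in>{lo n..hi n}. m n t) = (\<Sum>t\<in>{lo n..hi n}. \<integral>\<omega>. sqwin (a n t) n t (b n) (path \<omega>) \<partial>M)"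
      using elim(2) fit by (intro sum.cong) (auto simp: m_def)
    have "prob {\<omega> \<in> space M. e \<le> \<bar>V n \<omega> - integral {0..u} ?g\<bar>}
      \<le> prob {\<omega> \<in> space M. e / 2 \<le> \<bar>V n \<omega> - (\<Sum>t\<in>{lo n..hi n}. \<integral>\<omega>. sqwin (a n t) n t (b n) (path \<omega>) \<partial>M) / real n\<bar>}"
    proof (rule finite_measure_mono)
      have "e / 2 \<le> \<bar>x - y\<bar>" if "e \<le> \<bar>x - z\<bar>" "\<bar>y - z\<bar> < e / 2" for x y z :: real using that by linarith
      then show "{\<omega> \<in> space M. e \<le> \<bar>V n \<omega> - integral {0..u} ?g\<bar>} \<subseteq>
         {\<omega> \<in> space M. e / 2 \<le> \<bar>V n \<omega> - (\<Sum>t\<in>{lo n..hi n}. \<integral>\<omega>. sqwin (a n t) n t (b n) (path \<omega>) \<partial>M) / real n\<bar>}"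
        using elim(1) unfolding meq by blast
    qed (unfold V_def, measurable)
    also have "\<dots> \<le> B n"
      unfolding V_def B_def
    proof (rule sqwin_lln)
      have "card {lo n..hi n} = Suc (hi n) - lo n" by simp
      also have "\<dots> \<le> n" using lo(1)[of n] hin by simp
      finally show "card {lo n..hi n} \<le> n" .
    qed (use fit elim a e in auto)
    finally show ?case .
  qed
  then have "(\<lambda>n. prob {\<omega> \<in> space M. e \<le> \<bar>V n \<omega> - integral {0..u} ?g\<bar>}) \<longlonglongrightarrow> 0"
    by (intro tendsto_sandwich[OF _ _ tendsto_const B0]) auto
  then show "(\<lambda>n. prob {\<omega> \<in> space M. e \<le> \<bar>(\<Sum>t\<in>{lo n..nat \<lfloor>real n * u\<rfloor> - b n}. sqwin (a n t) n t (b n) (path \<omega>)) / real n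
       - integral {0..u} ?g\<bar>}) \<longlonglongrightarrow> 0"
    unfolding V_def hi_def .
qed

end

section \<open>Plug-in error\<close>

text \<open>Sequences of events that are eventually covered by measurable events of vanishing
  probability; this sidesteps measurability of events involving uncountably many \<open>u\<close>.\<close>

definition vanishing :: "'w measure \<Rightarrow> (nat \<Rightarrow> 'w set) \<Rightarrow> bool" where
  "vanishing M S \<longleftrightarrow> (\<exists>B. (\<forall>n. B n \<in> sets M) \<and> (\<forall>\<^sub>F n in sequentially. S n \<subseteq> B n) \<and> (\<lambda>n. measure M (B n)) \<longlonglongrightarrow> 0)"

context prob_space
begin

lemma vanishingI:
  assumes "\<And>n. B n \<in> events" "(\<lambda>n. prob (B n)) \<longlonglongrightarrow> 0"
  shows "vanishing M B"
  unfolding vanishing_def using assms by (intro exI[of _ B]) auto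

lemma vanishing_mono:
  assumes "vanishing M S" "\<forall>\<^sub>F n in sequentially. S' n \<subseteq> S n"
  shows "vanishing M S'"
proof -
  obtain B where B: "\<forall>n. B n \<in> events" "\<forall>\<^sub>F n in sequentially. S n \<subseteq> B n" "(\<lambda>n. prob (B n)) \<longlonglongrightarrow> 0"
    using assms(1) unfolding vanishing_def by blast
  have "\<forall>\<^sub>F n in sequentially. S' n \<subseteq> B n" using B(2) assms(2) by eventually_elim blast
  with B show ?thesis unfolding vanishing_def by blast
qed

lemma vanishing_Un:
  assumes "vanishing M S" "vanishing M S'"
  shows "vanishing M (\<lambda>n. S n \<union> S' n)"
proof -
  obtain B where B: "\<forall>n. B n \<in> events" "\<forall>\<^sub>F n in sequentially. S n \<subseteq> B n" "(\<lambda>n. prob (B n)) \<longlonglongrightarrow> 0"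
    using assms(1) unfolding vanishing_def by blast
  obtain B' where B': "\<forall>n. B' n \<in> events" "\<forall>\<^sub>F n in sequentially. S' n \<subseteq> B' n" "(\<lambda>n. prob (B' n)) \<longlonglongrightarrow> 0"
    using assms(2) unfolding vanishing_def by blast
  have "(\<lambda>n. prob (B n \<union> B' n)) \<longlonglongrightarrow> 0"
  proof (rule tendsto_sandwich[OF _ _ tendsto_const])
    show "(\<lambda>n. prob (B n) + prob (B' n)) \<longlonglongrightarrow> 0" using tendsto_add[OF B(3) B'(3)] by simp
    show "\<forall>\<^sub>F n in sequentially. prob (B n \<union> B' n) \<le> prob (B n) + prob (B' n)"
      using B(1) B'(1) by (intro always_eventually allI measure_Un_le) auto
  qed simp
  moreover have "\<forall>\<^sub>F n in sequentially. S n \<union> S' n \<subseteq> B n \<union> B' n" using B(2) B'(2) by eventually_elim blast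
  moreover have "\<forall>n. B n \<union> B' n \<in> events" using B(1) B'(1) by auto
  ultimately show ?thesis unfolding vanishing_def by (intro exI[of _ "\<lambda>n. B n \<union> B' n"]) auto
qed

lemma vanishing_UN:
  assumes "finite I" "\<And>i. i \<in> I \<Longrightarrow> vanishing M (S i)"
  shows "vanishing M (\<lambda>n. \<Union>i\<in>I. S i n)"
  using assms
proof (induction I rule: finite_induct)
  case empty
  show ?case by (rule vanishingI) auto
next
  case (insert i I)
  then show ?case using vanishing_Un[of "S i" "\<lambda>n. \<Union>i\<in>I. S i n"] by simp
qed

lemma vanishing_prob:
  assumes "vanishing M S"
  shows "(\<lambda>n. prob (S n)) \<longlonglongrightarrow> 0"
proof -
  obtain B where B: "\<forall>n. B n \<in> events" "\<forall>\<^sub>F n in sequentially. S n \<subseteq> B n" "(\<lambda>n. prob (B n)) \<longlonglongrightarrow> 0"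
    using assms unfolding vanishing_def by blast
  show ?thesis
  proof (rule tendsto_sandwich[OF _ _ tendsto_const B(3)])
    show "\<forall>\<^sub>F n in sequentially. prob (S n) \<le> prob (B n)"
      using B(2) by eventually_elim (use B(1) in \<open>auto intro: finite_measure_mono\<close>)
  qed simp
qed

end

section \<open>Elementary inequalities for the drift and for plug-in errors\<close>

lemma tendsto_ratio_mono:
  fixes x :: "nat \<Rightarrow> real"
  assumes "(\<lambda>n. x n / real n powr s) \<longlonglongrightarrow> 0" "s \<le> s'" "\<And>n. 0 \<le> x n"
  shows "(\<lambda>n. x n / real n powr s') \<longlonglongrightarrow> 0"
proof (rule tendsto_sandwich[OF _ _ tendsto_const assms(1)])
  show "\<forall>\<^sub>F n in sequentially. x n / real n powr s' \<le> x n / real n powr s"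
    using eventually_ge_at_top[of 1]
  proof eventually_elim
    case (elim n)
    then show ?case using assms(2,3) by (intro divide_left_mono powr_mono) auto
  qed
qed (use assms(3) in auto)

text \<open>The two shifted sums cancel except for \<open>i + l\<close> terms at the right end,
  however long the range is; this replaces smoothness of the means.\<close>

lemma sum_window_increments:
  fixes W :: "nat \<Rightarrow> real"
  assumes W: "\<And>s. s \<le> m + i \<Longrightarrow> 0 \<le> W s \<and> W s \<le> B"
  shows "(\<Sum>t\<in>{l..m}. W (t + i) - W (t - l)) \<le> real (i + l) * B"
proof (cases "l \<le> m")
  case True
  have "(\<Sum>t\<in>{l..m}. W (t + i)) = (\<Sum>s\<in>{l + i..m + i}. W s)"
    by (rule sum.reindex_bij_witness[of _ "\<lambda>s. s - i" "\<lambda>t. t + i"]) auto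
  also have "\<dots> \<le> (\<Sum>s\<in>{0..m - l} \<union> {m - l<..m + i}. W s)"
    using W True by (intro sum_mono2) auto
  also have "\<dots> = (\<Sum>s\<in>{0..m - l}. W s) + (\<Sum>s\<in>{m - l<..m + i}. W s)"
    by (rule sum.union_disjoint) auto
  also have "(\<Sum>s\<in>{m - l<..m + i}. W s) \<le> real (card {m - l<..m + i}) * B"
    using W by (intro sum_bounded_above) auto
  also have "card {m - l<..m + i} = i + l" using True by simp
  also have "(\<Sum>s\<in>{0..m - l}. W s) = (\<Sum>t\<in>{l..m}. W (t - l))"
    using True by (intro sum.reindex_bij_witness[of _ "\<lambda>t. t - l" "\<lambda>s. s + l"]) auto
  finally show ?thesis by (simp add: sum_subtractf)
next
  case False
  then show ?thesis using W[of 0] by simp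
qed

text \<open>Converts control of \<open>P\<close>-th powers into control of squares: a square above
  the threshold \<open>\<kappa>\<close> is at most its \<open>P / 2\<close>-th power divided by the
  surplus power of \<open>\<kappa>\<close>.\<close>

lemma square_le_powr:
  fixes x \<kappa> P :: real
  assumes "0 \<le> x" "0 < \<kappa>" "2 \<le> P"
  shows "x\<^sup>2 \<le> \<kappa> + \<kappa> powr (1 - P / 2) * x powr P"
proof (cases "x\<^sup>2 \<le> \<kappa>")
  case True
  then show ?thesis by (simp add: add_increasing2)
next
  case False
  have x: "0 < x" using False assms by (cases "x = 0") auto
  have "x\<^sup>2 = (x\<^sup>2) powr (1 - P / 2) * (x\<^sup>2) powr (P / 2)"
    using x by (simp add: powr_add[symmetric])
  also have "(x\<^sup>2) powr (P / 2) = x powr P"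
    using x by (simp add: powr_numeral[symmetric] powr_powr del: powr_numeral)
  also have "(x\<^sup>2) powr (1 - P / 2) \<le> \<kappa> powr (1 - P / 2)"
    using False assms x by (intro powr_mono2') auto
  finally have "x\<^sup>2 \<le> \<kappa> powr (1 - P / 2) * x powr P" by (simp add: mult_right_mono)
  then show ?thesis using assms by linarith
qed

lemma norm_sum_squared_le:
  fixes f :: "'i \<Rightarrow> 'b::real_normed_vector"
  shows "(norm (\<Sum>i\<in>I. f i))\<^sup>2 \<le> real (card I) * (\<Sum>i\<in>I. (norm (f i))\<^sup>2)"
proof -
  have "(norm (\<Sum>i\<in>I. f i))\<^sup>2 \<le> (\<Sum>i\<in>I. 1 * norm (f i))\<^sup>2"
    by (intro power_mono) (auto intro: norm_sum)
  also have "\<dots> \<le> (\<Sum>i\<in>I. 1\<^sup>2) * (\<Sum>i\<in>I. (norm (f i))\<^sup>2)" by (rule Cauchy_Schwarz_ineq_sum)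
  finally show ?thesis by simp
qed

text \<open>The error splits into \<open>A\<close> applied to drift and pilot error, and
  \<open>A - a\<close> applied to the centred window. Only the second part multiplies pilot error by
  window size, which is why a bound on the largest window is required.\<close>

lemma plug_in_error:
  fixes A a e :: "'b::euclidean_space" and S \<Delta> :: "nat \<Rightarrow> 'b"
  assumes A: "norm A \<le> F" and Aa: "norm (A - a) \<le> F * norm e" and b: "1 \<le> b"
  shows "(A \<bullet> (\<Sum>i\<in>{1..b}. S i + \<Delta> i - e) - a \<bullet> (\<Sum>i\<in>{1..b}. S i))\<^sup>2 / real b
    \<le> 4 * F\<^sup>2 * real b * (norm e)\<^sup>2 + 4 * F\<^sup>2 * (\<Sum>i\<in>{1..b}. (norm (\<Delta> i))\<^sup>2)
      + 2 * F\<^sup>2 * (norm e)\<^sup>2 * (norm (\<Sum>i\<in>{1..b}. S i))\<^sup>2 / real b"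
proof -
  let ?S = "\<Sum>i\<in>{1..b}. S i" and ?D = "\<Sum>i\<in>{1..b}. \<Delta> i"
  let ?R = "?D - real b *\<^sub>R e"
  have sq: "(x + y)\<^sup>2 \<le> 2 * x\<^sup>2 + 2 * y\<^sup>2" for x y :: real
    using sum_squares_ge_zero[of "x - y" 0] by (simp add: power2_eq_square algebra_simps)
  have F: "0 \<le> F" using A norm_ge_zero order_trans by blast
  have "A \<bullet> (\<Sum>i\<in>{1..b}. S i + \<Delta> i - e) - a \<bullet> ?S = A \<bullet> ?R + (A - a) \<bullet> ?S"
    by (simp add: sum.distrib sum_subtractf inner_diff_left inner_add_right inner_diff_right sum_constant_scaleR)
  also have "(\<dots>)\<^sup>2 \<le> 2 * (A \<bullet> ?R)\<^sup>2 + 2 * ((A - a) \<bullet> ?S)\<^sup>2" by (rule sq)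
  also have "(A \<bullet> ?R)\<^sup>2 \<le> F\<^sup>2 * (norm ?R)\<^sup>2"
  proof -
    have "\<bar>A \<bullet> ?R\<bar> \<le> F * norm ?R"
      using Cauchy_Schwarz_ineq2[of A ?R] A by (meson mult_right_mono norm_ge_zero order_trans)
    then show ?thesis using power_mono[of "\<bar>A \<bullet> ?R\<bar>" "F * norm ?R" 2] by (simp add: power_mult_distrib)
  qed
  also have "((A - a) \<bullet> ?S)\<^sup>2 \<le> F\<^sup>2 * (norm e)\<^sup>2 * (norm ?S)\<^sup>2"
  proof -
    have "\<bar>(A - a) \<bullet> ?S\<bar> \<le> F * norm e * norm ?S"
      using Cauchy_Schwarz_ineq2[of "A - a" ?S] Aa by (meson mult_right_mono norm_ge_zero order_trans)
    then show ?thesis using power_mono[of "\<bar>(A - a) \<bullet> ?S\<bar>" "F * norm e * norm ?S" 2] by (simp add: power_mult_distrib)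
  qed
  also have "(norm ?R)\<^sup>2 \<le> 2 * (real b * (\<Sum>i\<in>{1..b}. (norm (\<Delta> i))\<^sup>2)) + 2 * (real b * norm e)\<^sup>2"
  proof -
    have "norm ?R \<le> norm ?D + real b * norm e"
      using norm_triangle_ineq4[of ?D "real b *\<^sub>R e"] by simp
    then have "(norm ?R)\<^sup>2 \<le> (norm ?D + real b * norm e)\<^sup>2" by (rule power_mono) simp
    also have "\<dots> \<le> 2 * (norm ?D)\<^sup>2 + 2 * (real b * norm e)\<^sup>2" by (rule sq)
    also have "(norm ?D)\<^sup>2 \<le> real b * (\<Sum>i\<in>{1..b}. (norm (\<Delta> i))\<^sup>2)"
      using norm_sum_squared_le[of \<Delta> "{1..b}"] by simp
    finally show ?thesis by simp
  qed
  finally have "(A \<bullet> (\<Sum>i\<in>{1..b}. S i + \<Delta> i - e) - a \<bullet> ?S)\<^sup>2 \<le>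
     2 * (F\<^sup>2 * (2 * (real b * (\<Sum>i\<in>{1..b}. (norm (\<Delta> i))\<^sup>2)) + 2 * (real b * norm e)\<^sup>2))
     + 2 * (F\<^sup>2 * (norm e)\<^sup>2 * (norm ?S)\<^sup>2)"
    by (simp add: mult_left_mono)
  then have "(A \<bullet> (\<Sum>i\<in>{1..b}. S i + \<Delta> i - e) - a \<bullet> ?S)\<^sup>2 / real b \<le>
     (2 * (F\<^sup>2 * (2 * (real b * (\<Sum>i\<in>{1..b}. (norm (\<Delta> i))\<^sup>2)) + 2 * (real b * norm e)\<^sup>2))
     + 2 * (F\<^sup>2 * (norm e)\<^sup>2 * (norm ?S)\<^sup>2)) / real b"
    by (rule divide_right_mono) simp
  also have "\<dots> = 4 * F\<^sup>2 * real b * (norm e)\<^sup>2 + 4 * F\<^sup>2 * (\<Sum>i\<in>{1..b}. (norm (\<Delta> i))\<^sup>2)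
      + 2 * F\<^sup>2 * (norm e)\<^sup>2 * (norm ?S)\<^sup>2 / real b"
    using b by (simp add: power2_eq_square add_divide_distrib algebra_simps)
  finally show ?thesis .
qed

text \<open>Young's inequality for the cross term. After averaging, the squares of \<open>y\<close>
  stay bounded and receive the small weight \<open>\<theta>\<close>, while the mean square of the
  differences tends to 0 and tolerates the large one.\<close>

lemma abs_diff_squares_le:
  fixes x y \<theta> :: real
  assumes "0 < \<theta>"
  shows "\<bar>x\<^sup>2 - y\<^sup>2\<bar> \<le> (1 + 1 / \<theta>) * (x - y)\<^sup>2 + \<theta> * y\<^sup>2"
proof -
  define s where "s = sqrt \<theta>"
  have s: "0 < s" "\<theta> = s\<^sup>2" using assms by (auto simp: s_def)
  have "0 \<le> (s * y - (x - y) / s)\<^sup>2" "0 \<le> (s * y + (x - y) / s)\<^sup>2" by simp_all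
  then have "\<bar>2 * y * (x - y)\<bar> \<le> \<theta> * y\<^sup>2 + (x - y)\<^sup>2 / \<theta>"
    using s by (simp add: power2_diff power2_sum power_mult_distrib power_divide abs_le_iff)
  moreover have "x\<^sup>2 - y\<^sup>2 = (x - y)\<^sup>2 + 2 * y * (x - y)" by (simp add: power2_eq_square algebra_simps)
  moreover have "0 \<le> (x - y)\<^sup>2" by simp
  moreover have "(1 + 1 / \<theta>) * (x - y)\<^sup>2 = (x - y)\<^sup>2 + (x - y)\<^sup>2 / \<theta>" by (simp add: distrib_right)
  ultimately show ?thesis by linarith
qed

section \<open>Drift of the means and the size of the largest window\<close>

context locally_stationary
begin

text \<open>For each fixed \<open>i\<close> the increments of the control function telescope over
  \<open>t\<close>. The surplus power \<open>P - p\<close> is absorbed by the bound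
  \<open>2 * C\<close> on mean differences, and the last term comes from counting up to
  \<open>n + 1\<close> indices \<open>t\<close>.\<close>

lemma drift_bound:
  assumes \<kappa>: "0 < \<kappa>" and b: "b \<le> n" and n: "0 < n"
  defines "P \<equiv> max p 2"
  shows "(\<Sum>t\<in>{l..n - b}. \<Sum>i\<in>{1..b}. (norm (mun n (real (t + i) / real n) - mun n (real (t - l) / real n)))\<^sup>2)
    \<le> real n * real b * \<kappa> + \<kappa> powr (1 - P / 2) * ((2 * C) powr (P - p) * C powr p) * real b * real (b + l) + real b * \<kappa>"
proof -
  obtain w where w: "\<And>u. u \<in> {0..1} \<Longrightarrow> 0 \<le> w u \<and> w u \<le> C powr p"
    "\<And>u v. 0 \<le> u \<Longrightarrow> u \<le> v \<Longrightarrow> v \<le> 1 \<Longrightarrow> norm (mun n v - mun n u) powr p \<le> w v - w u"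
    using mean_control by blast
  let ?m = "n - b"
  define W where "W = (\<lambda>s. w (real s / real n))"
  define K where "K = \<kappa> powr (1 - P / 2) * (2 * C) powr (P - p)"
  have K: "0 \<le> K" by (simp add: K_def)
  have i_bound: "(\<Sum>t\<in>{l..?m}. (norm (mun n (real (t + i) / real n) - mun n (real (t - l) / real n)))\<^sup>2)
     \<le> (real n + 1) * \<kappa> + K * C powr p * real (b + l)" if i: "i \<in> {1..b}" for i
  proof -
    have "(\<Sum>t\<in>{l..?m}. (norm (mun n (real (t + i) / real n) - mun n (real (t - l) / real n)))\<^sup>2)
      \<le> (\<Sum>t\<in>{l..?m}. \<kappa> + K * (W (t + i) - W (t - l)))"
    proof (rule sum_mono)
      fix t assume t: "t \<in> {l..?m}"
      have g: "real (t + i) / real n \<in> {0..1}" "real (t - l) / real n \<in> {0..1}"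
        "real (t - l) / real n \<le> real (t + i) / real n"
        using t i b n by (auto simp: divide_le_eq intro!: divide_right_mono)
      let ?x = "norm (mun n (real (t + i) / real n) - mun n (real (t - l) / real n))"
      have x2: "?x \<le> 2 * C"
        using norm_triangle_ineq4[of "mun n (real (t + i) / real n)" "mun n (real (t - l) / real n)"]
          Gn_mean(2)[OF g(1)] Gn_mean(2)[OF g(2)] by (smt (verit))
      have "?x\<^sup>2 \<le> \<kappa> + \<kappa> powr (1 - P / 2) * ?x powr P"
        by (rule square_le_powr) (use \<kappa> in \<open>auto simp: P_def\<close>)
      also have "?x powr P = ?x powr (P - p) * ?x powr p" by (simp add: powr_add[symmetric])
      also have "\<dots> \<le> (2 * C) powr (P - p) * (W (t + i) - W (t - l))"
        unfolding W_def using x2 w(2)[OF _ g(3)] g by (intro mult_mono powr_mono2) (auto simp: P_def)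
      finally show "?x\<^sup>2 \<le> \<kappa> + K * (W (t + i) - W (t - l))" by (simp add: K_def mult_left_mono mult.assoc)
    qed
    also have "\<dots> = real (card {l..?m}) * \<kappa> + K * (\<Sum>t\<in>{l..?m}. W (t + i) - W (t - l))"
      by (simp add: sum.distrib sum_distrib_left)
    also have "\<dots> \<le> (real n + 1) * \<kappa> + K * (real (b + l) * C powr p)"
    proof (intro add_mono mult_right_mono mult_left_mono K)
      have "(\<Sum>t\<in>{l..?m}. W (t + i) - W (t - l)) \<le> real (i + l) * C powr p"
      proof (rule sum_window_increments)
        fix s assume "s \<le> ?m + i"
        then have "real s / real n \<in> {0..1}" using i b n by (auto simp: divide_le_eq)
        then show "0 \<le> W s \<and> W s \<le> C powr p" unfolding W_def by (rule w(1))
      qed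
      also have "\<dots> \<le> real (b + l) * C powr p" using i by (intro mult_right_mono) auto
      finally show "(\<Sum>t\<in>{l..?m}. W (t + i) - W (t - l)) \<le> real (b + l) * C powr p" .
      show "real (card {l..?m}) \<le> real n + 1" by simp
    qed (use \<kappa> in auto)
    finally show ?thesis by (simp add: mult_ac)
  qed
  have "(\<Sum>t\<in>{l..?m}. \<Sum>i\<in>{1..b}. (norm (mun n (real (t + i) / real n) - mun n (real (t - l) / real n)))\<^sup>2)
    = (\<Sum>i\<in>{1..b}. \<Sum>t\<in>{l..?m}. (norm (mun n (real (t + i) / real n) - mun n (real (t - l) / real n)))\<^sup>2)"
    by (rule sum.swap)
  also have "\<dots> \<le> (\<Sum>i\<in>{1..b}. (real n + 1) * \<kappa> + K * C powr p * real (b + l))"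
    by (intro sum_mono i_bound)
  also have "\<dots> = real n * real b * \<kappa> + \<kappa> powr (1 - P / 2) * ((2 * C) powr (P - p) * C powr p) * real b * real (b + l) + real b * \<kappa>"
    by (simp add: K_def algebra_simps)
  finally show ?thesis .
qed

lemma drift_vanishes:
  assumes b: "filterlim b at_top sequentially"
    and rate: "(\<lambda>n. real (b n) powr (max p 2 / 2) * real (b n + l n) / real n) \<longlonglongrightarrow> 0"
    and bn: "\<forall>\<^sub>F n in sequentially. b n \<le> n"
  shows "(\<lambda>n. (\<Sum>t\<in>{l n..n - b n}. \<Sum>i\<in>{1..b n}.
     (norm (mun n (real (t + i) / real n) - mun n (real (t - l n) / real n)))\<^sup>2) / real n) \<longlonglongrightarrow> 0"
proof (rule tendstoI)
  fix e :: real assume e: "0 < e"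
  define P where "P = max p 2"
  define \<kappa> where "\<kappa> = e / 4"
  have \<kappa>: "0 < \<kappa>" using e by (simp add: \<kappa>_def)
  define K where "K = \<kappa> powr (1 - P / 2) * ((2 * C) powr (P - p) * C powr p)"
  let ?D = "\<lambda>n. \<Sum>t\<in>{l n..n - b n}. \<Sum>i\<in>{1..b n}.
     (norm (mun n (real (t + i) / real n) - mun n (real (t - l n) / real n)))\<^sup>2"
  have "(\<lambda>n. K * (real (b n) powr (P / 2) * real (b n + l n) / real n)) \<longlonglongrightarrow> 0"
    using tendsto_mult_right_zero[OF rate, of K] by (simp add: P_def)
  from tendstoD[OF this, of "e / 4"] e
  have ev: "\<forall>\<^sub>F n in sequentially. \<bar>K * (real (b n) powr (P / 2) * real (b n + l n) / real n)\<bar> < e / 4" by simp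
  show "\<forall>\<^sub>F n in sequentially. dist (?D n / real n) 0 < e"
    using ev bn eventually_gt_at_top[of 0] b[unfolded filterlim_at_top, rule_format, of 1]
  proof eventually_elim
    case (elim n)
    have b0: "0 < real (b n)" using elim by simp
    \<comment> \<open>With threshold \<open>\<kappa> / b\<close> the nearly \<open>n * b\<close>
      small terms sum to about \<open>\<kappa> * n\<close>. The price is \<open>b\<close> to the
      power \<open>P / 2\<close>, which together with \<open>b + l\<close> is exactly the rate
      hypothesis.\<close>
    have balance: "(\<kappa> / real (b n)) powr (1 - P / 2) * real (b n)
       = \<kappa> powr (1 - P / 2) * real (b n) powr (P / 2)"
    proof -
      have "(\<kappa> / real (b n)) powr (1 - P / 2) * real (b n) = \<kappa> powr (1 - P / 2) * (real (b n) powr 1 / real (b n) powr (1 - P / 2))"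
        using b0 \<kappa> by (simp add: powr_divide)
      also have "real (b n) powr 1 / real (b n) powr (1 - P / 2) = real (b n) powr (P / 2)"
        using powr_diff[of "real (b n)" 1 "1 - P / 2"] b0 by simp
      finally show ?thesis .
    qed
    have "(\<kappa> / real (b n)) powr (1 - P / 2) * ((2 * C) powr (P - p) * C powr p) * real (b n) * real (b n + l n)
      = ((\<kappa> / real (b n)) powr (1 - P / 2) * real (b n)) * (((2 * C) powr (P - p) * C powr p) * real (b n + l n))"
      by (simp only: mult_ac)
    also have "\<dots> = K * (real (b n) powr (P / 2) * real (b n + l n))"
      unfolding balance K_def by (simp only: mult_ac)
    finally have "(\<kappa> / real (b n)) powr (1 - P / 2) * ((2 * C) powr (P - p) * C powr p) * real (b n) * real (b n + l n)
      = K * (real (b n) powr (P / 2) * real (b n + l n))" .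
    moreover have "?D n \<le> real n * real (b n) * (\<kappa> / real (b n)) + (\<kappa> / real (b n)) powr (1 - P / 2) * ((2 * C) powr (P - p) * C powr p) * real (b n) * real (b n + l n)
      + real (b n) * (\<kappa> / real (b n))"
      unfolding P_def by (rule drift_bound) (use elim \<kappa> b0 in auto)
    ultimately have "?D n \<le> real n * \<kappa> + K * (real (b n) powr (P / 2) * real (b n + l n)) + \<kappa>"
      using b0 by (simp add: mult.assoc)
    also have "\<dots> \<le> real n * \<kappa> + K * (real (b n) powr (P / 2) * real (b n + l n)) + real n * \<kappa>"
      using elim(3) \<kappa> by simp
    finally have "?D n / real n \<le> (real n * \<kappa> + K * (real (b n) powr (P / 2) * real (b n + l n)) + real n * \<kappa>) / real n"
      by (rule divide_right_mono) simp
    also have "\<dots> = 2 * \<kappa> + K * (real (b n) powr (P / 2) * real (b n + l n) / real n)"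
      using elim(3) by (simp add: add_divide_distrib)
    also have "\<dots> < e" using elim(1) e unfolding \<kappa>_def by linarith
    finally show ?case by (simp add: sum_nonneg)
  qed
qed

text \<open>Markov's inequality for the \<open>q\<close>-th moment at the level
  \<open>r = b^(1/2) * n^(1/4)\<close> gives \<open>(2 * C)^q * b^(q/2) * n^(-q/4)\<close> for one
  window; the union bound multiplies this by \<open>n\<close>.\<close>

lemma max_window_vanishes:
  assumes rate: "(\<lambda>n. real (b n) powr (q / 2) * real n powr (1 - q / 4)) \<longlonglongrightarrow> 0"
    and b: "filterlim b at_top sequentially" and bn: "\<forall>\<^sub>F n in sequentially. b n \<le> n"
  shows "vanishing M (\<lambda>n. {\<omega> \<in> space M. \<exists>t\<in>{1..n - b n}.
     real (b n) * sqrt (real n) \<le> (norm (\<Sum>i\<in>{1..b n}. Gn n (real (t + i) / real n) (epsvec eps (int (t + i)) \<omega>) - mun n (real (t + i) / real n)))\<^sup>2})"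
proof -
  define S where "S = (\<lambda>n t \<omega>. \<Sum>i\<in>{1..b n}. Gn n (real (t + i) / real n) (epsvec eps (int (t + i)) \<omega>) - mun n (real (t + i) / real n))"
  have [measurable]: "S n t \<in> borel_measurable M" for n t unfolding S_def by measurable
  let ?B = "\<lambda>n. {\<omega> \<in> space M. \<exists>t\<in>{1..n - b n}. real (b n) * sqrt (real n) \<le> (norm (S n t \<omega>))\<^sup>2}"
  have "(\<lambda>n. prob (?B n)) \<longlonglongrightarrow> 0"
  proof (rule tendsto_sandwich[OF _ _ tendsto_const tendsto_mult_right_zero[OF rate, of "(2 * C) powr q"]])
    show "\<forall>\<^sub>F n in sequentially. prob (?B n) \<le> (2 * C) powr q * (real (b n) powr (q / 2) * real n powr (1 - q / 4))"
      using bn b[unfolded filterlim_at_top, rule_format, of 1] eventually_gt_at_top[of 0]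
    proof eventually_elim
      case (elim n)
      define r where "r = real (b n) powr (1/2) * real n powr (1/4)"
      have r: "0 < r" using elim by (simp add: r_def)
      have r2: "r\<^sup>2 = real (b n) * sqrt (real n)"
      proof -
        have "r\<^sup>2 = (real (b n) powr (1/2) * real (b n) powr (1/2)) * (real n powr (1/4) * real n powr (1/4))"
          by (simp add: r_def power2_eq_square)
        also have "\<dots> = real (b n) * sqrt (real n)"
          using elim by (simp add: powr_add[symmetric] powr_half_sqrt)
        finally show ?thesis .
      qed
      have lq: "lq_le M q (S n t) (real (b n) * (2 * C))" if t: "t \<in> {1..n - b n}" for t
      proof -
        have tb: "t + b n \<le> n" using t elim(1) by auto
        have "lq_le M q (S n t) (\<Sum>i\<in>{1..b n}. 2 * C)"
          unfolding S_def by (intro lq_le_sum centred_lq grid_mem[OF tb]) (use elim q_gt in auto)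
        then show ?thesis by simp
      qed
      have "prob (?B n) \<le> prob (\<Union>t\<in>{1..n - b n}. {\<omega> \<in> space M. r \<le> norm (S n t \<omega>)})"
      proof (rule finite_measure_mono)
        have "r \<le> y" if "real (b n) * sqrt (real n) \<le> y\<^sup>2" "0 \<le> y" for y
          using that unfolding r2[symmetric] by (rule power2_le_imp_le)
        then show "?B n \<subseteq> (\<Union>t\<in>{1..n - b n}. {\<omega> \<in> space M. r \<le> norm (S n t \<omega>)})" by auto
      qed measurable
      also have "\<dots> \<le> (\<Sum>t\<in>{1..n - b n}. prob {\<omega> \<in> space M. r \<le> norm (S n t \<omega>)})"
        by (rule finite_measure_subadditive_finite) auto
      also have "\<dots> \<le> (\<Sum>t\<in>{1..n - b n}. (real (b n) * (2 * C) / r) powr q)"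
        by (intro sum_mono markov_lq lq r) (use q_gt in auto)
      also have "\<dots> \<le> real n * (real (b n) * (2 * C) / r) powr q" by (simp add: mult_right_mono)
      also have "\<dots> = (2 * C) powr q * (real (b n) powr (q / 2) * real n powr (1 - q / 4))"
      proof -
        have "r powr q = real (b n) powr (q / 2) * real n powr (q / 4)"
          unfolding r_def by (simp add: powr_mult powr_powr)
        moreover have "real (b n) powr q = real (b n) powr (q / 2) * real (b n) powr (q / 2)"
          by (simp add: powr_add[symmetric])
        moreover have "real n powr (1 - q / 4) = real n / real n powr (q / 4)"
          using elim(3) by (simp add: powr_diff)
        ultimately show ?thesis
          using elim C_pos r by (simp add: powr_divide powr_mult)
      qed
      finally show ?case .
    qed
  qed simp
  then have "vanishing M ?B" by (intro vanishingI) auto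
  then show ?thesis unfolding S_def .
qed

end

text \<open>Convexity holds because the neighbourhood is the Minkowski sum of \<open>S\<close> and a
  ball; it is needed for the mean value inequality. The common radius captures the finite-sample
  means, which approach \<open>mu\<close> uniformly. For infinite \<delta> the set is the whole
  space.\<close>

lemma infdist_nbhd:
  fixes S :: "'b::euclidean_space set" and \<delta> :: ereal
  assumes S: "convex S" "S \<noteq> {}" and \<delta>: "0 < \<delta>"
  defines "U \<equiv> {x. ereal (infdist x S) < \<delta>}"
  shows "convex U" and "U \<in> sets borel" and "\<exists>r>0. \<forall>s\<in>S. \<forall>x. norm (x - s) < r \<longrightarrow> x \<in> U"
proof -
  have conv: "convex {x. infdist x S < r}" for r
  proof -
    have "{x. infdist x S < r} = (\<Union>s\<in>S. \<Union>y\<in>ball 0 r. {s + y})"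
    proof (intro set_eqI iffI)
      fix x assume "x \<in> {x. infdist x S < r}"
      then have "infdist x S < r" by simp
      then have "\<exists>s\<in>S. dist x s < r"
        using S(2) by (subst (asm) infdist_notempty) (auto simp: cINF_less_iff intro!: bdd_belowI2[of _ 0])
      then obtain s where "s \<in> S" "dist x s < r" by blast
      then show "x \<in> (\<Union>s\<in>S. \<Union>y\<in>ball 0 r. {s + y})"
        by (intro UN_I[of s] UN_I[of "x - s"]) (auto simp: dist_norm norm_minus_commute)
    next
      fix x assume "x \<in> (\<Union>s\<in>S. \<Union>y\<in>ball 0 r. {s + y})"
      then obtain s y where "s \<in> S" "norm y < r" "x = s + y" by auto
      then show "x \<in> {x. infdist x S < r}"
        using infdist_le[of s S x] by (simp add: dist_norm)
    qed
    then show ?thesis using convex_sums[OF S(1) convex_ball, of 0 r] by simp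
  qed
  have "convex U \<and> U \<in> sets borel \<and> (\<exists>r>0. \<forall>s\<in>S. \<forall>x. norm (x - s) < r \<longrightarrow> x \<in> U)"
  proof (cases \<delta>)
    case (real r)
    then have U: "U = {x. infdist x S < r}" by (simp add: U_def)
    have "open U" unfolding U by (intro open_Collect_less continuous_intros)
    moreover have "\<forall>s\<in>S. \<forall>x. norm (x - s) < r \<longrightarrow> x \<in> U"
      unfolding U using infdist_le by (fastforce simp: dist_norm intro: le_less_trans)
    moreover have "0 < r" using \<delta> real by simp
    ultimately show ?thesis using conv[of r] U by auto
  next
    case PInf
    then have "U = UNIV" by (auto simp: U_def)
    then show ?thesis by (auto intro: exI[of _ 1])
  next
    case MInf
    then show ?thesis using \<delta> by simp
  qed
  then show "convex U" "U \<in> sets borel" "\<exists>r>0. \<forall>s\<in>S. \<forall>x. norm (x - s) < r \<longrightarrow> x \<in> U" by auto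
qed

text \<open>A Polya-type argument: between neighbouring grid points \<open>Y\<close> is squeezed by
  monotonicity and \<open>Q\<close> varies by less than \<open>e / 3\<close>. The uncountable event
  is thus covered by finitely many pointwise ones.\<close>

lemma (in prob_space) monotone_uniform_vanishing:
  fixes Y :: "nat \<Rightarrow> real \<Rightarrow> 'a \<Rightarrow> real" and Q :: "real \<Rightarrow> real"
  assumes mono: "\<And>n u v \<omega>. 0 \<le> u \<Longrightarrow> u \<le> v \<Longrightarrow> v \<le> 1 \<Longrightarrow> Y n u \<omega> \<le> Y n v \<omega>"
    and Q: "continuous_on {0..1} Q"
    and pt: "\<And>u e. 0 \<le> u \<Longrightarrow> u \<le> 1 \<Longrightarrow> 0 < e \<Longrightarrow> vanishing M (\<lambda>n. {\<omega> \<in> space M. e < \<bar>Y n u \<omega> - Q u\<bar>})"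
    and e: "0 < e"
  shows "vanishing M (\<lambda>n. {\<omega> \<in> space M. \<exists>u\<in>{0..1}. \<bar>Y n u \<omega> - Q u\<bar> > e})"
proof -
  have "uniformly_continuous_on {0..1} Q" by (rule compact_uniformly_continuous[OF Q]) simp
  then obtain d where d: "0 < d" "\<And>x y. x \<in> {0..1} \<Longrightarrow> y \<in> {0..1} \<Longrightarrow> \<bar>x - y\<bar> < d \<Longrightarrow> \<bar>Q x - Q y\<bar> < e / 3"
    by (rule uniformly_continuous_onE[of _ _ "e / 3"]) (use e in \<open>auto simp: dist_real_def\<close>)
  obtain m :: nat where m: "1 / d < real m" using reals_Archimedean2 by blast
  have m0: "0 < real m" using m d(1) by (meson less_trans zero_less_divide_1_iff)
  have step: "1 / real m < d" using m m0 d(1) by (simp add: field_simps)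
  have van: "vanishing M (\<lambda>n. \<Union>k\<in>{0..m}. {\<omega> \<in> space M. e / 3 < \<bar>Y n (real k / real m) \<omega> - Q (real k / real m)\<bar>})"
    using m0 e by (intro vanishing_UN pt) (auto simp: divide_le_eq)
  show ?thesis
  proof (rule vanishing_mono[OF van], intro always_eventually allI subsetI, rule ccontr)
    fix n \<omega>
    assume "\<omega> \<in> {\<omega> \<in> space M. \<exists>u\<in>{0..1}. \<bar>Y n u \<omega> - Q u\<bar> > e}"
    then obtain u where u: "\<omega> \<in> space M" "0 \<le> u" "u \<le> 1" "\<bar>Y n u \<omega> - Q u\<bar> > e" by auto
    assume "\<omega> \<notin> (\<Union>k\<in>{0..m}. {\<omega> \<in> space M. e / 3 < \<bar>Y n (real k / real m) \<omega> - Q (real k / real m)\<bar>})"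
    then have g: "\<bar>Y n (real k / real m) \<omega> - Q (real k / real m)\<bar> \<le> e / 3" if "k \<le> m" for k
      using u(1) that by (force simp: not_less)
    define k where "k = nat \<lfloor>real m * u\<rfloor>"
    define k' where "k' = nat \<lceil>real m * u\<rceil>"
    have mu: "0 \<le> real m * u" "real m * u \<le> real m" using u m0 by (auto simp: mult_left_le)
    have k: "real k \<le> real m * u" "real m * u < real k + 1" using mu unfolding k_def by linarith+
    have k': "real m * u \<le> real k'" "real k' < real m * u + 1" using mu unfolding k'_def by linarith+
    have km: "k \<le> m" "k' \<le> m" using k k' mu by linarith+
    have "u < (real k + 1) / real m" "real k' / real m < (real m * u + 1) / real m"
      using k k' m0 by (auto simp: less_divide_eq mult.commute divide_strict_right_mono)
    then have a: "real k / real m \<le> u" "u - real k / real m < 1 / real m"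
      "u \<le> real k' / real m" "real k' / real m - u < 1 / real m"
      using k k' m0 by (auto simp: divide_le_eq le_divide_eq mult.commute add_divide_distrib)
    have in01: "real k / real m \<in> {0..1}" "real k' / real m \<in> {0..1}" using km m0 by (auto simp: divide_le_eq)
    have "Y n (real k / real m) \<omega> \<le> Y n u \<omega>" using mono a u in01 by auto
    moreover have "Y n u \<omega> \<le> Y n (real k' / real m) \<omega>" using mono a u in01 by auto
    moreover have "\<bar>Q (real k / real m) - Q u\<bar> < e / 3" using d(2)[of "real k / real m" u] a in01 u step by auto
    moreover have "\<bar>Q (real k' / real m) - Q u\<bar> < e / 3" using d(2)[of "real k' / real m" u] a in01 u step by auto
    ultimately show False using g[OF km(1)] g[OF km(2)] u(4) e by linarith
  qed
qed

section \<open>From pilot estimators to true means\<close>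

context locally_stationary
begin

lemma mun_eventually_near:
  assumes "0 < r"
  shows "\<forall>\<^sub>F n in sequentially. \<forall>x\<in>{0..1}. norm (mun n x - mu x) < r"
proof -
  have "\<forall>\<^sub>F n in sequentially. \<forall>x\<in>{0..1}. lq_le M q (\<lambda>\<omega>. Gn n x (epsvec eps 0 \<omega>) - G x (epsvec eps 0 \<omega>)) (r / 2)"
    using assms by (intro G_lim) simp
  then show ?thesis
  proof eventually_elim
    case (elim n)
    show ?case
    proof
      fix x :: real assume x: "x \<in> {0..1}"
      have "norm (mun n x - mu x) \<le> r / 2" using elim x by (intro mean_diff) auto
      then show "norm (mun n x - mu x) < r" using assms by simp
    qed
  qed
qed

text \<open>Neither the rounding nor the lag \<open>L / n\<close> moves the limit point. Membership
  in [0,1] is recorded too, since only there the means are known to lie near the set of limit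
  means.\<close>

lemma lagged_weight_lim:
  fixes Df :: "'a \<Rightarrow> 'a"
  assumes cont: "\<And>e. 0 < e \<Longrightarrow> \<exists>\<eta>>0. \<forall>\<^sub>F n in sequentially. \<forall>x\<in>{0..1}. \<bar>x - v\<bar> < \<eta> \<longrightarrow>
      lq_le M q (\<lambda>\<omega>. Gn n x (epsvec eps 0 \<omega>) - G v (epsvec eps 0 \<omega>)) e"
    and v: "0 < v" "v < 1" and L: "(\<lambda>n. real (L n) / real n) \<longlonglongrightarrow> 0" and Df: "isCont Df (mu v)"
  shows "(\<lambda>n. Df (mun n (real (nat \<lceil>real n * v\<rceil> - L n) / real n))) \<longlonglongrightarrow> Df (mu v)"
    and "\<forall>\<^sub>F n in sequentially. real (nat \<lceil>real n * v\<rceil> - L n) / real n \<in> {0..1}"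
proof -
  define x where "x = (\<lambda>n. real (nat \<lceil>real n * v\<rceil> - L n) / real n)"
  have xlim: "x \<longlonglongrightarrow> v"
  proof (rule tendsto_sandwich[where f = "\<lambda>n. v - real (L n) / real n" and h = "\<lambda>n. v + 1 / real n"])
    have "(\<lambda>n. v + 1 / real n) \<longlonglongrightarrow> v + 0" by (intro tendsto_add tendsto_const lim_1_over_n)
    then show "(\<lambda>n. v + 1 / real n) \<longlonglongrightarrow> v" by (simp only: add_0_right)
    have "(\<lambda>n. v - real (L n) / real n) \<longlonglongrightarrow> v - 0" by (intro tendsto_diff tendsto_const L)
    then show "(\<lambda>n. v - real (L n) / real n) \<longlonglongrightarrow> v" by (simp only: diff_zero)
    show "\<forall>\<^sub>F n in sequentially. v - real (L n) / real n \<le> x n"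
      using eventually_gt_at_top[of 0]
    proof eventually_elim
      case (elim n)
      have "real n * v \<le> real (nat \<lceil>real n * v\<rceil>)" by linarith
      moreover have "real (nat \<lceil>real n * v\<rceil>) - real (L n) \<le> real (nat \<lceil>real n * v\<rceil> - L n)" by linarith
      ultimately have "(real n * v - real (L n)) / real n \<le> x n"
        unfolding x_def by (intro divide_right_mono) linarith+
      then show ?case using elim by (simp add: diff_divide_distrib)
    qed
    show "\<forall>\<^sub>F n in sequentially. x n \<le> v + 1 / real n"
      using eventually_gt_at_top[of 0]
    proof eventually_elim
      case (elim n)
      have "0 \<le> real n * v" using v by simp
      then have "real (nat \<lceil>real n * v\<rceil> - L n) \<le> real n * v + 1" by linarith
      then have "x n \<le> (real n * v + 1) / real n" unfolding x_def by (rule divide_right_mono) simp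
      then show ?case using elim by (simp add: add_divide_distrib)
    qed
  qed
  have x01: "\<forall>\<^sub>F n in sequentially. x n \<in> {0..1}"
    using order_tendstoD(2)[OF xlim v(2)] by eventually_elim (simp add: x_def)
  then show "\<forall>\<^sub>F n in sequentially. real (nat \<lceil>real n * v\<rceil> - L n) / real n \<in> {0..1}" unfolding x_def .
  have "(\<lambda>n. mun n (x n)) \<longlonglongrightarrow> mu v"
  proof (rule tendstoI)
    fix e :: real assume e: "0 < e"
    obtain \<eta> where \<eta>: "0 < \<eta>" "\<forall>\<^sub>F n in sequentially. \<forall>x\<in>{0..1}. \<bar>x - v\<bar> < \<eta> \<longrightarrow>
      lq_le M q (\<lambda>\<omega>. Gn n x (epsvec eps 0 \<omega>) - G v (epsvec eps 0 \<omega>)) (e / 2)"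
      using cont[of "e / 2"] e by auto
    show "\<forall>\<^sub>F n in sequentially. dist (mun n (x n)) (mu v) < e"
      using \<eta>(2) tendstoD[OF xlim \<eta>(1)] x01
    proof eventually_elim
      case (elim n)
      have "norm (mun n (x n) - mu v) \<le> e / 2"
        using elim v by (intro mean_diff) (auto simp: dist_real_def)
      then show ?case using e by (simp add: dist_norm)
    qed
  qed
  then show "(\<lambda>n. Df (mun n (real (nat \<lceil>real n * v\<rceil> - L n) / real n))) \<longlonglongrightarrow> Df (mu v)"
    unfolding x_def by (rule isCont_tendsto_compose[OF Df])
qed

text \<open>The constant 10 consists of 4 for the pilot error inside the window, where
  \<open>b \<le> sqrt n\<close>, of 2 for its product with the largest window, and of 4 for the
  drift. In the first two, \<open>sqrt n\<close> meets a total pilot error of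
  \<open>\<kappa> * sqrt n\<close>.\<close>

lemma plug_in_average_error:
  fixes Df :: "'a \<Rightarrow> 'a" and h :: "nat \<Rightarrow> 'a" and S :: "nat \<Rightarrow> nat \<Rightarrow> 'a"
  assumes F: "0 < F" and DfU: "\<And>x. x \<in> U \<Longrightarrow> norm (Df x) \<le> F"
    and lip: "\<And>x y. x \<in> U \<Longrightarrow> y \<in> U \<Longrightarrow> norm (Df x - Df y) \<le> F * norm (x - y)"
    and n: "0 < n" and b: "1 \<le> b" "real b \<le> sqrt (real n)"
    and T: "T \<subseteq> {lo + l..n - b}" "1 \<le> lo"
    and munU: "\<And>x. x \<in> {0..1} \<Longrightarrow> mun n x \<in> U"
    and hU: "\<And>t. t \<in> {lo..n} \<Longrightarrow> h t \<in> U"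
    and err: "(\<Sum>t\<in>{lo..n}. (norm (h t - mun n (real t / real n)))\<^sup>2) \<le> \<kappa> * sqrt (real n)"
    and drift: "(\<Sum>t\<in>{l..n - b}. \<Sum>i\<in>{1..b}. (norm (mun n (real (t + i) / real n) - mun n (real (t - l) / real n)))\<^sup>2) \<le> \<kappa> * real n"
    and max: "\<And>t. t \<in> {1..n - b} \<Longrightarrow> (norm (\<Sum>i\<in>{1..b}. S t i))\<^sup>2 \<le> real b * sqrt (real n)"
  shows "(\<Sum>t\<in>T. (Df (h (t - l)) \<bullet> (\<Sum>i\<in>{1..b}. S t i + mun n (real (t + i) / real n) - h (t - l))
      - Df (mun n (real (t - l) / real n)) \<bullet> (\<Sum>i\<in>{1..b}. S t i))\<^sup>2 / real b) \<le> 10 * F\<^sup>2 * \<kappa> * real n"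
proof -
  let ?x = "\<lambda>t. mun n (real (t - l) / real n)"
  let ?e = "\<lambda>t. h (t - l) - ?x t" and ?\<Delta> = "\<lambda>t i. mun n (real (t + i) / real n) - ?x t"
  have fT: "finite T" using T(1) finite_subset by blast
  have pt: "(Df (h (t - l)) \<bullet> (\<Sum>i\<in>{1..b}. S t i + mun n (real (t + i) / real n) - h (t - l))
      - Df (?x t) \<bullet> (\<Sum>i\<in>{1..b}. S t i))\<^sup>2 / real b
    \<le> 6 * F\<^sup>2 * sqrt (real n) * (norm (?e t))\<^sup>2 + 4 * F\<^sup>2 * (\<Sum>i\<in>{1..b}. (norm (?\<Delta> t i))\<^sup>2)" if t: "t \<in> T" for t
  proof -
    have tr: "t - l \<in> {lo..n}" "t \<in> {1..n - b}" using subsetD[OF T(1) t] T(2) by auto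
    have x01: "real (t - l) / real n \<in> {0..1}" using tr n by (auto simp: divide_le_eq)
    have eq: "Df (h (t - l)) \<bullet> (\<Sum>i\<in>{1..b}. S t i + mun n (real (t + i) / real n) - h (t - l))
      = Df (h (t - l)) \<bullet> (\<Sum>i\<in>{1..b}. S t i + ?\<Delta> t i - ?e t)"
      by (simp add: algebra_simps)
    have "(Df (h (t - l)) \<bullet> (\<Sum>i\<in>{1..b}. S t i + ?\<Delta> t i - ?e t) - Df (?x t) \<bullet> (\<Sum>i\<in>{1..b}. S t i))\<^sup>2 / real b
      \<le> 4 * F\<^sup>2 * real b * (norm (?e t))\<^sup>2 + 4 * F\<^sup>2 * (\<Sum>i\<in>{1..b}. (norm (?\<Delta> t i))\<^sup>2)
        + 2 * F\<^sup>2 * (norm (?e t))\<^sup>2 * (norm (\<Sum>i\<in>{1..b}. S t i))\<^sup>2 / real b"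
      using DfU[OF hU[OF tr(1)]] lip[OF hU[OF tr(1)] munU[OF x01]] b(1) by (rule plug_in_error)
    moreover have "4 * F\<^sup>2 * real b * (norm (?e t))\<^sup>2 \<le> 4 * F\<^sup>2 * sqrt (real n) * (norm (?e t))\<^sup>2"
      using b(2) by (intro mult_right_mono mult_left_mono) auto
    moreover have "2 * F\<^sup>2 * (norm (?e t))\<^sup>2 * (norm (\<Sum>i\<in>{1..b}. S t i))\<^sup>2 / real b \<le> 2 * F\<^sup>2 * (norm (?e t))\<^sup>2 * sqrt (real n)"
    proof -
      have "(norm (\<Sum>i\<in>{1..b}. S t i))\<^sup>2 / real b \<le> sqrt (real n)"
        using max[OF tr(2)] b(1) by (simp add: divide_le_eq mult.commute)
      then have "2 * F\<^sup>2 * (norm (?e t))\<^sup>2 * ((norm (\<Sum>i\<in>{1..b}. S t i))\<^sup>2 / real b) \<le> 2 * F\<^sup>2 * (norm (?e t))\<^sup>2 * sqrt (real n)"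
        by (rule mult_left_mono) simp
      then show ?thesis by simp
    qed
    moreover have "6 * F\<^sup>2 * sqrt (real n) * (norm (?e t))\<^sup>2 = 4 * F\<^sup>2 * sqrt (real n) * (norm (?e t))\<^sup>2 + 2 * F\<^sup>2 * (norm (?e t))\<^sup>2 * sqrt (real n)"
      by (simp add: algebra_simps)
    ultimately show ?thesis unfolding eq by linarith
  qed
  have "(\<Sum>t\<in>T. (Df (h (t - l)) \<bullet> (\<Sum>i\<in>{1..b}. S t i + mun n (real (t + i) / real n) - h (t - l))
      - Df (?x t) \<bullet> (\<Sum>i\<in>{1..b}. S t i))\<^sup>2 / real b)
    \<le> (\<Sum>t\<in>T. 6 * F\<^sup>2 * sqrt (real n) * (norm (?e t))\<^sup>2 + 4 * F\<^sup>2 * (\<Sum>i\<in>{1..b}. (norm (?\<Delta> t i))\<^sup>2))"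
    by (rule sum_mono[OF pt])
  also have "\<dots> = 6 * F\<^sup>2 * sqrt (real n) * (\<Sum>t\<in>T. (norm (?e t))\<^sup>2) + 4 * F\<^sup>2 * (\<Sum>t\<in>T. \<Sum>i\<in>{1..b}. (norm (?\<Delta> t i))\<^sup>2)"
    by (simp only: sum.distrib sum_distrib_left)
  also have "\<dots> \<le> 6 * F\<^sup>2 * sqrt (real n) * (\<kappa> * sqrt (real n)) + 4 * F\<^sup>2 * (\<kappa> * real n)"
  proof (intro add_mono mult_left_mono)
    \<comment> \<open>Truncated subtraction of \<open>l\<close> is injective here because all
      elements of \<open>T\<close> are at least \<open>l\<close>.\<close>
    have inj: "inj_on (\<lambda>t. t - l) T" 
    proof (rule inj_onI)
      fix s t assume "s \<in> T" "t \<in> T" "s - l = t - l"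
      moreover from this have "l \<le> s" "l \<le> t" using T(1) by auto
      ultimately show "s = t" by linarith
    qed
    have "(\<Sum>t\<in>T. (norm (?e t))\<^sup>2) = (\<Sum>s\<in>(\<lambda>t. t - l) ` T. (norm (h s - mun n (real s / real n)))\<^sup>2)"
      by (simp add: sum.reindex[OF inj])
    also have "\<dots> \<le> (\<Sum>s\<in>{lo..n}. (norm (h s - mun n (real s / real n)))\<^sup>2)"
    proof (rule sum_mono2)
      show "(\<lambda>t. t - l) ` T \<subseteq> {lo..n}"
      proof
        fix s assume "s \<in> (\<lambda>t. t - l) ` T"
        then obtain t where "t \<in> {lo + l..n - b}" "s = t - l" using T(1) by blast
        then show "s \<in> {lo..n}" by auto
      qed
    qed auto
    also note err
    finally show "(\<Sum>t\<in>T. (norm (?e t))\<^sup>2) \<le> \<kappa> * sqrt (real n)" .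
    have "(\<Sum>t\<in>T. \<Sum>i\<in>{1..b}. (norm (?\<Delta> t i))\<^sup>2) \<le> (\<Sum>t\<in>{l..n - b}. \<Sum>i\<in>{1..b}. (norm (?\<Delta> t i))\<^sup>2)"
      using T by (intro sum_mono2) (auto intro!: sum_nonneg)
    also note drift
    finally show "(\<Sum>t\<in>T. \<Sum>i\<in>{1..b}. (norm (?\<Delta> t i))\<^sup>2) \<le> \<kappa> * real n" .
  qed auto
  also have "\<dots> = 10 * F\<^sup>2 * \<kappa> * real n"
  proof -
    have "sqrt (real n) * (\<kappa> * sqrt (real n)) = \<kappa> * real n" by simp
    then have "6 * F\<^sup>2 * sqrt (real n) * (\<kappa> * sqrt (real n)) = 6 * F\<^sup>2 * (\<kappa> * real n)" by (simp only: mult.assoc)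
    then show ?thesis by simp
  qed
  finally show ?thesis .
qed

text \<open>The comparison is pathwise outside four exceptional events: a pilot outside
  \<open>U\<close>, a large total pilot error, a large window, or a deterministic-weight average
  away from its limit. The drift is not random and requires only large \<open>n\<close>.\<close>

lemma plug_in_pointwise:
  fixes Df :: "'a \<Rightarrow> 'a" and muhat :: "nat \<Rightarrow> nat \<Rightarrow> 'w \<Rightarrow> 'a" and tau L b :: "nat \<Rightarrow> nat"
  assumes F: "0 < F" and DfU: "\<And>x. x \<in> U \<Longrightarrow> norm (Df x) \<le> F"
    and lip: "\<And>x y. x \<in> U \<Longrightarrow> y \<in> U \<Longrightarrow> norm (Df x - Df y) \<le> F * norm (x - y)"
    and Df: "\<And>x. isCont Df x" and U: "U \<in> sets borel"
    and nbhd: "0 < r" "\<And>v x. v \<in> {0..1} \<Longrightarrow> norm (x - mu v) < r \<Longrightarrow> x \<in> U"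
    and muhat [measurable]: "\<And>n t. muhat n t \<in> borel_measurable M"
    and tau: "\<And>n. 1 \<le> tau n" and lo: "(\<lambda>n. real (tau n + L n) / real n) \<longlonglongrightarrow> 0"
    and b: "filterlim b at_top sequentially" and b3: "(\<lambda>n. real (b n) ^ 3 / real n) \<longlonglongrightarrow> 0"
    and rate1: "(\<lambda>n. real (b n) powr (max p 2 / 2) * real (b n + L n) / real n) \<longlonglongrightarrow> 0"
    and rate2: "(\<lambda>n. real (b n) powr (q / 2) * real n powr (1 - q / 4)) \<longlonglongrightarrow> 0"
    and A5: "\<And>\<kappa>. 0 < \<kappa> \<Longrightarrow> (\<lambda>n. prob {\<omega>\<in>space M.
        (\<Sum>t\<in>{tau n..n}. (norm (muhat n t \<omega> - mun n (real t / real n)))\<^sup>2) / sqrt (real n) > \<kappa>}) \<longlonglongrightarrow> 0"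
    and A6: "(\<lambda>n. prob {\<omega>\<in>space M. \<forall>t\<in>{tau n..n}. muhat n t \<omega> \<in> U}) \<longlonglongrightarrow> 1"
    and u: "0 \<le> u" "u \<le> 1"
  defines "Qu \<equiv> integral {0..u} (\<lambda>v. quad_form (longrun_cov M eps G v) (Df (mu v)))"
  shows "(\<lambda>v. quad_form (longrun_cov M eps G v) (Df (mu v))) integrable_on {0..u}"
    and "0 < e \<Longrightarrow> vanishing M (\<lambda>n. {\<omega> \<in> space M. e < \<bar>(1 / real n) *
        (\<Sum>t\<in>{tau n + L n..nat \<lfloor>real n * u\<rfloor> - b n}. (1 / real (b n)) * (Df (muhat n (t - L n) \<omega>) \<bullet>
          (\<Sum>i\<in>{1..b n}. Gn n (real (t + i) / real n) (epsvec eps (int (t + i)) \<omega>) - muhat n (t - L n) \<omega>))\<^sup>2) - Qu\<bar>})"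
proof -
  have munU: "\<forall>\<^sub>F n in sequentially. \<forall>x\<in>{0..1}. mun n x \<in> U"
    using mun_eventually_near[OF nbhd(1)] by eventually_elim (use nbhd(2) in blast)
  have Ln: "(\<lambda>n. real (L n) / real n) \<longlonglongrightarrow> 0"
    by (rule tendsto_sandwich[OF _ _ tendsto_const lo]) (auto intro!: always_eventually divide_right_mono)
  \<comment> \<open>The default 0 gives the bound \<open>F\<close> for all \<open>n\<close> and
    \<open>t\<close>; for large \<open>n\<close> it never occurs at grid points inside
    [0,1].\<close>
  define a where "a = (\<lambda>n t. if mun n (real (t - L n) / real n) \<in> U then Df (mun n (real (t - L n) / real n)) else 0)"
  have aF: "norm (a n t) \<le> F" for n t using DfU F by (auto simp: a_def)
  obtain N where N: "countable N"
    "\<And>v e. v \<in> {0..1} - N \<Longrightarrow> 0 < e \<Longrightarrow> \<exists>\<eta>>0. \<forall>\<^sub>F n in sequentially. \<forall>x\<in>{0..1}. \<bar>x - v\<bar> < \<eta> \<longrightarrow>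
      lq_le M q (\<lambda>\<omega>. Gn n x (epsvec eps 0 \<omega>) - G v (epsvec eps 0 \<omega>)) e"
    using equicontinuous_ae by blast
  have alim: "(\<lambda>n. a n (nat \<lceil>real n * v\<rceil>)) \<longlonglongrightarrow> Df (mu v)" if v: "0 < v" "v < 1" "v \<notin> N" for v
  proof -
    have v': "v \<in> {0..1} - N" using v by simp
    have lw1: "(\<lambda>n. Df (mun n (real (nat \<lceil>real n * v\<rceil> - L n) / real n))) \<longlonglongrightarrow> Df (mu v)"
      by (rule lagged_weight_lim(1)[OF _ v(1,2) Ln Df]) (rule N(2)[OF v'])
    have lw2: "\<forall>\<^sub>F n in sequentially. real (nat \<lceil>real n * v\<rceil> - L n) / real n \<in> {0..1}"
      by (rule lagged_weight_lim(2)[OF _ v(1,2) Ln Df]) (rule N(2)[OF v'])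
    have "\<forall>\<^sub>F n in sequentially. Df (mun n (real (nat \<lceil>real n * v\<rceil> - L n) / real n)) = a n (nat \<lceil>real n * v\<rceil>)"
      using munU lw2 by eventually_elim (simp only: a_def if_True)
    from Lim_transform_eventually[OF lw1 this] show ?thesis .
  qed
  have lo1: "1 \<le> tau n + L n" for n using tau[of n] by simp
  note avg = sqwin_average_lim[where a = a and \<alpha> = "\<lambda>v. Df (mu v)", OF aF F N(1) _ b b3 lo1 lo u]
  show "(\<lambda>v. quad_form (longrun_cov M eps G v) (Df (mu v))) integrable_on {0..u}" by (rule avg(1)[OF alim])
  assume e: "0 < e"
  define hi where "hi = (\<lambda>n. nat \<lfloor>real n * u\<rfloor> - b n)"
  define V where "V = (\<lambda>n \<omega>. (\<Sum>t\<in>{tau n + L n..hi n}. sqwin (a n t) n t (b n) (path \<omega>)) / real n)"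
  \<comment> \<open>Off the exceptional events the average of squares is at most
    \<open>|Qu| + 1\<close>, so the choices of \<open>\<theta>\<close> and \<open>\<kappa>\<close>
    let the two terms of \<open>abs_diff_squares_le\<close> contribute \<open>e / 4\<close> each.
    The bound \<open>e1 \<le> 1\<close> justifies the \<open>+ 1\<close>.\<close>
  define \<theta> where "\<theta> = e / (4 * (\<bar>Qu\<bar> + 1))"
  have \<theta>: "0 < \<theta>" using e by (simp add: \<theta>_def)
  define \<kappa> where "\<kappa> = e / 4 / ((1 + 1 / \<theta>) * (10 * F\<^sup>2))"
  have \<theta>F: "0 < (1 + 1 / \<theta>) * (10 * F\<^sup>2)" using \<theta> F by (simp add: add_pos_pos)
  have \<kappa>: "0 < \<kappa>" using e \<theta>F by (simp add: \<kappa>_def)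
  have \<kappa>_eq: "(1 + 1 / \<theta>) * (10 * F\<^sup>2 * \<kappa>) = e / 4"
  proof -
    have "(1 + 1 / \<theta>) * (10 * F\<^sup>2 * \<kappa>) = ((1 + 1 / \<theta>) * (10 * F\<^sup>2)) * \<kappa>" by (simp only: mult.assoc)
    also have "\<dots> = e / 4"
    proof -
      have "z * (e / 4 / z) = e / 4" if "0 < z" for z using that by simp
      from this[OF \<theta>F] show ?thesis unfolding \<kappa>_def .
    qed
    finally show ?thesis .
  qed
  define e1 where "e1 = min 1 (e / 4)"
  have e1: "0 < e1" "e1 \<le> 1" "e1 \<le> e / 4" using e by (auto simp: e1_def)
  let ?S = "\<lambda>n t \<omega>. \<Sum>i\<in>{1..b n}. Gn n (real (t + i) / real n) (epsvec eps (int (t + i)) \<omega>) - mun n (real (t + i) / real n)"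
  let ?B1 = "\<lambda>n. {\<omega> \<in> space M. \<not> (\<forall>t\<in>{tau n..n}. muhat n t \<omega> \<in> U)}"
  let ?B2 = "\<lambda>n. {\<omega> \<in> space M. (\<Sum>t\<in>{tau n..n}. (norm (muhat n t \<omega> - mun n (real t / real n)))\<^sup>2) / sqrt (real n) > \<kappa>}"
  let ?B3 = "\<lambda>n. {\<omega> \<in> space M. \<exists>t\<in>{1..n - b n}. real (b n) * sqrt (real n) \<le> (norm (?S n t \<omega>))\<^sup>2}"
  let ?B4 = "\<lambda>n. {\<omega> \<in> space M. e1 \<le> \<bar>V n \<omega> - Qu\<bar>}"
  have b1: "\<forall>\<^sub>F n in sequentially. 1 \<le> b n" using b by (simp add: filterlim_at_top)
  have bsq: "\<forall>\<^sub>F n in sequentially. real (b n) \<le> sqrt (real n)"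
    using order_tendstoD(2)[OF b3, of 1, simplified] b1 eventually_gt_at_top[of 0]
  proof eventually_elim
    case (elim n)
    have "(real (b n))\<^sup>2 \<le> real (b n) ^ 3" using elim(2) by (intro power_increasing) auto
    also have "\<dots> \<le> real n" using elim by (simp add: divide_less_eq)
    finally show ?case by (rule real_le_rsqrt)
  qed
  have bn: "\<forall>\<^sub>F n in sequentially. b n \<le> n"
    using bsq eventually_ge_at_top[of 1]
  proof eventually_elim
    case (elim n)
    have "sqrt (real n) \<le> sqrt (real n * real n)" using elim by (intro real_sqrt_le_mono) simp
    then show ?case using elim by simp
  qed
  have van1: "vanishing M ?B1"
  proof (rule vanishingI)
    have [measurable]: "{\<omega> \<in> space M. \<forall>t\<in>{tau n..n}. muhat n t \<omega> \<in> U} \<in> events" for n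
      using U by measurable
    show "?B1 n \<in> events" for n using U by measurable
    have "prob (?B1 n) = 1 - prob {\<omega>\<in>space M. \<forall>t\<in>{tau n..n}. muhat n t \<omega> \<in> U}" for n
      by (subst prob_compl[symmetric]) (auto intro!: arg_cong[where f=prob])
    then show "(\<lambda>n. prob (?B1 n)) \<longlonglongrightarrow> 0" using tendsto_diff[OF tendsto_const A6, of 1] by simp
  qed
  have van2: "vanishing M ?B2" by (rule vanishingI[OF _ A5[OF \<kappa>]]) measurable
  have van3: "vanishing M ?B3" by (rule max_window_vanishes[OF rate2 b bn])
  have van4: "vanishing M ?B4"
  proof (rule vanishingI)
    show "?B4 n \<in> events" for n unfolding V_def by measurable
    show "(\<lambda>n. prob (?B4 n)) \<longlonglongrightarrow> 0"
      unfolding V_def hi_def Qu_def by (rule avg(2)[OF alim e1(1)])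
  qed
  have drift: "\<forall>\<^sub>F n in sequentially. (\<Sum>t\<in>{L n..n - b n}. \<Sum>i\<in>{1..b n}.
     (norm (mun n (real (t + i) / real n) - mun n (real (t - L n) / real n)))\<^sup>2) / real n < \<kappa>"
    using order_tendstoD(2)[OF drift_vanishes[OF b rate1 bn] \<kappa>] .
  have van: "vanishing M (\<lambda>n. (?B1 n \<union> ?B2 n) \<union> (?B3 n \<union> ?B4 n))"
    by (intro vanishing_Un van1 van2 van3 van4)
  show "vanishing M (\<lambda>n. {\<omega> \<in> space M. e < \<bar>(1 / real n) *
        (\<Sum>t\<in>{tau n + L n..nat \<lfloor>real n * u\<rfloor> - b n}. (1 / real (b n)) * (Df (muhat n (t - L n) \<omega>) \<bullet>
          (\<Sum>i\<in>{1..b n}. Gn n (real (t + i) / real n) (epsvec eps (int (t + i)) \<omega>) - muhat n (t - L n) \<omega>))\<^sup>2) - Qu\<bar>})"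
  proof (rule vanishing_mono[OF van])
    show "\<forall>\<^sub>F n in sequentially. {\<omega> \<in> space M. e < \<bar>(1 / real n) *
        (\<Sum>t\<in>{tau n + L n..nat \<lfloor>real n * u\<rfloor> - b n}. (1 / real (b n)) * (Df (muhat n (t - L n) \<omega>) \<bullet>
          (\<Sum>i\<in>{1..b n}. Gn n (real (t + i) / real n) (epsvec eps (int (t + i)) \<omega>) - muhat n (t - L n) \<omega>))\<^sup>2) - Qu\<bar>}
      \<subseteq> (?B1 n \<union> ?B2 n) \<union> (?B3 n \<union> ?B4 n)"
      using munU b1 bsq bn drift eventually_gt_at_top[of 0]
    proof eventually_elim
      case (elim n)
      have n: "0 < real n" using elim by simp
      have hin: "T \<subseteq> {tau n + L n..n - b n}" if "T = {tau n + L n..hi n}" for T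
      proof -
        have "real n * u \<le> real n * 1" using u by (intro mult_left_mono) auto
        then have "nat \<lfloor>real n * u\<rfloor> \<le> n" by linarith
        then show ?thesis unfolding that hi_def by auto
      qed
      show ?case
      proof (intro subsetI, rule ccontr)
        fix \<omega>
        let ?T = "{tau n + L n..hi n}"
        define x where "x = (\<lambda>t. Df (muhat n (t - L n) \<omega>) \<bullet>
          (\<Sum>i\<in>{1..b n}. Gn n (real (t + i) / real n) (epsvec eps (int (t + i)) \<omega>) - muhat n (t - L n) \<omega>))"
        define y where "y = (\<lambda>t. Df (mun n (real (t - L n) / real n)) \<bullet> ?S n t \<omega>)"
        define Y where "Y = (1 / real n) * (\<Sum>t\<in>?T. (1 / real (b n)) * (x t)\<^sup>2)"
        assume "\<omega> \<in> {\<omega> \<in> space M. e < \<bar>(1 / real n) *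
        (\<Sum>t\<in>{tau n + L n..nat \<lfloor>real n * u\<rfloor> - b n}. (1 / real (b n)) * (Df (muhat n (t - L n) \<omega>) \<bullet>
          (\<Sum>i\<in>{1..b n}. Gn n (real (t + i) / real n) (epsvec eps (int (t + i)) \<omega>) - muhat n (t - L n) \<omega>))\<^sup>2) - Qu\<bar>}"
        then have \<omega>: "\<omega> \<in> space M" and big: "e < \<bar>Y - Qu\<bar>"
          unfolding Y_def x_def hi_def by auto
        assume "\<omega> \<notin> (?B1 n \<union> ?B2 n) \<union> (?B3 n \<union> ?B4 n)"
        then have g1: "\<And>t. t \<in> {tau n..n} \<Longrightarrow> muhat n t \<omega> \<in> U"
          and g2: "(\<Sum>t\<in>{tau n..n}. (norm (muhat n t \<omega> - mun n (real t / real n)))\<^sup>2) / sqrt (real n) \<le> \<kappa>"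
          and g3: "\<And>t. t \<in> {1..n - b n} \<Longrightarrow> (norm (?S n t \<omega>))\<^sup>2 \<le> real (b n) * sqrt (real n)"
          and g4: "\<bar>V n \<omega> - Qu\<bar> < e1"
          using \<omega> by (auto simp: not_less not_le intro: less_imp_le)
        have V_eq: "V n \<omega> = (\<Sum>t\<in>?T. (y t)\<^sup>2 / real (b n)) / real n"
        proof -
          have "sqwin (a n t) n t (b n) (path \<omega>) = (y t)\<^sup>2 / real (b n)" if t: "t \<in> ?T" for t
          proof -
            have "t - L n \<le> n" using t hin by auto
            then have "real (t - L n) / real n \<in> {0..1}" using n by (auto simp: divide_le_eq)
            then have "a n t = Df (mun n (real (t - L n) / real n))" using elim(1) by (simp only: a_def if_True)
            then show ?thesis by (simp only: sqwin_def win_def y_def epsvec_eq inner_sum_right)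
          qed
          then show ?thesis unfolding V_def by (intro arg_cong2[where f = "(/)"] sum.cong refl)
        qed
        have D: "(\<Sum>t\<in>?T. (x t - y t)\<^sup>2 / real (b n)) \<le> 10 * F\<^sup>2 * \<kappa> * real n"
        proof -
          have "(\<Sum>t\<in>?T. (Df (muhat n (t - L n) \<omega>) \<bullet> (\<Sum>i\<in>{1..b n}.
              (Gn n (real (t + i) / real n) (epsvec eps (int (t + i)) \<omega>) - mun n (real (t + i) / real n))
               + mun n (real (t + i) / real n) - muhat n (t - L n) \<omega>)
            - Df (mun n (real (t - L n) / real n)) \<bullet> ?S n t \<omega>)\<^sup>2 / real (b n)) \<le> 10 * F\<^sup>2 * \<kappa> * real n"
          proof (rule plug_in_average_error[OF F DfU lip _ elim(2,3) hin[OF refl] tau])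
            show "(\<Sum>t\<in>{tau n..n}. (norm (muhat n t \<omega> - mun n (real t / real n)))\<^sup>2) \<le> \<kappa> * sqrt (real n)"
              using g2 n by (simp add: divide_le_eq)
            show "(\<Sum>t\<in>{L n..n - b n}. \<Sum>i\<in>{1..b n}. (norm (mun n (real (t + i) / real n) - mun n (real (t - L n) / real n)))\<^sup>2) \<le> \<kappa> * real n"
              using elim(5) n by (simp add: divide_less_eq)
          qed (use elim g1 g3 in auto)
          then show ?thesis by (simp add: x_def y_def)
        qed
        have "\<bar>Y - V n \<omega>\<bar> = \<bar>\<Sum>t\<in>?T. ((x t)\<^sup>2 - (y t)\<^sup>2) / real (b n)\<bar> / real n"
        proof -
          have "Y - V n \<omega> = (\<Sum>t\<in>?T. ((x t)\<^sup>2 - (y t)\<^sup>2) / real (b n)) / real n"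
            unfolding Y_def V_eq by (simp add: diff_divide_distrib sum_subtractf)
          then show ?thesis using n by simp
        qed
        also have "\<dots> \<le> (\<Sum>t\<in>?T. (1 + 1 / \<theta>) * ((x t - y t)\<^sup>2 / real (b n)) + \<theta> * ((y t)\<^sup>2 / real (b n))) / real n"
        proof (intro divide_right_mono order_trans[OF sum_abs] sum_mono)
          fix t
          have "\<bar>((x t)\<^sup>2 - (y t)\<^sup>2) / real (b n)\<bar> = \<bar>(x t)\<^sup>2 - (y t)\<^sup>2\<bar> / real (b n)" by simp
          also have "\<dots> \<le> ((1 + 1 / \<theta>) * (x t - y t)\<^sup>2 + \<theta> * (y t)\<^sup>2) / real (b n)"
            by (intro divide_right_mono abs_diff_squares_le \<theta>) simp
          finally show "\<bar>((x t)\<^sup>2 - (y t)\<^sup>2) / real (b n)\<bar> \<le> (1 + 1 / \<theta>) * ((x t - y t)\<^sup>2 / real (b n)) + \<theta> * ((y t)\<^sup>2 / real (b n))"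
            by (simp add: add_divide_distrib)
        qed (use n in simp)
        also have "\<dots> = (1 + 1 / \<theta>) * (\<Sum>t\<in>?T. (x t - y t)\<^sup>2 / real (b n)) / real n + \<theta> * V n \<omega>"
          unfolding V_eq by (simp only: sum.distrib sum_distrib_left[symmetric] add_divide_distrib) simp
        also have "\<dots> \<le> (1 + 1 / \<theta>) * (10 * F\<^sup>2 * \<kappa> * real n) / real n + \<theta> * (\<bar>Qu\<bar> + 1)"
          using D g4 e1 \<theta> by (intro add_mono divide_right_mono mult_left_mono) auto
        also have "(1 + 1 / \<theta>) * (10 * F\<^sup>2 * \<kappa> * real n) / real n = e / 4"
          unfolding \<kappa>_eq[symmetric] using n by simp
        also have "\<theta> * (\<bar>Qu\<bar> + 1) = e / 4" unfolding \<theta>_def by (simp add: field_simps)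
        finally have "\<bar>Y - V n \<omega>\<bar> \<le> e / 2" by simp
        then show False using g4 e1 big by linarith
      qed
    qed
  qed
qed

end

section \<open>Rates and conclusion\<close>

lemma lq_le_of_moment:
  assumes "Lq_moment M q Y \<le> ennreal (c powr q)" "Y \<in> borel_measurable M" "0 \<le> c" "c \<le> c'" "0 < c'" "0 \<le> q"
  shows "lq_le M q Y c'"
proof -
  have "ennreal (c powr q) \<le> ennreal (c' powr q)" using assms by (intro ennreal_leI powr_mono2) auto
  then show ?thesis using assms lq_le_iff_moment[OF assms(2,5)] by (meson order_trans)
qed

text \<open>As \<open>max p 2\<close> is at least 2, the exponent is at most 1/3.\<close>

lemma bandwidth_cubed_rate:
  fixes p :: real
  assumes "(\<lambda>n. real (b n) / real n powr (2 / (3 * max p 2))) \<longlonglongrightarrow> 0"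
  shows "(\<lambda>n. real (b n) ^ 3 / real n) \<longlonglongrightarrow> 0"
proof -
  have "2 / (3 * max p 2) \<le> 1 / 3" by (simp add: divide_simps)
  from tendsto_ratio_mono[OF assms this]
  have "(\<lambda>n. real (b n) / real n powr (1 / 3)) \<longlonglongrightarrow> 0" by simp
  from tendsto_power[OF this, of 3] have "(\<lambda>n. (real (b n) / real n powr (1 / 3)) ^ 3) \<longlonglongrightarrow> 0" by simp
  moreover have "(real (b n) / real n powr (1 / 3)) ^ 3 = real (b n) ^ 3 / real n" for n
  proof (cases "n = 0")
    case False
    then have "(real n powr (1 / 3)) ^ 3 = real n" by (simp add: powr_realpow[symmetric] powr_powr del: powr_numeral)
    then show ?thesis by (simp add: power_divide)
  qed simp
  ultimately show ?thesis by simp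
qed

text \<open>Raised to the power \<open>P / 2\<close>, the exponent \<open>2 / (3 * P)\<close>
  becomes 1/3, and \<open>b + L\<close> is of smaller order than \<open>n^(2/3)\<close>; the two
  rates multiply to \<open>n\<close>.\<close>

lemma drift_rate:
  fixes p :: real
  assumes b: "(\<lambda>n. real (b n) / real n powr (2 / (3 * max p 2))) \<longlonglongrightarrow> 0"
    and L: "(\<lambda>n. real (L n) / real n powr (1 / (2 * p))) \<longlonglongrightarrow> 0" and p: "1 \<le> p"
  shows "(\<lambda>n. real (b n) powr (max p 2 / 2) * real (b n + L n) / real n) \<longlonglongrightarrow> 0"
proof -
  define P where "P = max p 2"
  have P: "2 \<le> P" by (simp add: P_def)
  have "(\<lambda>n. (real (b n) / real n powr (2 / (3 * P))) powr (P / 2)) \<longlonglongrightarrow> 0"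
    using tendsto_zero_powrI[OF b[folded P_def] tendsto_const, of "P / 2"] P by simp
  moreover have "(real (b n) / real n powr (2 / (3 * P))) powr (P / 2) = real (b n) powr (P / 2) / real n powr (1 / 3)" for n
    using P by (simp add: powr_divide powr_powr)
  ultimately have 1: "(\<lambda>n. real (b n) powr (P / 2) / real n powr (1 / 3)) \<longlonglongrightarrow> 0" by simp
  have "2 / (3 * P) \<le> 2 / 3" using P by (simp add: divide_simps)
  from tendsto_ratio_mono[OF b[folded P_def] this]
  have 2: "(\<lambda>n. real (b n) / real n powr (2 / 3)) \<longlonglongrightarrow> 0" by simp
  have "1 / (2 * p) \<le> 2 / 3" using p by (simp add: divide_simps)
  from tendsto_ratio_mono[OF L this]
  have 3: "(\<lambda>n. real (L n) / real n powr (2 / 3)) \<longlonglongrightarrow> 0" by simp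
  have "(\<lambda>n. real (b n) powr (P / 2) / real n powr (1 / 3) * (real (b n) / real n powr (2 / 3) + real (L n) / real n powr (2 / 3))) \<longlonglongrightarrow> 0 * (0 + 0)"
    by (intro tendsto_mult tendsto_add 1 2 3)
  moreover have "real (b n) powr (P / 2) / real n powr (1 / 3) * (real (b n) / real n powr (2 / 3) + real (L n) / real n powr (2 / 3))
     = real (b n) powr (P / 2) * real (b n + L n) / real n" for n
  proof -
    have "real n powr (1 / 3) * real n powr (2 / 3) = real n" by (simp add: powr_add[symmetric])
    then show ?thesis by (simp add: add_divide_distrib[symmetric])
  qed
  ultimately show ?thesis by (simp add: P_def)
qed

text \<open>Inserting the rate of \<open>b\<close> leaves \<open>n\<close> with the exponent
  \<open>- (q - 4) / (2 * (q + 2))\<close>, which is negative for \<open>q > 4\<close>.\<close>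

lemma max_window_rate:
  fixes q :: real
  assumes b: "(\<lambda>n. real (b n) / real n powr ((q - 4) / (2 * q + 4))) \<longlonglongrightarrow> 0" and q: "4 < q"
  shows "(\<lambda>n. real (b n) powr (q / 2) * real n powr (1 - q / 4)) \<longlonglongrightarrow> 0"
proof -
  define s where "s = (q - 4) / (2 * q + 4)"
  have lim: "(\<lambda>n. (real (b n) / real n powr s) powr (q / 2)) \<longlonglongrightarrow> 0"
    using tendsto_zero_powrI[OF b[folded s_def] tendsto_const, of "q / 2"] q by simp
  have "s * (q / 2) + (1 - q / 4) = - (q - 4) / (2 * (q + 2))"
    using q by (simp add: s_def divide_simps) (simp add: algebra_simps)
  also have "\<dots> \<le> 0" using q by (intro divide_nonpos_nonneg) auto
  finally have neg: "s * (q / 2) + (1 - q / 4) \<le> 0" .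
  show ?thesis
  proof (rule tendsto_sandwich[OF _ _ tendsto_const lim])
    show "\<forall>\<^sub>F n in sequentially. real (b n) powr (q / 2) * real n powr (1 - q / 4) \<le> (real (b n) / real n powr s) powr (q / 2)"
      using eventually_ge_at_top[of 1]
    proof eventually_elim
      case (elim n)
      have "real n powr (s * (q / 2)) * real n powr (1 - q / 4) \<le> real n powr 0"
        unfolding powr_add[symmetric] using elim neg by (intro powr_mono) auto
      then have "real n powr (1 - q / 4) \<le> 1 / real n powr (s * (q / 2))"
        using elim by (simp add: le_divide_eq mult.commute)
      then have "real (b n) powr (q / 2) * real n powr (1 - q / 4) \<le> real (b n) powr (q / 2) * (1 / real n powr (s * (q / 2)))"
        by (rule mult_left_mono) simp
      then show ?case by (simp add: powr_divide powr_powr)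
    qed
  qed simp
qed

theorem theorem3p3:
  fixes M :: "'w measure"
    and eps epsS :: "int \<Rightarrow> 'w \<Rightarrow> real"
    and Gn :: "nat \<Rightarrow> real \<Rightarrow> (nat \<Rightarrow> real) \<Rightarrow> 'a::euclidean_space"
    and G :: "real \<Rightarrow> (nat \<Rightarrow> real) \<Rightarrow> 'a"
    and f :: "'a \<Rightarrow> real" and Df :: "'a \<Rightarrow> 'a" and D2f :: "'a \<Rightarrow> 'a \<Rightarrow> 'a"
    and muhat :: "nat \<Rightarrow> nat \<Rightarrow> 'w \<Rightarrow> 'a"
    and tau L b :: "nat \<Rightarrow> nat"
    and q p :: real and \<delta> :: ereal
    and mun :: "nat \<Rightarrow> real \<Rightarrow> 'a" and mu :: "real \<Rightarrow> 'a" and Mdelta :: "'a set"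
    and X :: "nat \<Rightarrow> nat \<Rightarrow> 'w \<Rightarrow> 'a"
    and Qn :: "nat \<Rightarrow> real \<Rightarrow> 'w \<Rightarrow> real" and Q :: "real \<Rightarrow> real"
  assumes mun_def: "mun = (\<lambda>n u. \<integral>\<omega>. Gn n u (epsvec eps 0 \<omega>) \<partial>M)"
    and mu_def: "mu = (\<lambda>u. \<integral>\<omega>. G u (epsvec eps 0 \<omega>) \<partial>M)"
    and Mdelta_def: "Mdelta = {x. ereal (infdist x (convex hull (mu ` {0..1}))) < \<delta>}"
    and X_def: "X = (\<lambda>t n \<omega>. Gn n (real t / real n) (epsvec eps (int t) \<omega>))"
    and Qn_def: "Qn = (\<lambda>n u \<omega>. (1 / real n) *
           (\<Sum>t\<in>{tau n + L n .. nat \<lfloor>real n * u\<rfloor> - b n}.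
              (1 / real (b n)) *
              (Df (muhat n (t - L n) \<omega>) \<bullet> (\<Sum>i\<in>{1..b n}. X (t + i) n \<omega> - muhat n (t - L n) \<omega>))\<^sup>2))"
    and Q_def: "Q = (\<lambda>u. integral {0..u} (\<lambda>v. quad_form (longrun_cov M eps G v) (Df (mu v))))"
    and M: "prob_space M"
    \<comment> \<open>i.i.d. innovations and an independent copy\<close>
    and eps_meas: "\<And>i. eps i \<in> borel_measurable M" "\<And>i. epsS i \<in> borel_measurable M"
    and eps_indep: "prob_space.indep_vars M (\<lambda>_. borel)
                      (\<lambda>k. case k of Inl i \<Rightarrow> eps i | Inr i \<Rightarrow> epsS i) (UNIV :: (int + int) set)"
    and eps_ident: "\<And>i. distr M borel (eps i) = distr M borel (eps 0)"
                   "\<And>i. distr M borel (epsS i) = distr M borel (eps 0)"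
    \<comment> \<open>measurable kernels\<close>
    and Gn_meas: "\<And>n. (\<lambda>(u, x). Gn n u x) \<in> borel_measurable (borel \<Otimes>\<^sub>M (\<Pi>\<^sub>M k\<in>(UNIV::nat set). borel))"
    and G_meas: "(\<lambda>(u, x). G u x) \<in> borel_measurable (borel \<Otimes>\<^sub>M (\<Pi>\<^sub>M k\<in>(UNIV::nat set). borel))"
    \<comment> \<open>(A.1)\<close>
    and A1: "\<forall>e>0. \<forall>\<^sub>F n in sequentially. \<forall>u\<in>{0..1}.
               Lq_moment M q (\<lambda>\<omega>. Gn n u (epsvec eps 0 \<omega>) - G u (epsvec eps 0 \<omega>)) \<le> ennreal (e powr q)"
    \<comment> \<open>(A.2) and (A.3)\<close>
    and A23: "\<exists>C\<ge>0.
        (\<forall>n. \<forall>u\<in>{0..1}. Lq_moment M q (\<lambda>\<omega>. Gn n u (epsvec eps 0 \<omega>)) \<le> ennreal (C powr q)) \<and>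
        (\<forall>n m (us::nat \<Rightarrow> real). us 0 = 0 \<and> us m = 1 \<and> strict_mono_on {0..m} us \<longrightarrow>
            (\<Sum>i\<in>{1..m}. Lq_norm M q (\<lambda>\<omega>. Gn n (us i) (epsvec eps 0 \<omega>) - Gn n (us (i - 1)) (epsvec eps 0 \<omega>)) powr p)
              \<le> C powr p) \<and>
        (\<exists>\<rho>. 0 < \<rho> \<and> \<rho> < 1 \<and>
           (\<forall>j n (t::int). \<forall>u\<in>{0..1}.
              Lq_moment M q (\<lambda>\<omega>. Gn n u (epsvec eps t \<omega>) - Gn n u (epstilde eps epsS t j \<omega>))
                \<le> ennreal ((C * \<rho> ^ j) powr q)))"
    \<comment> \<open>f twice differentiable, (A.4)\<close>
    and f_deriv: "\<And>x. (f has_derivative (\<lambda>h. Df x \<bullet> h)) (at x)"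
    and Df_deriv: "\<And>x. (Df has_derivative D2f x) (at x)"
    and delta_pos: "\<delta> > 0"
    and A4: "\<exists>Cf. \<forall>x\<in>Mdelta. \<bar>f x\<bar> + norm (Df x) + onorm (D2f x) \<le> Cf"
    \<comment> \<open>pilot estimators\<close>
    and muhat_meas: "\<And>n t. muhat n t \<in> borel_measurable
                        (sigma (space M) {eps s -` A \<inter> space M | s A. s \<le> int t \<and> A \<in> sets borel})"
    and tau_pos: "\<And>n. tau n \<ge> 1"
    and L_lim: "filterlim L at_top sequentially"
    and L_tau: "(\<lambda>n. real (L n) / real (tau n)) \<longlonglongrightarrow> 0"
    and A5: "\<forall>e>0. (\<lambda>n. measure M {\<omega>\<in>space M.
               (\<Sum>t\<in>{tau n..n}. (norm (muhat n t \<omega> - mun n (real t / real n)))\<^sup>2) / sqrt (real n) > e})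
             \<longlonglongrightarrow> 0"
    and A6: "(\<lambda>n. measure M {\<omega>\<in>space M. \<forall>t\<in>{tau n..n}. muhat n t \<omega> \<in> Mdelta}) \<longlonglongrightarrow> 1"
    and tau_n: "(\<lambda>n. real (tau n) / real n) \<longlonglongrightarrow> 0"
    and L_log: "\<exists>a. 0 < a \<and> a < 1 \<and> (\<lambda>n. ln (real n) powr (1 + a) / real (L n)) \<longlonglongrightarrow> 0"
    and L_rate1: "(\<lambda>n. real (L n) / real n powr (1 / p - 1 / 4)) \<longlonglongrightarrow> 0"
    and L_rate2: "(\<lambda>n. real (L n) / real n powr (1 / (2 * p))) \<longlonglongrightarrow> 0"
    \<comment> \<open>hypotheses of the theorem\<close>
    and q_gt: "q > 4" and p_ge: "1 \<le> p" and p_lt: "p < 4"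
    and b_lim: "filterlim b at_top sequentially"
    and b_rate1: "(\<lambda>n. real (b n) / real n powr (2 / (3 * max p 2))) \<longlonglongrightarrow> 0"
    and b_rate2: "(\<lambda>n. real (b n) / real n powr ((q - 4) / (2 * q + 4))) \<longlonglongrightarrow> 0"
  shows "\<forall>e>0. (\<lambda>n. measure M {\<omega>\<in>space M. \<exists>u\<in>{0..1}. \<bar>Qn n u \<omega> - Q u\<bar> > e}) \<longlonglongrightarrow> 0"
proof -
  interpret prob_space M by (rule M)
  have indep: "indep_vars (\<lambda>_. borel) (case_sum eps epsS) UNIV" using eps_indep .
  interpret innovations M eps epsS "distr M borel (eps 0)"
    by unfold_locales (use indep eps_ident in \<open>auto split: sum.splits\<close>)
  obtain C0 \<rho> where C0: "0 \<le> C0" and \<rho>: "0 < \<rho>" "\<rho> < 1"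
    and mom: "\<And>n u. u \<in> {0..1} \<Longrightarrow> Lq_moment M q (\<lambda>\<omega>. Gn n u (epsvec eps 0 \<omega>)) \<le> ennreal (C0 powr q)"
    and pvar: "\<And>n m us. us 0 = 0 \<Longrightarrow> us m = 1 \<Longrightarrow> strict_mono_on {0..m::nat} us \<Longrightarrow>
      (\<Sum>i\<in>{1..m}. Lq_norm M q (\<lambda>\<omega>. Gn n (us i) (epsvec eps 0 \<omega>) - Gn n (us (i - 1)) (epsvec eps 0 \<omega>)) powr p)
        \<le> C0 powr p"
    and coup: "\<And>j n t u. u \<in> {0..1} \<Longrightarrow>
      Lq_moment M q (\<lambda>\<omega>. Gn n u (epsvec eps t \<omega>) - Gn n u (epstilde eps epsS t j \<omega>)) \<le> ennreal ((C0 * \<rho> ^ j) powr q)"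
    using A23 by (elim exE conjE) blast
  have [measurable]: "Gn n u \<in> borel_measurable seqM" for n u
    using measurable_compose[OF measurable_Pair1' Gn_meas[of n], of u] by simp
  have [measurable]: "G u \<in> borel_measurable seqM" for u
    using measurable_compose[OF measurable_Pair1' G_meas, of u] by simp
  have [measurable]: "epsvec eps s \<in> M \<rightarrow>\<^sub>M seqM" for s
    unfolding epsvec_eq[abs_def] by measurable
  have [measurable]: "epstilde eps epsS s j \<in> M \<rightarrow>\<^sub>M seqM" for s j
  proof -
    have "epstilde eps epsS s j = reindex (\<lambda>k. if k = j then Inr (s - int j) else Inl (s - int k))"
      by (auto simp: epstilde_def reindex_def fun_eq_iff)
    then show ?thesis by simp
  qed
  have q0: "0 \<le> q" using q_gt by simp
  \<comment> \<open>The constant \<open>C0\<close> may be 0 while \<open>lq_le\<close> requires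
    positive bounds; adding 1 preserves all upper bounds.\<close>
  interpret ls: locally_stationary M eps epsS "distr M borel (eps 0)" Gn G q p "C0 + 1" \<rho>
  proof unfold_locales
    show "\<forall>\<^sub>F n in sequentially. \<forall>u\<in>{0..1}.
      lq_le M q (\<lambda>\<omega>. Gn n u (epsvec eps 0 \<omega>) - G u (epsvec eps 0 \<omega>)) e" if e: "0 < e" for e
      using A1[rule_format, OF e]
    proof eventually_elim
      case (elim n)
      show ?case
      proof
        fix u :: real assume u: "u \<in> {0..1}"
        show "lq_le M q (\<lambda>\<omega>. Gn n u (epsvec eps 0 \<omega>) - G u (epsvec eps 0 \<omega>)) e"
          by (rule lq_le_of_moment[OF bspec[OF elim u]]) (use e q0 in auto)
      qed
    qed
    show "lq_le M q (\<lambda>\<omega>. Gn n u (epsvec eps 0 \<omega>)) (C0 + 1)" if "u \<in> {0..1}" for n u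
      by (rule lq_le_of_moment[OF mom[OF that]]) (use C0 q0 in auto)
    show "lq_le M q (\<lambda>\<omega>. Gn n u (epsvec eps t \<omega>) - Gn n u (epstilde eps epsS t j \<omega>)) ((C0 + 1) * \<rho> ^ j)"
      if "u \<in> {0..1}" for j n t u
      by (rule lq_le_of_moment[OF coup[OF that]]) (use C0 q0 \<rho> in auto)
    show "(\<Sum>i\<in>{1..m}. Lq_norm M q (\<lambda>\<omega>. Gn n (us i) (epsvec eps 0 \<omega>) - Gn n (us (i - 1)) (epsvec eps 0 \<omega>)) powr p)
        \<le> (C0 + 1) powr p" if "us 0 = 0" "us m = 1" "strict_mono_on {0..m} us" for n m and us :: "nat \<Rightarrow> real"
      using pvar[OF that, of n] by (rule order_trans) (use C0 p_ge in \<open>auto intro: powr_mono2\<close>)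
  qed (use q_gt p_ge C0 \<rho> in auto)
  have mun_eq: "mun = ls.mun" by (simp add: mun_def ls.mun_def fun_eq_iff)
  have mu_eq: "mu = ls.mu" by (simp add: mu_def ls.mu_def fun_eq_iff)
  let ?S = "convex hull (mu ` {0..1})"
  have S: "convex ?S" "?S \<noteq> {}" by (auto simp: convex_convex_hull)
  note nb = infdist_nbhd[OF S delta_pos, folded Mdelta_def]
  obtain r where r: "0 < r" "\<And>s x. s \<in> ?S \<Longrightarrow> norm (x - s) < r \<Longrightarrow> x \<in> Mdelta" using nb(3) by blast
  obtain Cf where Cf: "\<And>x. x \<in> Mdelta \<Longrightarrow> \<bar>f x\<bar> + norm (Df x) + onorm (D2f x) \<le> Cf" using A4 by blast
  \<comment> \<open>One positive constant bounds the gradient and, through the operator norm of its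
    derivative, the Lipschitz constant of the gradient.\<close>
  define F where "F = \<bar>Cf\<bar> + 1"
  have F: "0 < F" by (simp add: F_def)
  have D2: "0 \<le> onorm (D2f x)" for x by (rule onorm_pos_le[OF has_derivative_bounded_linear[OF Df_deriv]])
  have DfU: "norm (Df x) \<le> F" if "x \<in> Mdelta" for x using Cf[OF that] D2[of x] unfolding F_def by linarith
  have D2F: "onorm (D2f x) \<le> F" if "x \<in> Mdelta" for x
    using Cf[OF that] norm_ge_zero[of "Df x"] unfolding F_def by linarith
  \<comment> \<open>The mean value inequality along segments, which stay in \<open>Mdelta\<close> by
    convexity.\<close>
  have lip: "norm (Df x - Df y) \<le> F * norm (x - y)" if "x \<in> Mdelta" "y \<in> Mdelta" for x y
    by (rule differentiable_bound[OF nb(1) _ D2F that]) (auto intro: has_derivative_at_withinI[OF Df_deriv])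
  have near: "x \<in> Mdelta" if "v \<in> {0..1}" "norm (x - ls.mu v) < r" for v x
    by (rule r(2)[of "mu v"]) (use that in \<open>auto simp: mu_eq intro: hull_inc\<close>)
  have sub: "sets (sigma (space M) {eps s -` A \<inter> space M | s A. s \<le> int t \<and> A \<in> sets borel}) \<subseteq> sets M" for t
    using eps_meas(1) by (subst sets_measure_of) (auto intro!: sets.sigma_sets_subset)
  have mh: "muhat n t \<in> borel_measurable M" for n t
    using muhat_meas[of n t] sub[of t] unfolding measurable_def by (auto simp: space_measure_of_conv)
  have Ln: "(\<lambda>n. real (L n) / real n) \<longlonglongrightarrow> 0"
  proof -
    have "(\<lambda>n. real (L n) / real (tau n) * (real (tau n) / real n)) \<longlonglongrightarrow> 0 * 0" by (intro tendsto_mult L_tau tau_n)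
    moreover have "real (L n) / real (tau n) * (real (tau n) / real n) = real (L n) / real n" for n
      using tau_pos[of n] by simp
    ultimately show ?thesis by (simp only: mult_zero_left)
  qed
  have lo: "(\<lambda>n. real (tau n + L n) / real n) \<longlonglongrightarrow> 0"
    using tendsto_add[OF tau_n Ln] by (simp add: add_divide_distrib)
  note pw = ls.plug_in_pointwise[where U = Mdelta and Df = Df and muhat = muhat, OF F DfU lip _ nb(2) r(1) near mh tau_pos lo
      b_lim bandwidth_cubed_rate[OF b_rate1] drift_rate[OF b_rate1 L_rate2 p_ge] max_window_rate[OF b_rate2 q_gt]]
  have cont: "isCont Df x" for x using has_derivative_continuous[OF Df_deriv] .
  show ?thesis
  proof (intro allI impI vanishing_prob)
    fix e :: real assume e: "0 < e"
    show "vanishing M (\<lambda>n. {\<omega>\<in>space M. \<exists>u\<in>{0..1}. \<bar>Qn n u \<omega> - Q u\<bar> > e})"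
    proof (rule monotone_uniform_vanishing[OF _ _ _ e])
      \<comment> \<open>The summands are squares and the index ranges are nested, so the estimator
        is monotone along every path.\<close>
      show "Qn n u \<omega> \<le> Qn n v \<omega>" if "0 \<le> u" "u \<le> v" "v \<le> 1" for n u v \<omega>
      proof -
        have "nat \<lfloor>real n * u\<rfloor> \<le> nat \<lfloor>real n * v\<rfloor>"
          using that by (intro nat_mono floor_mono mult_left_mono) auto
        then have "{tau n + L n..nat \<lfloor>real n * u\<rfloor> - b n} \<subseteq> {tau n + L n..nat \<lfloor>real n * v\<rfloor> - b n}" by auto
        then show ?thesis unfolding Qn_def by (intro mult_left_mono sum_mono2) auto
      qed
      show "continuous_on {0..1} Q"
        unfolding Q_def mu_eq by (rule indefinite_integral_continuous_1, rule pw(1))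
          (use cont A5 A6 in \<open>auto simp: mun_eq\<close>)
      fix u d :: real assume u: "0 \<le> u" "u \<le> 1" and d: "0 < d"
      show "vanishing M (\<lambda>n. {\<omega> \<in> space M. d < \<bar>Qn n u \<omega> - Q u\<bar>})"
        unfolding Qn_def Q_def X_def mu_eq by (rule pw(2))
          (use cont A5 A6 u d in \<open>auto simp: mun_eq\<close>)
    qed
  qed
qed

end
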